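(* Let $(E,F)$ be a complex Finsler Lie algebroid with convex $F$, let $N_k^\beta=h^{\bar\sigma\beta}\partial_k\dot\partial_{\bar\sigma}F$, let $N_\alpha^\beta=\rho_\alpha^kN_k^\beta$ be the coefficients of the induced nonlinear connection on $\mathcal T_{\mathbb C}E$, and let $$L^{\gamma}_{\alpha k}=h^{\bar\sigma\gamma}\,\delta_k h_{\alpha\bar\sigma},\qquad C^{\gamma}_{\alpha\beta}=h^{\bar\sigma\gamma}\,\dot\partial_\beta h_{\alpha\bar\sigma}.$$ Then the functions $$L^{\gamma}_{\alpha\beta}=\rho^k_\beta L^{\gamma}_{\alpha k}=h^{\bar\sigma\gamma}\,\delta_\beta h_{\alpha\bar\sigma}$$ are the coefficients of a linear connection $\mathcal D$ of $(1,0)$-type on $\mathcal T_{\mathbb C}E$ (called the Chern-Finsler connection of the algebroid $E$). It is induced by the vertical connection with coefficients $(L^\gamma_{\alpha k},C^\gamma_{\alpha\beta})$; that is, in every adapted frame $\mathcal D_{\mathcal X_\beta}\mathcal X_\alpha=L^\gamma_{\alpha\beta}\mathcal X_\gamma$, $\mathcal D_{\mathcal X_\beta}\mathcal V_\alpha=L^\gamma_{\alpha\beta}\mathcal V_\gamma$, $\mathcal D_{\mathcal V_\beta}\mathcal X_\alpha=C^\gamma_{\alpha\beta}\mathcal X_\gamma$, $\mathcal D_{\mathcal V_\beta}\mathcal V_\alpha=C^\gamma_{\alpha\beta}\mathcal V_\gamma$.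
   Context: Holomorphic Lie algebroid. $M$ is a complex manifold of dimension $n$ and $\pi:E\to M$ a holomorphic vector bundle of rank $m$ with a holomorphic bundle morphism $\rho:E\to T'M$ (anchor; $T'M$ is the holomorphic tangent bundle) and a Lie bracket $[\cdot,\cdot]_E$ on holomorphic sections such that $[s_1,fs_2]_E=f[s_1,s_2]_E+\rho(s_1)(f)s_2$ for holomorphic $f$. In local coordinates $(z^k)$ of $M$ and a local holomorphic frame $(e_\alpha)$ of $E$ one has coordinates $(z^k,u^\alpha)$ on $E$ ($u=u^\alpha e_\alpha$), $\rho(e_\alpha)=\rho^k_\alpha(z)\,\partial/\partial z^k$, $[e_\alpha,e_\beta]_E=\mathcal C^\gamma_{\alpha\beta}(z)e_\gamma$. Latin indices run over $1,\dots,n$, Greek over $1,\dots,m$; repeated indices are summed; barred indices refer to complex conjugates. Write $\partial_k=\partial/\partial z^k$, $\dot\partial_\alpha=\partial/\partial u^\alpha$, $\partial_{\bar k}=\partial/\partial\bar z^k$, $\dot\partial_{\bar\alpha}=\partial/\partial\bar u^\alpha$. Chart changes on $E$ are $\widetilde z^k=\widetilde z^k(z)$, $\widetilde u^\alpha=M^\alpha_\beta(z)u^\beta$ with $M$ holomorphic and invertible; $W=M^{-1}$, so $\widetilde e_\alpha=W^\beta_\alpha e_\beta$. Prolongation. $\mathcal T'E=\{(e,v)\in E\times T'E:\rho(e)=\pi'_*(v)\}$ is a holomorphic vector bundle of rank $2m$ over $E$ (fibre over $u$: pairs with $e\in E_{\pi(u)}$, $v\in T'_uE$), with local frame $\mathcal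 Z_\alpha(u)=(e_\alpha(\pi(u)),\rho^k_\alpha\partial_k|_u)$, $\mathcal V_\alpha(u)=(0,\dot\partial_\alpha|_u)$. The complexified prolongation is $\mathcal T_{\mathbb C}E=\mathcal T'E\oplus\overline{\mathcal T'E}$, with frame $\{\mathcal Z_\alpha,\mathcal V_\alpha,\mathcal Z_{\bar\alpha},\mathcal V_{\bar\alpha}\}$ (the last two being conjugates) and anchor $\rho_{\mathcal T}(e,v)=v\in T_{\mathbb C}E$ (the complexified tangent bundle of $E$). Nonlinear connection. Given local functions $N^\beta_k$ which are the coefficients of a nonlinear connection on $T'E$, put $\delta_k=\partial_k-N_k^\beta\dot\partial_\beta$, $N_\alpha^\beta=\rho^k_\alpha N^\beta_k$, $\delta_\alpha=\rho^k_\alpha\delta_k$, and $\mathcal X_\alpha=\mathcal Z_\alpha-N_\alpha^\beta\mathcal V_\beta$. The frame $\{\mathcal X_\alpha,\mathcal V_\alpha,\mathcal X_{\bar\alpha},\mathcal V_{\bar\alpha}\}$ (with conjugates) is the adapted frame of the induced nonlinear connection on $\mathcal T_{\mathbb C}E$; one has $\rho_{\mathcal T}(\mathcal X_\alpha)=\delta_\alpha$, $\rho_{\mathcal T}(\mathcal V_\alpha)=\dot\partial_\alpha$, and under chart changes $\widetilde{\mathcal X}_\alpha=W^\beta_\alpha\mathcal X_\beta$, $\widetilde{\mathcal V}_\alpha=W^\beta_\alpha\mathcal V_\beta$. Finsler structure. Let $\widetilde E$ be $E$ minus the zero section. A complex Finsler structure is $F:E\to\mathbb R$, $C^\infty$ on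 $\widetilde E$, with $F\ge0$, $F(z,u)=0$ iff $u=0$, and $F(z,\lambda u)=|\lambda|^2F(z,u)$ for all $\lambda\in\mathbb C$; $(E,F)$ is then a complex Finsler Lie algebroid. $F$ is convex if $h_{\alpha\bar\beta}=\dot\partial_\alpha\dot\partial_{\bar\beta}F$ is positive definite (on $\widetilde E$). $(h^{\bar\sigma\beta})$ is the inverse matrix: $h^{\bar\sigma\beta}h_{\alpha\bar\sigma}=\delta^\beta_\alpha$. All objects built from $F$ are considered over $\widetilde E$. Linear connections on $\mathcal T_{\mathbb C}E$. A (normal, $N$-complex) linear connection $\mathcal D$ assigns to smooth sections $Z,W$ of $\mathcal T_{\mathbb C}E$ a section $\mathcal D_ZW$, is $\mathbb C$-bilinear, satisfies $\mathcal D_{fZ}W=f\mathcal D_ZW$ and $\mathcal D_Z(fW)=f\mathcal D_ZW+\rho_{\mathcal T}(Z)(f)W$ for smooth complex functions $f$, commutes with conjugation, and in adapted frames has the form $\mathcal D_{\mathcal X_\beta}\mathcal V_\alpha=L^\gamma_{\alpha\beta}\mathcal V_\gamma$, $\mathcal D_{\mathcal V_\beta}\mathcal V_\alpha=C^\gamma_{\alpha\beta}\mathcal V_\gamma$, $\mathcal D_{\mathcal X_\beta}\mathcal V_{\bar\alpha}=L^{\bar\gamma}_{\bar\alpha\beta}\mathcal V_{\bar\gamma}$, $\mathcal D_{\mathcal V_\beta}\mathcal V_{\bar\alpha}=C^{\bar\gamma}_{\bar\alpha\beta}\mathcal V_{\bar\gamma}$, and the same formulas with the same coefficients when $\mathcal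 V_\alpha,\mathcal V_\gamma,\mathcal V_{\bar\alpha},\mathcal V_{\bar\gamma}$ (the differentiated and resulting sections) are replaced by $\mathcal X_\alpha,\mathcal X_\gamma,\mathcal X_{\bar\alpha},\mathcal X_{\bar\gamma}$. It is of $(1,0)$-type if $L^{\bar\gamma}_{\bar\alpha\beta}=C^{\bar\gamma}_{\bar\alpha\beta}=0$. The vertical connection with coefficients $(L^\gamma_{\alpha k},C^\gamma_{\alpha\beta})$ is the partial linear connection $D$, commuting with conjugation, on the complexified vertical bundle of $E$ (locally spanned by the $\dot\partial_\alpha$ and $\dot\partial_{\bar\alpha}$), along vectors of $T_{\mathbb C}E$, with $D_{\delta_k}\dot\partial_\alpha=L^\gamma_{\alpha k}\dot\partial_\gamma$, $D_{\dot\partial_\beta}\dot\partial_\alpha=C^\gamma_{\alpha\beta}\dot\partial_\gamma$, $D_{\delta_k}\dot\partial_{\bar\alpha}=0=D_{\dot\partial_\beta}\dot\partial_{\bar\alpha}$. *)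

theory Defs
  imports "HOL-Analysis.Analysis"
begin

section \<open>Smooth and holomorphic functions of several complex variables\<close>

text \<open>Real differentiability classes on open sets: all iterated directional derivatives exist and
  are continuous.\<close>

primrec Ck_on :: "nat \<Rightarrow> 'a::real_normed_vector set \<Rightarrow> ('a \<Rightarrow> 'b::real_normed_vector) \<Rightarrow> bool" where
  "Ck_on 0 S f \<longleftrightarrow> continuous_on S f"
| "Ck_on (Suc k) S f \<longleftrightarrow>
     (\<forall>x\<in>S. f differentiable (at x)) \<and> (\<forall>v. Ck_on k S (\<lambda>x. frechet_derivative f (at x) v))"

definition smooth_on :: "'a::real_normed_vector set \<Rightarrow> ('a \<Rightarrow> 'b::real_normed_vector) \<Rightarrow> bool" where
  "smooth_on S f \<longleftrightarrow> (\<forall>k. Ck_on k S f)"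

definition dz :: "'d::finite \<Rightarrow> (complex^'d \<Rightarrow> complex) \<Rightarrow> complex^'d \<Rightarrow> complex" where
  "dz k f z = (frechet_derivative f (at z) (axis k 1)
                 - \<i> * frechet_derivative f (at z) (axis k \<i>)) / 2"

definition dzbar :: "'d::finite \<Rightarrow> (complex^'d \<Rightarrow> complex) \<Rightarrow> complex^'d \<Rightarrow> complex" where
  "dzbar k f z = (frechet_derivative f (at z) (axis k 1)
                    + \<i> * frechet_derivative f (at z) (axis k \<i>)) / 2"

text \<open>Smooth solutions of the Cauchy-Riemann equations.\<close>

definition holo_on :: "(complex^'d::finite) set \<Rightarrow> (complex^'d \<Rightarrow> complex) \<Rightarrow> bool" where
  "holo_on S f \<longleftrightarrow> smooth_on S f \<and> (\<forall>z\<in>S. \<forall>k. dzbar k f z = 0)"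


section \<open>Complex manifolds and tangent vectors\<close>

text \<open>A chart is a domain together with a coordinate map; only the values of the coordinate map on
  the domain matter. A manifold is the whole type, equipped with an atlas.\<close>

type_synonym ('p, 'd) chart = "'p set \<times> ('p \<Rightarrow> complex^'d)"

definition complex_atlas :: "('p::topological_space, 'd::finite) chart set \<Rightarrow> bool" where
  "complex_atlas A \<longleftrightarrow>
     (\<Union>(fst ` A) = UNIV) \<and>
     (\<forall>(U, \<phi>)\<in>A. open U \<and> open (\<phi> ` U) \<and> homeomorphism U (\<phi> ` U) \<phi> (inv_into U \<phi>)) \<and>
     (\<forall>(U, \<phi>)\<in>A. \<forall>(V, \<psi>)\<in>A. \<forall>k. holo_on (\<phi> ` (U \<inter> V)) (\<lambda>z. \<psi> (inv_into U \<phi> z) $ k))"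

text \<open>The following two predicates are meant for open sets \<^term>\<open>W\<close>.\<close>

definition smooth_fun :: "('p, 'd::finite) chart set \<Rightarrow> 'p set \<Rightarrow> ('p \<Rightarrow> complex) \<Rightarrow> bool" where
  "smooth_fun A W f \<longleftrightarrow> (\<forall>(U, \<phi>)\<in>A. smooth_on (\<phi> ` (U \<inter> W)) (f \<circ> inv_into U \<phi>))"

definition holo_fun :: "('p, 'd::finite) chart set \<Rightarrow> 'p set \<Rightarrow> ('p \<Rightarrow> complex) \<Rightarrow> bool" where
  "holo_fun A W f \<longleftrightarrow> (\<forall>(U, \<phi>)\<in>A. holo_on (\<phi> ` (U \<inter> W)) (f \<circ> inv_into U \<phi>))"

definition smooth_at :: "('p::topological_space, 'd::finite) chart set \<Rightarrow> 'p \<Rightarrow> ('p \<Rightarrow> complex) \<Rightarrow> bool" where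
  "smooth_at A p f \<longleftrightarrow> (\<exists>W. open W \<and> p \<in> W \<and> smooth_fun A W f)"

definition pd :: "('p, 'd::finite) chart \<Rightarrow> 'd \<Rightarrow> ('p \<Rightarrow> complex) \<Rightarrow> 'p \<Rightarrow> complex" where
  "pd c k f p = dz k (f \<circ> inv_into (fst c) (snd c)) (snd c p)"

definition pdbar :: "('p, 'd::finite) chart \<Rightarrow> 'd \<Rightarrow> ('p \<Rightarrow> complex) \<Rightarrow> 'p \<Rightarrow> complex" where
  "pdbar c k f p = dzbar k (f \<circ> inv_into (fst c) (snd c)) (snd c p)"

text \<open>A (complexified) tangent vector at a point is a linear functional on the functions that are
  smooth near that point. So that equality of tangent vectors is equality of functionals, they are
  extended by 0 to all other functions.\<close>

type_synonym 'p tvec = "('p \<Rightarrow> complex) \<Rightarrow> complex"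

definition pdvec :: "('p::topological_space, 'd::finite) chart set \<Rightarrow> ('p, 'd) chart \<Rightarrow> 'd \<Rightarrow> 'p \<Rightarrow> 'p tvec" where
  "pdvec A c k p = (\<lambda>f. if smooth_at A p f then pd c k f p else 0)"

definition hol_tangent :: "('p::topological_space, 'd::finite) chart set \<Rightarrow> 'p \<Rightarrow> 'p tvec set" where
  "hol_tangent A p = {v. \<exists>c\<in>A. p \<in> fst c \<and> (\<exists>a. v = (\<lambda>f. \<Sum>k\<in>UNIV. a k * pdvec A c k p f))}"

definition conj_tv :: "'p tvec \<Rightarrow> 'p tvec" where
  "conj_tv v = (\<lambda>f. cnj (v (\<lambda>x. cnj (f x))))"


section \<open>Holomorphic Lie algebroids\<close>

text \<open>The base is the type \<^typ>\<open>'b\<close>, the total space the type \<^typ>\<open>'e\<close>. A trivialization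
  \<open>(V, \<Phi>)\<close> consists of an open set of the base and the fibre coordinates over it, i.e. it is a
  local frame. The operations \<open>vadd\<close> and \<open>vscale\<close> are the fibrewise vector space operations
  (\<open>vadd\<close> is only relevant for vectors in the same fibre). The operation \<open>bracket W\<close> is the
  bracket of holomorphic sections over the open set \<open>W\<close>.\<close>

record ('b, 'e, 'n::finite, 'm::finite) algebroid =
  atlas :: "('b, 'n) chart set"
  proj :: "'e \<Rightarrow> 'b"
  vadd :: "'e \<Rightarrow> 'e \<Rightarrow> 'e"
  vscale :: "complex \<Rightarrow> 'e \<Rightarrow> 'e"
  trivs :: "('b set \<times> ('e \<Rightarrow> complex^'m)) set"
  anchor :: "'e \<Rightarrow> 'b tvec"
  bracket :: "'b set \<Rightarrow> ('b \<Rightarrow> 'e) \<Rightarrow> ('b \<Rightarrow> 'e) \<Rightarrow> 'b \<Rightarrow> 'e"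

definition holomorphic_vector_bundle ::
  "('b::topological_space, 'e::topological_space, 'n::finite, 'm::finite) algebroid \<Rightarrow> bool" where
  "holomorphic_vector_bundle E \<longleftrightarrow>
     complex_atlas (atlas E) \<and>
     continuous_on UNIV (proj E) \<and>
     (\<Union>(fst ` trivs E) = UNIV) \<and>
     (\<forall>e e'. proj E e = proj E e' \<longrightarrow> proj E (vadd E e e') = proj E e) \<and>
     (\<forall>r e. proj E (vscale E r e) = proj E e) \<and>
     (\<forall>(V, \<Phi>)\<in>trivs E.
        open V \<and>
        (\<exists>g. homeomorphism (proj E -` V) (V \<times> UNIV) (\<lambda>e. (proj E e, \<Phi> e)) g) \<and>
        (\<forall>e e'. proj E e \<in> V \<longrightarrow> proj E e = proj E e' \<longrightarrow> \<Phi> (vadd E e e') = \<Phi> e + \<Phi> e') \<and>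
        (\<forall>r e. proj E e \<in> V \<longrightarrow> \<Phi> (vscale E r e) = r *s \<Phi> e)) \<and>
     (\<forall>(V, \<Phi>)\<in>trivs E. \<forall>(V', \<Phi>')\<in>trivs E.
        \<exists>M :: 'b \<Rightarrow> complex^'m^'m.
          (\<forall>\<alpha> \<beta>. holo_fun (atlas E) (V \<inter> V') (\<lambda>x. M x $ \<alpha> $ \<beta>)) \<and>
          (\<forall>e. proj E e \<in> V \<inter> V' \<longrightarrow> \<Phi>' e = M (proj E e) *v \<Phi> e))"

text \<open>A bundle chart is a chart \<open>(z\<^sup>k)\<close> of the base paired with a local frame; it induces the
  coordinates \<open>(z\<^sup>k, u\<^sup>\<alpha>)\<close> on the total space over the intersection of the two domains.\<close>

type_synonym ('b, 'e, 'n, 'm) bchart = "('b, 'n) chart \<times> ('b set \<times> ('e \<Rightarrow> complex^'m))"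

definition bcharts :: "('b, 'e, 'n::finite, 'm::finite) algebroid \<Rightarrow> ('b, 'e, 'n, 'm) bchart set" where
  "bcharts E = atlas E \<times> trivs E"

definition base_dom :: "('b, 'e, 'n::finite, 'm::finite) bchart \<Rightarrow> 'b set" where
  "base_dom c = fst (fst c) \<inter> fst (snd c)"

definition bdom :: "('b, 'e, 'n::finite, 'm::finite) algebroid \<Rightarrow> ('b, 'e, 'n, 'm) bchart \<Rightarrow> 'e set" where
  "bdom E c = proj E -` base_dom c"

definition echart ::
  "('b, 'e, 'n::finite, 'm::finite) algebroid \<Rightarrow> ('b, 'e, 'n, 'm) bchart \<Rightarrow> ('e, 'n + 'm) chart" where
  "echart E c = (bdom E c,
     \<lambda>e. \<chi> i. case i of Inl k \<Rightarrow> snd (fst c) (proj E e) $ k | Inr \<alpha> \<Rightarrow> snd (snd c) e $ \<alpha>)"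

definition eatlas :: "('b, 'e, 'n::finite, 'm::finite) algebroid \<Rightarrow> ('e, 'n + 'm) chart set" where
  "eatlas E = echart E ` bcharts E"

definition frame ::
  "('b, 'e, 'n::finite, 'm::finite) algebroid \<Rightarrow> ('b, 'e, 'n, 'm) bchart \<Rightarrow> 'm \<Rightarrow> 'b \<Rightarrow> 'e" where
  "frame E c \<alpha> x = (THE e. proj E e = x \<and> snd (snd c) e = axis \<alpha> 1)"

text \<open>\<open>\<rho>\<^sup>k\<^sub>\<alpha>\<close>: the component of a tangent vector along \<open>\<partial>\<^sub>k\<close> is its value on the coordinate
  function \<open>z\<^sup>k\<close>.\<close>

definition rho ::
  "('b, 'e, 'n::finite, 'm::finite) algebroid \<Rightarrow> ('b, 'e, 'n, 'm) bchart \<Rightarrow> 'n \<Rightarrow> 'm \<Rightarrow> 'b \<Rightarrow> complex" where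
  "rho E c k \<alpha> x = anchor E (frame E c \<alpha> x) (\<lambda>y. snd (fst c) y $ k)"

definition holomorphic_anchor ::
  "('b::topological_space, 'e, 'n::finite, 'm::finite) algebroid \<Rightarrow> bool" where
  "holomorphic_anchor E \<longleftrightarrow>
     (\<forall>e. anchor E e \<in> hol_tangent (atlas E) (proj E e)) \<and>
     (\<forall>e e'. proj E e = proj E e' \<longrightarrow>
        anchor E (vadd E e e') = (\<lambda>f. anchor E e f + anchor E e' f)) \<and>
     (\<forall>r e. anchor E (vscale E r e) = (\<lambda>f. r * anchor E e f)) \<and>
     (\<forall>c\<in>bcharts E. \<forall>k \<alpha>. holo_fun (atlas E) (base_dom c) (rho E c k \<alpha>))"

definition hol_section ::
  "('b, 'e, 'n::finite, 'm::finite) algebroid \<Rightarrow> 'b set \<Rightarrow> ('b \<Rightarrow> 'e) \<Rightarrow> bool" where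
  "hol_section E W s \<longleftrightarrow>
     (\<forall>x\<in>W. proj E (s x) = x) \<and>
     (\<forall>(V, \<Phi>)\<in>trivs E. \<forall>\<alpha>. holo_fun (atlas E) (W \<inter> V) (\<lambda>x. \<Phi> (s x) $ \<alpha>))"

text \<open>The Lie bracket lives on the sheaf of holomorphic sections: the locality clause says that it
  commutes with restriction to smaller open sets.\<close>

definition holomorphic_lie_bracket ::
  "('b::topological_space, 'e, 'n::finite, 'm::finite) algebroid \<Rightarrow> bool" where
  "holomorphic_lie_bracket E \<longleftrightarrow>
     (\<forall>W s t. open W \<longrightarrow> hol_section E W s \<longrightarrow> hol_section E W t \<longrightarrow>
        hol_section E W (bracket E W s t)) \<and>
     (\<forall>W W' s t s' t'. open W \<longrightarrow> open W' \<longrightarrow> W' \<subseteq> W \<longrightarrow>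
        hol_section E W s \<longrightarrow> hol_section E W t \<longrightarrow> hol_section E W' s' \<longrightarrow> hol_section E W' t' \<longrightarrow>
        (\<forall>x\<in>W'. s x = s' x \<and> t x = t' x) \<longrightarrow>
        (\<forall>x\<in>W'. bracket E W s t x = bracket E W' s' t' x)) \<and>
     (\<forall>W s s' t. open W \<longrightarrow> hol_section E W s \<longrightarrow> hol_section E W s' \<longrightarrow> hol_section E W t \<longrightarrow>
        (\<forall>x\<in>W. bracket E W (\<lambda>y. vadd E (s y) (s' y)) t x
                  = vadd E (bracket E W s t x) (bracket E W s' t x))) \<and>
     (\<forall>W r s t. open W \<longrightarrow> hol_section E W s \<longrightarrow> hol_section E W t \<longrightarrow>
        (\<forall>x\<in>W. bracket E W (\<lambda>y. vscale E r (s y)) t x = vscale E r (bracket E W s t x))) \<and>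
     (\<forall>W s t. open W \<longrightarrow> hol_section E W s \<longrightarrow> hol_section E W t \<longrightarrow>
        (\<forall>x\<in>W. bracket E W s t x = vscale E (-1) (bracket E W t s x))) \<and>
     (\<forall>W r s t. open W \<longrightarrow> hol_section E W r \<longrightarrow> hol_section E W s \<longrightarrow> hol_section E W t \<longrightarrow>
        (\<forall>x\<in>W. vadd E (bracket E W r (bracket E W s t) x)
                  (vadd E (bracket E W s (bracket E W t r) x) (bracket E W t (bracket E W r s) x))
                  = vscale E 0 (r x))) \<and>
     (\<forall>W f s t. open W \<longrightarrow> holo_fun (atlas E) W f \<longrightarrow> hol_section E W s \<longrightarrow> hol_section E W t \<longrightarrow>
        (\<forall>x\<in>W. bracket E W s (\<lambda>y. vscale E (f y) (t y)) x
                  = vadd E (vscale E (f x) (bracket E W s t x)) (vscale E (anchor E (s x) f) (t x))))"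

definition holomorphic_lie_algebroid ::
  "('b::{t2_space,second_countable_topology}, 'e::topological_space, 'n::finite, 'm::finite) algebroid \<Rightarrow> bool" where
  "holomorphic_lie_algebroid E \<longleftrightarrow>
     holomorphic_vector_bundle E \<and> holomorphic_anchor E \<and> holomorphic_lie_bracket E"


section \<open>The complexified prolongation\<close>

text \<open>An element of a fibre of the prolongation \<open>\<T>'E\<close> is a pair \<open>(e, v)\<close>. An element of
  \<open>\<T>'E \<oplus> cnj \<T>'E\<close> is a pair \<open>(a, b)\<close> of such pairs, where the second component \<open>b\<close> stands for
  the conjugate of \<open>b\<close>; hence the conjugate scalar in \<open>tscl\<close>.\<close>

type_synonym 'e pvec = "'e \<times> 'e tvec"
type_synonym 'e cpvec = "'e pvec \<times> 'e pvec"

definition pushfwd ::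
  "('b::topological_space, 'e, 'n::finite, 'm::finite) algebroid \<Rightarrow> 'e \<Rightarrow> 'e tvec \<Rightarrow> 'b tvec" where
  "pushfwd E u v = (\<lambda>f. if smooth_at (atlas E) (proj E u) f then v (f \<circ> proj E) else 0)"

definition prol ::
  "('b::topological_space, 'e::topological_space, 'n::finite, 'm::finite) algebroid \<Rightarrow> 'e \<Rightarrow> 'e pvec set" where
  "prol E u = {(e, v). proj E e = proj E u \<and> v \<in> hol_tangent (eatlas E) u \<and> anchor E e = pushfwd E u v}"

definition cprol ::
  "('b::topological_space, 'e::topological_space, 'n::finite, 'm::finite) algebroid \<Rightarrow> 'e \<Rightarrow> 'e cpvec set" where
  "cprol E u = prol E u \<times> prol E u"

definition padd :: "('b, 'e, 'n::finite, 'm::finite) algebroid \<Rightarrow> 'e pvec \<Rightarrow> 'e pvec \<Rightarrow> 'e pvec" where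
  "padd E a b = (vadd E (fst a) (fst b), \<lambda>f. snd a f + snd b f)"

definition pscl :: "('b, 'e, 'n::finite, 'm::finite) algebroid \<Rightarrow> complex \<Rightarrow> 'e pvec \<Rightarrow> 'e pvec" where
  "pscl E r a = (vscale E r (fst a), \<lambda>f. r * snd a f)"

definition pzero :: "('b, 'e, 'n::finite, 'm::finite) algebroid \<Rightarrow> 'e \<Rightarrow> 'e pvec" where
  "pzero E u = (vscale E 0 u, \<lambda>f. 0)"

definition tadd :: "('b, 'e, 'n::finite, 'm::finite) algebroid \<Rightarrow> 'e cpvec \<Rightarrow> 'e cpvec \<Rightarrow> 'e cpvec" where
  "tadd E s t = (padd E (fst s) (fst t), padd E (snd s) (snd t))"

definition tscl :: "('b, 'e, 'n::finite, 'm::finite) algebroid \<Rightarrow> complex \<Rightarrow> 'e cpvec \<Rightarrow> 'e cpvec" where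
  "tscl E r s = (pscl E r (fst s), pscl E (cnj r) (snd s))"

definition tconj :: "'e cpvec \<Rightarrow> 'e cpvec" where
  "tconj s = (snd s, fst s)"

definition tanchor :: "'e cpvec \<Rightarrow> 'e tvec" where
  "tanchor s = (\<lambda>f. snd (fst s) f + conj_tv (snd (snd s)) f)"

text \<open>Finite sums in the fibre over \<open>x\<close>, computed in the linear trivializations.\<close>

definition fsum :: "('b, 'e, 'n::finite, 'm::finite) algebroid \<Rightarrow> 'b \<Rightarrow> ('m \<Rightarrow> 'e) \<Rightarrow> 'e" where
  "fsum E x g = (THE e. proj E e = x \<and>
     (\<forall>(V, \<Phi>)\<in>trivs E. x \<in> V \<longrightarrow> \<Phi> e = (\<Sum>i\<in>UNIV. \<Phi> (g i))))"

definition psum :: "('b, 'e, 'n::finite, 'm::finite) algebroid \<Rightarrow> 'e \<Rightarrow> ('m \<Rightarrow> 'e pvec) \<Rightarrow> 'e pvec" where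
  "psum E u g = (fsum E (proj E u) (\<lambda>i. fst (g i)), \<lambda>f. \<Sum>i\<in>UNIV. snd (g i) f)"

definition tsum :: "('b, 'e, 'n::finite, 'm::finite) algebroid \<Rightarrow> 'e \<Rightarrow> ('m \<Rightarrow> 'e cpvec) \<Rightarrow> 'e cpvec" where
  "tsum E u g = (psum E u (\<lambda>i. fst (g i)), psum E u (\<lambda>i. snd (g i)))"

text \<open>\<open>evec E c i u\<close> is \<open>\<partial>\<^sub>k\<close> at \<open>u\<close> for \<open>i = Inl k\<close>, and the fibre derivative in direction \<open>u\<^sup>\<alpha>\<close>
  for \<open>i = Inr \<alpha>\<close>.\<close>

definition evec ::
  "('b, 'e::topological_space, 'n::finite, 'm::finite) algebroid \<Rightarrow> ('b, 'e, 'n, 'm) bchart \<Rightarrow> 'n + 'm \<Rightarrow> 'e \<Rightarrow> 'e tvec" where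
  "evec E c i u = pdvec (eatlas E) (echart E c) i u"

definition frameZ ::
  "('b, 'e::topological_space, 'n::finite, 'm::finite) algebroid \<Rightarrow> ('b, 'e, 'n, 'm) bchart \<Rightarrow> 'm \<Rightarrow> 'e \<Rightarrow> 'e cpvec" where
  "frameZ E c \<alpha> u =
     ((frame E c \<alpha> (proj E u), \<lambda>f. \<Sum>k\<in>UNIV. rho E c k \<alpha> (proj E u) * evec E c (Inl k) u f), pzero E u)"

definition frameV ::
  "('b, 'e::topological_space, 'n::finite, 'm::finite) algebroid \<Rightarrow> ('b, 'e, 'n, 'm) bchart \<Rightarrow> 'm \<Rightarrow> 'e \<Rightarrow> 'e cpvec" where
  "frameV E c \<alpha> u = ((vscale E 0 u, evec E c (Inr \<alpha>) u), pzero E u)"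

definition smooth_section ::
  "('b::topological_space, 'e::topological_space, 'n::finite, 'm::finite) algebroid \<Rightarrow> 'e set \<Rightarrow> ('e \<Rightarrow> 'e cpvec) \<Rightarrow> bool" where
  "smooth_section E W S \<longleftrightarrow>
     (\<forall>u\<in>W. S u \<in> cprol E u) \<and>
     (\<forall>c\<in>bcharts E. \<exists>a b a' b'.
        (\<forall>\<alpha>. smooth_fun (eatlas E) (W \<inter> bdom E c) (a \<alpha>) \<and>
              smooth_fun (eatlas E) (W \<inter> bdom E c) (b \<alpha>) \<and>
              smooth_fun (eatlas E) (W \<inter> bdom E c) (a' \<alpha>) \<and>
              smooth_fun (eatlas E) (W \<inter> bdom E c) (b' \<alpha>)) \<and>
        (\<forall>u\<in>W \<inter> bdom E c. S u =
           tadd E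
            (tadd E (tsum E u (\<lambda>\<alpha>. tscl E (a \<alpha> u) (frameZ E c \<alpha> u)))
                    (tsum E u (\<lambda>\<alpha>. tscl E (b \<alpha> u) (frameV E c \<alpha> u))))
            (tadd E (tsum E u (\<lambda>\<alpha>. tscl E (a' \<alpha> u) (tconj (frameZ E c \<alpha> u))))
                    (tsum E u (\<lambda>\<alpha>. tscl E (b' \<alpha> u) (tconj (frameV E c \<alpha> u)))))))"


section \<open>Nonlinear connections and adapted frames\<close>

definition slit :: "('b, 'e, 'n::finite, 'm::finite) algebroid \<Rightarrow> 'e set" where
  "slit E = {e. e \<noteq> vscale E 0 e}"

text \<open>A family \<open>N c k \<beta> = N\<^sub>k\<^sup>\<beta>\<close> of functions, one for each bundle chart.\<close>

type_synonym ('b, 'e, 'n, 'm) nlcoeffs = "('b, 'e, 'n, 'm) bchart \<Rightarrow> 'n \<Rightarrow> 'm \<Rightarrow> 'e \<Rightarrow> complex"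

definition deltak ::
  "('b, 'e::topological_space, 'n::finite, 'm::finite) algebroid \<Rightarrow> ('b, 'e, 'n, 'm) nlcoeffs \<Rightarrow>
   ('b, 'e, 'n, 'm) bchart \<Rightarrow> 'n \<Rightarrow> 'e \<Rightarrow> 'e tvec" where
  "deltak E N c k u = (\<lambda>f. evec E c (Inl k) u f - (\<Sum>\<beta>\<in>UNIV. N c k \<beta> u * evec E c (Inr \<beta>) u f))"

definition deltaA ::
  "('b, 'e::topological_space, 'n::finite, 'm::finite) algebroid \<Rightarrow> ('b, 'e, 'n, 'm) nlcoeffs \<Rightarrow>
   ('b, 'e, 'n, 'm) bchart \<Rightarrow> 'm \<Rightarrow> 'e \<Rightarrow> 'e tvec" where
  "deltaA E N c \<alpha> u = (\<lambda>f. \<Sum>k\<in>UNIV. rho E c k \<alpha> (proj E u) * deltak E N c k u f)"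

definition NA ::
  "('b, 'e, 'n::finite, 'm::finite) algebroid \<Rightarrow> ('b, 'e, 'n, 'm) nlcoeffs \<Rightarrow>
   ('b, 'e, 'n, 'm) bchart \<Rightarrow> 'm \<Rightarrow> 'm \<Rightarrow> 'e \<Rightarrow> complex" where
  "NA E N c \<alpha> \<beta> u = (\<Sum>k\<in>UNIV. rho E c k \<alpha> (proj E u) * N c k \<beta> u)"

text \<open>The \<open>\<delta>\<^sub>k\<close> of the various charts span one distribution, which is then automatically a smooth
  complement of the vertical bundle in \<open>T'E\<close>.\<close>

definition nonlinear_connection ::
  "('b, 'e::topological_space, 'n::finite, 'm::finite) algebroid \<Rightarrow> ('b, 'e, 'n, 'm) nlcoeffs \<Rightarrow> bool" where
  "nonlinear_connection E N \<longleftrightarrow>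
     (\<forall>c\<in>bcharts E. \<forall>k \<beta>. smooth_fun (eatlas E) (slit E \<inter> bdom E c) (N c k \<beta>)) \<and>
     (\<exists>H. \<forall>c\<in>bcharts E. \<forall>u\<in>slit E \<inter> bdom E c.
        H u = {v. \<exists>a. v = (\<lambda>f. \<Sum>k\<in>UNIV. a k * deltak E N c k u f)})"

definition frameX ::
  "('b, 'e::topological_space, 'n::finite, 'm::finite) algebroid \<Rightarrow> ('b, 'e, 'n, 'm) nlcoeffs \<Rightarrow>
   ('b, 'e, 'n, 'm) bchart \<Rightarrow> 'm \<Rightarrow> 'e \<Rightarrow> 'e cpvec" where
  "frameX E N c \<alpha> u =
     tadd E (frameZ E c \<alpha> u)
       (tscl E (-1) (tsum E u (\<lambda>\<beta>. tscl E (NA E N c \<alpha> \<beta> u) (frameV E c \<beta> u))))"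


section \<open>Linear connections on the complexified prolongation\<close>

text \<open>\<open>D W Z S\<close> is the covariant derivative of the section \<open>S\<close> along the section \<open>Z\<close>, both defined
  over the open set \<open>W\<close>. Adapted frames are local sections, so the operator acts on sections over
  arbitrary open subsets of the slit bundle, compatibly with restriction.\<close>

type_synonym 'e connection = "'e set \<Rightarrow> ('e \<Rightarrow> 'e cpvec) \<Rightarrow> ('e \<Rightarrow> 'e cpvec) \<Rightarrow> 'e \<Rightarrow> 'e cpvec"

definition linear_connection ::
  "('b::topological_space, 'e::topological_space, 'n::finite, 'm::finite) algebroid \<Rightarrow> 'e connection \<Rightarrow> bool" where
  "linear_connection E D \<longleftrightarrow>
     (\<forall>W Z S. open W \<longrightarrow> W \<subseteq> slit E \<longrightarrow> smooth_section E W Z \<longrightarrow> smooth_section E W S \<longrightarrow>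
        smooth_section E W (D W Z S)) \<and>
     (\<forall>W W' Z S Z' S'. open W \<longrightarrow> W \<subseteq> slit E \<longrightarrow> open W' \<longrightarrow> W' \<subseteq> W \<longrightarrow>
        smooth_section E W Z \<longrightarrow> smooth_section E W S \<longrightarrow>
        smooth_section E W' Z' \<longrightarrow> smooth_section E W' S' \<longrightarrow>
        (\<forall>u\<in>W'. Z u = Z' u \<and> S u = S' u) \<longrightarrow> (\<forall>u\<in>W'. D W Z S u = D W' Z' S' u)) \<and>
     (\<forall>W Z Z' S. open W \<longrightarrow> W \<subseteq> slit E \<longrightarrow>
        smooth_section E W Z \<longrightarrow> smooth_section E W Z' \<longrightarrow> smooth_section E W S \<longrightarrow>
        (\<forall>u\<in>W. D W (\<lambda>x. tadd E (Z x) (Z' x)) S u = tadd E (D W Z S u) (D W Z' S u))) \<and>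
     (\<forall>W Z S S'. open W \<longrightarrow> W \<subseteq> slit E \<longrightarrow>
        smooth_section E W Z \<longrightarrow> smooth_section E W S \<longrightarrow> smooth_section E W S' \<longrightarrow>
        (\<forall>u\<in>W. D W Z (\<lambda>x. tadd E (S x) (S' x)) u = tadd E (D W Z S u) (D W Z S' u))) \<and>
     (\<forall>W r Z S. open W \<longrightarrow> W \<subseteq> slit E \<longrightarrow> smooth_section E W Z \<longrightarrow> smooth_section E W S \<longrightarrow>
        (\<forall>u\<in>W. D W Z (\<lambda>x. tscl E r (S x)) u = tscl E r (D W Z S u))) \<and>
     (\<forall>W f Z S. open W \<longrightarrow> W \<subseteq> slit E \<longrightarrow> smooth_fun (eatlas E) W f \<longrightarrow>
        smooth_section E W Z \<longrightarrow> smooth_section E W S \<longrightarrow>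
        (\<forall>u\<in>W. D W (\<lambda>x. tscl E (f x) (Z x)) S u = tscl E (f u) (D W Z S u))) \<and>
     (\<forall>W f Z S. open W \<longrightarrow> W \<subseteq> slit E \<longrightarrow> smooth_fun (eatlas E) W f \<longrightarrow>
        smooth_section E W Z \<longrightarrow> smooth_section E W S \<longrightarrow>
        (\<forall>u\<in>W. D W Z (\<lambda>x. tscl E (f x) (S x)) u
                  = tadd E (tscl E (f u) (D W Z S u)) (tscl E (tanchor (Z u) f) (S u)))) \<and>
     (\<forall>W Z S. open W \<longrightarrow> W \<subseteq> slit E \<longrightarrow> smooth_section E W Z \<longrightarrow> smooth_section E W S \<longrightarrow>
        (\<forall>u\<in>W. D W (\<lambda>x. tconj (Z x)) (\<lambda>x. tconj (S x)) u = tconj (D W Z S u)))"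

text \<open>Coefficients in the adapted frame of the chart \<open>c\<close>; the arguments are ordered so that
  \<open>L \<gamma> \<alpha> \<beta> = L\<^sup>\<gamma>\<^sub>\<alpha>\<^sub>\<beta>\<close>, with \<open>\<alpha>\<close> the differentiated and \<open>\<beta>\<close> the differentiating index.\<close>

definition pure_coeffs ::
  "('b, 'e::topological_space, 'n::finite, 'm::finite) algebroid \<Rightarrow> ('b, 'e, 'n, 'm) nlcoeffs \<Rightarrow> 'e connection \<Rightarrow>
   ('b, 'e, 'n, 'm) bchart \<Rightarrow> ('m \<Rightarrow> 'm \<Rightarrow> 'm \<Rightarrow> 'e \<Rightarrow> complex) \<Rightarrow> ('m \<Rightarrow> 'm \<Rightarrow> 'm \<Rightarrow> 'e \<Rightarrow> complex) \<Rightarrow> bool" where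
  "pure_coeffs E N D c L C \<longleftrightarrow>
     (let W = slit E \<inter> bdom E c; X = frameX E N c; V = frameV E c in
      \<forall>u\<in>W. \<forall>\<alpha> \<beta>.
        D W (X \<beta>) (X \<alpha>) u = tsum E u (\<lambda>\<gamma>. tscl E (L \<gamma> \<alpha> \<beta> u) (X \<gamma> u)) \<and>
        D W (X \<beta>) (V \<alpha>) u = tsum E u (\<lambda>\<gamma>. tscl E (L \<gamma> \<alpha> \<beta> u) (V \<gamma> u)) \<and>
        D W (V \<beta>) (X \<alpha>) u = tsum E u (\<lambda>\<gamma>. tscl E (C \<gamma> \<alpha> \<beta> u) (X \<gamma> u)) \<and>
        D W (V \<beta>) (V \<alpha>) u = tsum E u (\<lambda>\<gamma>. tscl E (C \<gamma> \<alpha> \<beta> u) (V \<gamma> u)))"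

definition mixed_coeffs ::
  "('b, 'e::topological_space, 'n::finite, 'm::finite) algebroid \<Rightarrow> ('b, 'e, 'n, 'm) nlcoeffs \<Rightarrow> 'e connection \<Rightarrow>
   ('b, 'e, 'n, 'm) bchart \<Rightarrow> ('m \<Rightarrow> 'm \<Rightarrow> 'm \<Rightarrow> 'e \<Rightarrow> complex) \<Rightarrow> ('m \<Rightarrow> 'm \<Rightarrow> 'm \<Rightarrow> 'e \<Rightarrow> complex) \<Rightarrow> bool" where
  "mixed_coeffs E N D c L' C' \<longleftrightarrow>
     (let W = slit E \<inter> bdom E c; X = frameX E N c; V = frameV E c;
          X' = (\<lambda>\<alpha> u. tconj (X \<alpha> u)); V' = (\<lambda>\<alpha> u. tconj (V \<alpha> u)) in
      \<forall>u\<in>W. \<forall>\<alpha> \<beta>.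
        D W (X \<beta>) (X' \<alpha>) u = tsum E u (\<lambda>\<gamma>. tscl E (L' \<gamma> \<alpha> \<beta> u) (X' \<gamma> u)) \<and>
        D W (X \<beta>) (V' \<alpha>) u = tsum E u (\<lambda>\<gamma>. tscl E (L' \<gamma> \<alpha> \<beta> u) (V' \<gamma> u)) \<and>
        D W (V \<beta>) (X' \<alpha>) u = tsum E u (\<lambda>\<gamma>. tscl E (C' \<gamma> \<alpha> \<beta> u) (X' \<gamma> u)) \<and>
        D W (V \<beta>) (V' \<alpha>) u = tsum E u (\<lambda>\<gamma>. tscl E (C' \<gamma> \<alpha> \<beta> u) (V' \<gamma> u)))"

definition normal_linear_connection ::
  "('b::topological_space, 'e::topological_space, 'n::finite, 'm::finite) algebroid \<Rightarrow> ('b, 'e, 'n, 'm) nlcoeffs \<Rightarrow>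
   'e connection \<Rightarrow> bool" where
  "normal_linear_connection E N D \<longleftrightarrow>
     linear_connection E D \<and>
     (\<forall>c\<in>bcharts E. \<exists>L C L' C'. pure_coeffs E N D c L C \<and> mixed_coeffs E N D c L' C')"

definition type_10 ::
  "('b, 'e::topological_space, 'n::finite, 'm::finite) algebroid \<Rightarrow> ('b, 'e, 'n, 'm) nlcoeffs \<Rightarrow> 'e connection \<Rightarrow> bool" where
  "type_10 E N D \<longleftrightarrow> (\<forall>c\<in>bcharts E. mixed_coeffs E N D c (\<lambda>_ _ _ _. 0) (\<lambda>_ _ _ _. 0))"


section \<open>Vertical connections\<close>

definition tangent_section ::
  "('b, 'e::topological_space, 'n::finite, 'm::finite) algebroid \<Rightarrow> 'e set \<Rightarrow> ('e \<Rightarrow> 'e tvec) \<Rightarrow> bool" where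
  "tangent_section E W \<xi> \<longleftrightarrow>
     (\<forall>c\<in>bcharts E. \<exists>a a'.
        (\<forall>i. smooth_fun (eatlas E) (W \<inter> bdom E c) (a i) \<and> smooth_fun (eatlas E) (W \<inter> bdom E c) (a' i)) \<and>
        (\<forall>u\<in>W \<inter> bdom E c. \<xi> u =
           (\<lambda>f. (\<Sum>i\<in>UNIV. a i u * evec E c i u f) + (\<Sum>i\<in>UNIV. a' i u * conj_tv (evec E c i u) f))))"

definition vertical_section ::
  "('b, 'e::topological_space, 'n::finite, 'm::finite) algebroid \<Rightarrow> 'e set \<Rightarrow> ('e \<Rightarrow> 'e tvec) \<Rightarrow> bool" where
  "vertical_section E W \<eta> \<longleftrightarrow>
     (\<forall>c\<in>bcharts E. \<exists>b b'.
        (\<forall>\<alpha>. smooth_fun (eatlas E) (W \<inter> bdom E c) (b \<alpha>) \<and> smooth_fun (eatlas E) (W \<inter> bdom E c) (b' \<alpha>)) \<and>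
        (\<forall>u\<in>W \<inter> bdom E c. \<eta> u =
           (\<lambda>f. (\<Sum>\<alpha>\<in>UNIV. b \<alpha> u * evec E c (Inr \<alpha>) u f)
              + (\<Sum>\<alpha>\<in>UNIV. b' \<alpha> u * conj_tv (evec E c (Inr \<alpha>) u) f))))"

type_synonym 'e vconnection = "'e set \<Rightarrow> ('e \<Rightarrow> 'e tvec) \<Rightarrow> ('e \<Rightarrow> 'e tvec) \<Rightarrow> 'e \<Rightarrow> 'e tvec"

definition vertical_connection ::
  "('b, 'e::topological_space, 'n::finite, 'm::finite) algebroid \<Rightarrow> 'e vconnection \<Rightarrow> bool" where
  "vertical_connection E D \<longleftrightarrow>
     (\<forall>W \<xi> \<eta>. open W \<longrightarrow> W \<subseteq> slit E \<longrightarrow> tangent_section E W \<xi> \<longrightarrow> vertical_section E W \<eta> \<longrightarrow>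
        vertical_section E W (D W \<xi> \<eta>)) \<and>
     (\<forall>W W' \<xi> \<eta> \<xi>' \<eta>'. open W \<longrightarrow> W \<subseteq> slit E \<longrightarrow> open W' \<longrightarrow> W' \<subseteq> W \<longrightarrow>
        tangent_section E W \<xi> \<longrightarrow> vertical_section E W \<eta> \<longrightarrow>
        tangent_section E W' \<xi>' \<longrightarrow> vertical_section E W' \<eta>' \<longrightarrow>
        (\<forall>u\<in>W'. \<xi> u = \<xi>' u \<and> \<eta> u = \<eta>' u) \<longrightarrow> (\<forall>u\<in>W'. D W \<xi> \<eta> u = D W' \<xi>' \<eta>' u)) \<and>
     (\<forall>W \<xi> \<xi>' \<eta>. open W \<longrightarrow> W \<subseteq> slit E \<longrightarrow>
        tangent_section E W \<xi> \<longrightarrow> tangent_section E W \<xi>' \<longrightarrow> vertical_section E W \<eta> \<longrightarrow>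
        (\<forall>u\<in>W. D W (\<lambda>x f. \<xi> x f + \<xi>' x f) \<eta> u = (\<lambda>f. D W \<xi> \<eta> u f + D W \<xi>' \<eta> u f))) \<and>
     (\<forall>W \<xi> \<eta> \<eta>'. open W \<longrightarrow> W \<subseteq> slit E \<longrightarrow>
        tangent_section E W \<xi> \<longrightarrow> vertical_section E W \<eta> \<longrightarrow> vertical_section E W \<eta>' \<longrightarrow>
        (\<forall>u\<in>W. D W \<xi> (\<lambda>x f. \<eta> x f + \<eta>' x f) u = (\<lambda>f. D W \<xi> \<eta> u f + D W \<xi> \<eta>' u f))) \<and>
     (\<forall>W r \<xi> \<eta>. open W \<longrightarrow> W \<subseteq> slit E \<longrightarrow> tangent_section E W \<xi> \<longrightarrow> vertical_section E W \<eta> \<longrightarrow>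
        (\<forall>u\<in>W. D W \<xi> (\<lambda>x f. r * \<eta> x f) u = (\<lambda>f. r * D W \<xi> \<eta> u f))) \<and>
     (\<forall>W g \<xi> \<eta>. open W \<longrightarrow> W \<subseteq> slit E \<longrightarrow> smooth_fun (eatlas E) W g \<longrightarrow>
        tangent_section E W \<xi> \<longrightarrow> vertical_section E W \<eta> \<longrightarrow>
        (\<forall>u\<in>W. D W (\<lambda>x f. g x * \<xi> x f) \<eta> u = (\<lambda>f. g u * D W \<xi> \<eta> u f))) \<and>
     (\<forall>W g \<xi> \<eta>. open W \<longrightarrow> W \<subseteq> slit E \<longrightarrow> smooth_fun (eatlas E) W g \<longrightarrow>
        tangent_section E W \<xi> \<longrightarrow> vertical_section E W \<eta> \<longrightarrow>
        (\<forall>u\<in>W. D W \<xi> (\<lambda>x f. g x * \<eta> x f) u = (\<lambda>f. g u * D W \<xi> \<eta> u f + \<xi> u g * \<eta> u f))) \<and>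
     (\<forall>W \<xi> \<eta>. open W \<longrightarrow> W \<subseteq> slit E \<longrightarrow> tangent_section E W \<xi> \<longrightarrow> vertical_section E W \<eta> \<longrightarrow>
        (\<forall>u\<in>W. D W (\<lambda>x. conj_tv (\<xi> x)) (\<lambda>x. conj_tv (\<eta> x)) u = conj_tv (D W \<xi> \<eta> u)))"

definition vertical_coeffs ::
  "('b, 'e::topological_space, 'n::finite, 'm::finite) algebroid \<Rightarrow> ('b, 'e, 'n, 'm) nlcoeffs \<Rightarrow> 'e vconnection \<Rightarrow>
   ('b, 'e, 'n, 'm) bchart \<Rightarrow> ('m \<Rightarrow> 'm \<Rightarrow> 'n \<Rightarrow> 'e \<Rightarrow> complex) \<Rightarrow> ('m \<Rightarrow> 'm \<Rightarrow> 'm \<Rightarrow> 'e \<Rightarrow> complex) \<Rightarrow> bool" where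
  "vertical_coeffs E N D c L C \<longleftrightarrow>
     (let W = slit E \<inter> bdom E c; d = deltak E N c; v = (\<lambda>\<alpha>. evec E c (Inr \<alpha>)) in
      \<forall>u\<in>W. \<forall>\<alpha>.
        (\<forall>k. D W (d k) (v \<alpha>) u = (\<lambda>f. \<Sum>\<gamma>\<in>UNIV. L \<gamma> \<alpha> k u * v \<gamma> u f) \<and>
              D W (d k) (\<lambda>x. conj_tv (v \<alpha> x)) u = (\<lambda>f. 0)) \<and>
        (\<forall>\<beta>. D W (v \<beta>) (v \<alpha>) u = (\<lambda>f. \<Sum>\<gamma>\<in>UNIV. C \<gamma> \<alpha> \<beta> u * v \<gamma> u f) \<and>
              D W (v \<beta>) (\<lambda>x. conj_tv (v \<alpha> x)) u = (\<lambda>f. 0)))"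

text \<open>The connection induced by a vertical connection with coefficients \<open>(L\<^sup>\<gamma>\<^sub>\<alpha>\<^sub>k, C\<^sup>\<gamma>\<^sub>\<alpha>\<^sub>\<beta>)\<close> has the
  coefficients \<open>(\<rho>\<^sup>k\<^sub>\<beta> L\<^sup>\<gamma>\<^sub>\<alpha>\<^sub>k, C\<^sup>\<gamma>\<^sub>\<alpha>\<^sub>\<beta>)\<close> in every adapted frame.\<close>

definition induced_by_vertical ::
  "('b, 'e::topological_space, 'n::finite, 'm::finite) algebroid \<Rightarrow> ('b, 'e, 'n, 'm) nlcoeffs \<Rightarrow>
   'e connection \<Rightarrow> 'e vconnection \<Rightarrow> bool" where
  "induced_by_vertical E N D Dv \<longleftrightarrow>
     (\<forall>c\<in>bcharts E. \<exists>L C. vertical_coeffs E N Dv c L C \<and>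
        pure_coeffs E N D c (\<lambda>\<gamma> \<alpha> \<beta> u. \<Sum>k\<in>UNIV. rho E c k \<beta> (proj E u) * L \<gamma> \<alpha> k u) C)"


section \<open>Complex Finsler structures\<close>

definition complex_finsler ::
  "('b, 'e, 'n::finite, 'm::finite) algebroid \<Rightarrow> ('e \<Rightarrow> real) \<Rightarrow> bool" where
  "complex_finsler E F \<longleftrightarrow>
     smooth_fun (eatlas E) (slit E) (\<lambda>e. complex_of_real (F e)) \<and>
     (\<forall>e. F e \<ge> 0) \<and> (\<forall>e. F e = 0 \<longleftrightarrow> e \<notin> slit E) \<and>
     (\<forall>r e. F (vscale E r e) = (cmod r)\<^sup>2 * F e)"

definition hmet ::
  "('b, 'e, 'n::finite, 'm::finite) algebroid \<Rightarrow> ('e \<Rightarrow> real) \<Rightarrow> ('b, 'e, 'n, 'm) bchart \<Rightarrow> 'm \<Rightarrow> 'm \<Rightarrow> 'e \<Rightarrow> complex" where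
  "hmet E F c \<alpha> \<sigma> =
     pd (echart E c) (Inr \<alpha>) (pdbar (echart E c) (Inr \<sigma>) (\<lambda>e. complex_of_real (F e)))"

definition convex_finsler ::
  "('b, 'e, 'n::finite, 'm::finite) algebroid \<Rightarrow> ('e \<Rightarrow> real) \<Rightarrow> bool" where
  "convex_finsler E F \<longleftrightarrow>
     (\<forall>c\<in>bcharts E. \<forall>u\<in>slit E \<inter> bdom E c. \<forall>\<xi>::complex^'m. \<xi> \<noteq> 0 \<longrightarrow>
        (let q = (\<Sum>\<alpha>\<in>UNIV. \<Sum>\<beta>\<in>UNIV. hmet E F c \<alpha> \<beta> u * \<xi> $ \<alpha> * cnj (\<xi> $ \<beta>))
         in q \<in> \<real> \<and> Re q > 0))"

text \<open>\<open>hinv E F c \<sigma> \<beta>\<close> is the entry with barred index \<open>\<sigma>\<close> and unbarred index \<open>\<beta>\<close> of the inverse of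
  the matrix whose rows are indexed by the unbarred index of \<open>hmet\<close>.\<close>

definition hinv ::
  "('b, 'e, 'n::finite, 'm::finite) algebroid \<Rightarrow> ('e \<Rightarrow> real) \<Rightarrow> ('b, 'e, 'n, 'm) bchart \<Rightarrow> 'm \<Rightarrow> 'm \<Rightarrow> 'e \<Rightarrow> complex" where
  "hinv E F c \<sigma> \<beta> u = matrix_inv (\<chi> \<alpha> \<tau>. hmet E F c \<alpha> \<tau> u) $ \<sigma> $ \<beta>"

definition cfN ::
  "('b, 'e, 'n::finite, 'm::finite) algebroid \<Rightarrow> ('e \<Rightarrow> real) \<Rightarrow> ('b, 'e, 'n, 'm) nlcoeffs" where
  "cfN E F c k \<beta> u = (\<Sum>\<sigma>\<in>UNIV. hinv E F c \<sigma> \<beta> u *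
     pd (echart E c) (Inl k) (pdbar (echart E c) (Inr \<sigma>) (\<lambda>e. complex_of_real (F e))) u)"

definition cfLk ::
  "('b, 'e::topological_space, 'n::finite, 'm::finite) algebroid \<Rightarrow> ('e \<Rightarrow> real) \<Rightarrow> ('b, 'e, 'n, 'm) bchart \<Rightarrow>
   'm \<Rightarrow> 'm \<Rightarrow> 'n \<Rightarrow> 'e \<Rightarrow> complex" where
  "cfLk E F c \<gamma> \<alpha> k u = (\<Sum>\<sigma>\<in>UNIV. hinv E F c \<sigma> \<gamma> u * deltak E (cfN E F) c k u (hmet E F c \<alpha> \<sigma>))"

definition cfC ::
  "('b, 'e::topological_space, 'n::finite, 'm::finite) algebroid \<Rightarrow> ('e \<Rightarrow> real) \<Rightarrow> ('b, 'e, 'n, 'm) bchart \<Rightarrow>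
   'm \<Rightarrow> 'm \<Rightarrow> 'm \<Rightarrow> 'e \<Rightarrow> complex" where
  "cfC E F c \<gamma> \<alpha> \<beta> u = (\<Sum>\<sigma>\<in>UNIV. hinv E F c \<sigma> \<gamma> u * evec E c (Inr \<beta>) u (hmet E F c \<alpha> \<sigma>))"

definition cfL ::
  "('b, 'e::topological_space, 'n::finite, 'm::finite) algebroid \<Rightarrow> ('e \<Rightarrow> real) \<Rightarrow> ('b, 'e, 'n, 'm) bchart \<Rightarrow>
   'm \<Rightarrow> 'm \<Rightarrow> 'm \<Rightarrow> 'e \<Rightarrow> complex" where
  "cfL E F c \<gamma> \<alpha> \<beta> u = (\<Sum>k\<in>UNIV. rho E c k \<beta> (proj E u) * cfLk E F c \<gamma> \<alpha> k u)"

end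

theory Submission
  imports Defs
begin

text \<open>
  The connection is the Chern connection of the Hermitian metric \<open>h\<close> on the vertical bundle,
  transported to both summands of the prolongation. In a chart, a complexified tangent vector \<open>v\<close> of the
  total space acts on the components \<open>b\<close> of a section by
  \<open>\<nabla>\<^sub>v b = v(b) + b \<cdot> v\<^sup>1\<^sup>0(h) h\<inverse>\<close>, where \<open>v\<^sup>1\<^sup>0\<close> is the part of \<open>v\<close> of type (1,0). With constant
  \<open>b\<close> and \<open>v = \<delta>\<^sub>k\<close>, \<open>v = \<delta>\<^sub>\<beta>\<close> or \<open>v\<close> a fibre derivative this formula gives exactly the
  coefficients \<open>L\<^sup>\<gamma>\<^sub>\<alpha>\<^sub>k\<close>, \<open>L\<^sup>\<gamma>\<^sub>\<alpha>\<^sub>\<beta>\<close>, \<open>C\<^sup>\<gamma>\<^sub>\<alpha>\<^sub>\<beta>\<close>; for \<open>v\<close> of type (0,1) it gives 0, which is the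
  (1,0)-type condition. The additivity and Leibniz rules are immediate from the formula. What has to be
  shown is that the formulas of the various charts define one operator.

  Under a change of bundle chart, components transform by a matrix \<open>M\<close> of holomorphic functions of the
  base point, and the fundamental tensor by \<open>h = M\<^sup>t h' (cnj M)\<close>. A vector of type (1,0) annihilates
  \<open>cnj M\<close>. Hence lowering an index turns a quantity that transforms with \<open>M\<close> into one that transforms
  with \<open>cnj M\<close>, a matrix of constants as far as derivatives of type (1,0) are concerned. As lowering is
  injective (\<open>convex_finsler\<close> makes \<open>h\<close> invertible), it is enough to compare lowered quantities. This is
  lemma \<open>raise_transition\<close>, and it is used twice:

  \<^item> for the nonlinear connection: lowering the vertical component of a vector \<open>v\<close> of type (1,0)
    gives \<open>v(\<partial>F / \<partial>(cnj u\<^sup>\<sigma>))\<close>, because \<open>N\<^sub>k\<^sup>\<beta>\<close> is \<open>\<partial>\<^sub>k\<close> of this function with the index raised.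
    So \<open>v\<close> is horizontal iff it annihilates the functions \<open>\<partial>F / \<partial>(cnj u\<^sup>\<sigma>)\<close>, and these transform with
    \<open>cnj M\<close> (\<open>span_delta_iff\<close>, \<open>vert_transition\<close>);

  \<^item> for the covariant derivative itself (\<open>nabla_transition\<close>).

  An element of the prolongation over \<open>u\<close> has horizontal and vertical components in the adapted frame,
  both of which transform with \<open>M\<close>. Applying \<open>\<nabla>\<close> to both of them gives \<open>\<D>\<close> on the first summand of
  the complexified prolongation, and conjugation gives it on the second one. The same construction with
  vertical vectors gives the vertical connection that induces \<open>\<D>\<close>.

  All of this takes place on the total space, whose bundle charts form a holomorphic atlas
  (\<open>total_atlas\<close>). Tangent vectors are functionals on smooth germs, determined by their values on the
  coordinate functions and the conjugates of these (\<open>ctan_repr\<close>); most identities between vectors are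
  proved by evaluating both sides there.
\<close>


section \<open>Calculus of smooth functions\<close>

lemma Ck_on_continuous: "Ck_on k S f \<Longrightarrow> open S \<Longrightarrow> continuous_on S f"
  by (cases k) (auto simp: continuous_on_eq_continuous_at intro: differentiable_imp_continuous_within)

lemma Ck_on_Suc_imp: "open S \<Longrightarrow> Ck_on (Suc k) S f \<Longrightarrow> Ck_on k S f"
proof (induction k arbitrary: f)
  case 0
  then show ?case using Ck_on_continuous[of "Suc 0" S f] by simp
next
  case (Suc k)
  have "Ck_on (Suc k) S (\<lambda>x. frechet_derivative f (at x) v)" for v
    using Suc.prems(2) unfolding Ck_on.simps(2)[of "Suc k"] by blast
  then have "Ck_on k S (\<lambda>x. frechet_derivative f (at x) v)" for v
    using Suc.IH Suc.prems(1) by blast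
  then show ?case using Suc.prems(2) unfolding Ck_on.simps(2) by blast
qed

lemma Ck_on_cong:
  assumes "open S" "\<And>x. x \<in> S \<Longrightarrow> f x = g x" "Ck_on k S f"
  shows "Ck_on k S g"
  using assms(2,3)
proof (induction k arbitrary: f g)
  case 0
  then show ?case using continuous_on_cong[of S S f g] by simp
next
  case (Suc k)
  have fr: "frechet_derivative f (at x) = frechet_derivative g (at x)" if "x \<in> S" for x
    using frechet_derivative_transform_within_open[of f x S g] Suc.prems assms(1) that by auto
  have df: "g differentiable (at x)" if "x \<in> S" for x
    using Suc.prems that assms(1) unfolding differentiable_def Ck_on.simps
    by (metis has_derivative_transform_within_open)
  have "Ck_on k S (\<lambda>x. frechet_derivative g (at x) v)" for v
    using Suc.IH[of "\<lambda>x. frechet_derivative f (at x) v"] fr Suc.prems(2) by simp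
  then show ?case using df by simp
qed

lemma Ck_on_subset: "Ck_on k S f \<Longrightarrow> T \<subseteq> S \<Longrightarrow> Ck_on k T f"
  by (induction k arbitrary: f) (auto intro: continuous_on_subset)

lemma Ck_on_SucI:
  assumes "open S" "\<And>x. x \<in> S \<Longrightarrow> (f has_derivative f' x) (at x)"
    and "\<And>v. Ck_on k S (\<lambda>x. f' x v)"
  shows "Ck_on (Suc k) S f"
proof -
  have "frechet_derivative f (at x) = f' x" if "x \<in> S" for x
    using frechet_derivative_at[OF assms(2)[OF that]] by simp
  then have "Ck_on k S (\<lambda>x. frechet_derivative f (at x) v)" for v
    by (intro Ck_on_cong[OF assms(1) _ assms(3)[of v]]) simp
  then show ?thesis using assms(2) by (auto simp: differentiable_def)
qed

lemma Ck_on_SucD: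
  assumes "Ck_on (Suc k) S f"
  shows "x \<in> S \<Longrightarrow> (f has_derivative frechet_derivative f (at x)) (at x)"
    and "Ck_on k S (\<lambda>x. frechet_derivative f (at x) v)"
  using assms by (auto simp: frechet_derivative_works)

lemma Ck_on_const: "open S \<Longrightarrow> Ck_on k S (\<lambda>x. c)"
proof (induction k arbitrary: c)
  case (Suc k)
  show ?case by (rule Ck_on_SucI[OF Suc.prems has_derivative_const Suc.IH[OF Suc.prems]])
qed simp

lemma Ck_on_bounded_linear:
  assumes "open S" "bounded_linear h"
  shows "Ck_on k S h"
proof (cases k)
  case 0
  then show ?thesis using assms(2) by (simp add: linear_continuous_on)
next
  case (Suc l)
  have "Ck_on (Suc l) S h"
    by (rule Ck_on_SucI[of S h "\<lambda>_. h", OF assms(1) bounded_linear_imp_has_derivative[OF assms(2)]])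
      (rule Ck_on_const[OF assms(1)])
  then show ?thesis using Suc by simp
qed

lemma Ck_on_linear_compose:
  assumes "open S" "bounded_linear h" "Ck_on k S f"
  shows "Ck_on k S (\<lambda>x. h (f x))"
  using assms(3)
proof (induction k arbitrary: f)
  case 0
  then show ?case
    by (simp add: bounded_linear.continuous_on[OF assms(2)])
next
  case (Suc k)
  show ?case
    by (rule Ck_on_SucI[OF assms(1)])
      (auto intro: bounded_linear.has_derivative[OF assms(2)] Ck_on_SucD[OF Suc.prems] Suc.IH)
qed

lemma Ck_on_add:
  assumes "open S" "Ck_on k S f" "Ck_on k S g"
  shows "Ck_on k S (\<lambda>x. f x + g x)"
  using assms(2,3)
proof (induction k arbitrary: f g)
  case 0
  then show ?case by (simp add: continuous_on_add)
next
  case (Suc k)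
  show ?case
    by (rule Ck_on_SucI[OF assms(1)])
      (auto intro: has_derivative_add Ck_on_SucD[OF Suc.prems(1)] Ck_on_SucD[OF Suc.prems(2)] Suc.IH)
qed

lemma (in bounded_bilinear) Ck_on_bilinear:
  assumes "open S" "Ck_on k S f" "Ck_on k S g"
  shows "Ck_on k S (\<lambda>x. prod (f x) (g x))"
  using assms(2,3)
proof (induction k arbitrary: f g)
  case 0
  then show ?case by (simp add: continuous_on)
next
  case (Suc k)
  note F = Ck_on_SucD[OF Suc.prems(1)] and G = Ck_on_SucD[OF Suc.prems(2)]
  have fg: "Ck_on k S f" "Ck_on k S g" using Suc.prems Ck_on_Suc_imp assms(1) by blast+
  show ?case
    by (rule Ck_on_SucI[OF assms(1)], rule FDERIV[OF F(1) G(1)])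
      (auto intro!: Ck_on_add[OF assms(1)] Suc.IH fg F(2) G(2))
qed

lemma Ck_on_sum:
  assumes "open S" "finite I" "\<And>i. i \<in> I \<Longrightarrow> Ck_on k S (f i)"
  shows "Ck_on k S (\<lambda>x. \<Sum>i\<in>I. f i x)"
  using assms(2,3) by (induction I rule: finite_induct) (auto intro: Ck_on_const Ck_on_add assms(1))

text \<open>The induction needs the derivative of a composition in the form
  \<open>\<Sum>\<^sub>b (D\<^sub>b g \<circ> f) \<cdot> (D\<^sub>v f)\<^sub>b\<close>, a sum of products to which the induction hypothesis applies;
  this is where the space in the middle has to be finite-dimensional.\<close>

lemma Ck_on_compose:
  fixes f :: "'a::real_normed_vector \<Rightarrow> 'c::euclidean_space" and g :: "'c \<Rightarrow> 'd::real_normed_vector"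
  assumes "open S" "open T" "f ` S \<subseteq> T" "Ck_on k S f" "Ck_on k T g"
  shows "Ck_on k S (\<lambda>x. g (f x))"
  using assms(4,5)
proof (induction k arbitrary: g)
  case 0
  then show ?case using continuous_on_compose2[of T g S f] assms(3) by simp
next
  case (Suc k)
  note F = Ck_on_SucD[OF Suc.prems(1)] and G = Ck_on_SucD[OF Suc.prems(2)]
  have f: "Ck_on k S f" using Suc.prems Ck_on_Suc_imp assms(1) by blast
  have expand: "frechet_derivative g (at (f x)) w =
      (\<Sum>b\<in>Basis. (w \<bullet> b) *\<^sub>R frechet_derivative g (at (f x)) b)" if "x \<in> S" for x w
  proof -
    have "linear (frechet_derivative g (at (f x)))"
      using G(1)[of "f x"] that assms(3) by (auto dest: has_derivative_linear)
    then show ?thesis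
      by (subst euclidean_representation[of w, symmetric]) (simp add: linear_sum linear_scale)
  qed
  show ?case
  proof (rule Ck_on_SucI[OF assms(1)])
    show "((\<lambda>x. g (f x)) has_derivative
        (\<lambda>v. frechet_derivative g (at (f x)) (frechet_derivative f (at x) v))) (at x)" if "x \<in> S" for x
      using diff_chain_at[OF F(1)[OF that] G(1)[of "f x"]] that assms(3) by (auto simp: o_def)
    fix v
    have "Ck_on k S (\<lambda>x. \<Sum>b\<in>Basis. (frechet_derivative f (at x) v \<bullet> b) *\<^sub>R frechet_derivative g (at (f x)) b)"
      by (intro Ck_on_sum[OF assms(1)] bounded_bilinear.Ck_on_bilinear[OF bounded_bilinear_scaleR] assms(1)
          Ck_on_linear_compose[OF assms(1) bounded_linear_inner_left] F(2) Suc.IH f G(2) finite_Basis)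
    then show "Ck_on k S (\<lambda>x. frechet_derivative g (at (f x)) (frechet_derivative f (at x) v))"
      by (rule Ck_on_cong[OF assms(1), rotated]) (simp add: expand[symmetric])
  qed
qed

lemma Ck_on_inverse: "Ck_on k (- {0}) (inverse :: complex \<Rightarrow> complex)"
proof (induction k)
  case 0
  show ?case by (auto intro!: continuous_intros)
next
  case (Suc k)
  show ?case
    by (rule Ck_on_SucI[of _ _ "\<lambda>x v. - (inverse x * v * inverse x)"])
      (auto intro!: Ck_on_linear_compose[OF _ bounded_linear_minus[OF bounded_linear_ident]]
        bounded_bilinear.Ck_on_bilinear[OF bounded_bilinear_mult] Ck_on_const Suc has_derivative_inverse'
        simp: open_Compl)
qed

text \<open>The coordinate-level notion of a smooth germ. Working with germs instead of with functions on
  fixed open sets removes all bookkeeping of domains from the rest of the proof.\<close>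

definition germ_smooth :: "'a::real_normed_vector \<Rightarrow> ('a \<Rightarrow> 'b::real_normed_vector) \<Rightarrow> bool" where
  "germ_smooth z g \<longleftrightarrow> (\<exists>T. open T \<and> z \<in> T \<and> smooth_on T g)"

lemma smooth_on_subset: "smooth_on S f \<Longrightarrow> T \<subseteq> S \<Longrightarrow> smooth_on T f"
  unfolding smooth_on_def using Ck_on_subset by blast

text \<open>On open sets smoothness is a local property, although \<^const>\<open>Ck_on\<close> is defined by recursion over
  global functions: at each stage continuity and differentiability are tested pointwise.\<close>

lemma smooth_on_iff_germ:
  assumes "open S"
  shows "smooth_on S f \<longleftrightarrow> (\<forall>z\<in>S. germ_smooth z f)"
proof
  assume R: "\<forall>z\<in>S. germ_smooth z f"
  have "Ck_on k S g" if "\<forall>z\<in>S. \<exists>T. open T \<and> z \<in> T \<and> Ck_on k T g" for k and g :: "'a \<Rightarrow> 'b"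
    using that
  proof (induction k arbitrary: g)
    case 0
    have "isCont g z" if z: "z \<in> S" for z
    proof -
      obtain T where "open T" "z \<in> T" "continuous_on T g" using 0 z by auto
      then show ?thesis using continuous_on_eq_continuous_at by blast
    qed
    then have "continuous_on S g"
      by (intro continuous_on_eq_continuous_at[OF assms, THEN iffD2] ballI)
    then show ?case by (simp only: Ck_on.simps)
  next
    case (Suc k)
    have "\<forall>z\<in>S. \<exists>T. open T \<and> z \<in> T \<and> Ck_on k T (\<lambda>x. frechet_derivative g (at x) v)" for v
    proof
      fix z assume "z \<in> S"
      then obtain T where "open T" "z \<in> T" "Ck_on (Suc k) T g" using Suc.prems by blast
      then show "\<exists>T. open T \<and> z \<in> T \<and> Ck_on k T (\<lambda>x. frechet_derivative g (at x) v)"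
        by (intro exI[of _ T] conjI Ck_on_SucD(2))
    qed
    then have "Ck_on k S (\<lambda>x. frechet_derivative g (at x) v)" for v by (rule Suc.IH)
    moreover have "g differentiable (at z)" if "z \<in> S" for z
      using Suc.prems that unfolding Ck_on.simps by blast
    ultimately show ?case by simp
  qed
  then show "smooth_on S f" using R unfolding smooth_on_def germ_smooth_def by meson
qed (use assms in \<open>auto simp: germ_smooth_def\<close>)

lemma germ_smooth2:
  assumes "germ_smooth z f" "germ_smooth z g"
    and "\<And>T k. open T \<Longrightarrow> Ck_on k T f \<Longrightarrow> Ck_on k T g \<Longrightarrow> Ck_on k T h"
  shows "germ_smooth z h"
proof -
  obtain T T' where "open T" "z \<in> T" "smooth_on T f" "open T'" "z \<in> T'" "smooth_on T' g"
    using assms by (auto simp: germ_smooth_def)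
  then have op: "open (T \<inter> T')" "z \<in> T \<inter> T'"
    and sm: "smooth_on (T \<inter> T') f" "smooth_on (T \<inter> T') g"
    using smooth_on_subset[OF _ Int_lower1] smooth_on_subset[OF _ Int_lower2] by auto
  have "smooth_on (T \<inter> T') h"
    using sm assms(3)[OF op(1)] by (simp add: smooth_on_def)
  then show ?thesis using op by (auto simp: germ_smooth_def)
qed

lemma germ_smooth_add: "germ_smooth z f \<Longrightarrow> germ_smooth z g \<Longrightarrow> germ_smooth z (\<lambda>x. f x + g x)"
  by (erule (1) germ_smooth2) (rule Ck_on_add)

lemma germ_smooth_mult:
  fixes f g :: "_ \<Rightarrow> 'b::real_normed_algebra"
  shows "germ_smooth z f \<Longrightarrow> germ_smooth z g \<Longrightarrow> germ_smooth z (\<lambda>x. f x * g x)"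
  by (erule (1) germ_smooth2) (rule bounded_bilinear.Ck_on_bilinear[OF bounded_bilinear_mult])

lemma germ_smooth_const: "germ_smooth z (\<lambda>x. c)"
  unfolding germ_smooth_def smooth_on_def by (intro exI[of _ UNIV]) (auto intro: Ck_on_const)

lemma germ_smooth_bounded_linear: "bounded_linear h \<Longrightarrow> germ_smooth z h"
  unfolding germ_smooth_def smooth_on_def by (intro exI[of _ UNIV]) (auto intro: Ck_on_bounded_linear)

lemma germ_smooth_cong:
  assumes "germ_smooth z f" "open T" "z \<in> T" "\<And>x. x \<in> T \<Longrightarrow> f x = g x"
  shows "germ_smooth z g"
proof -
  obtain T' where T': "open T'" "z \<in> T'" "smooth_on T' f" using assms by (auto simp: germ_smooth_def)
  have "Ck_on k (T \<inter> T') f" for k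
    using T'(3) Ck_on_subset[OF _ Int_lower2] unfolding smooth_on_def by blast
  then have "Ck_on k (T \<inter> T') g" for k
    by (rule Ck_on_cong[rotated 2]) (use T' assms in auto)
  then show ?thesis using T' assms by (auto simp: germ_smooth_def smooth_on_def intro!: exI[of _ "T \<inter> T'"])
qed

lemma germ_smooth_sum:
  "finite I \<Longrightarrow> (\<And>i. i \<in> I \<Longrightarrow> germ_smooth z (f i)) \<Longrightarrow> germ_smooth z (\<lambda>x. \<Sum>i\<in>I. f i x)"
  by (induction I rule: finite_induct) (auto intro: germ_smooth_const germ_smooth_add)

lemma germ_smooth_differentiable: "germ_smooth z f \<Longrightarrow> f differentiable (at z)"
  unfolding germ_smooth_def smooth_on_def by (metis Ck_on.simps(2))

lemma germ_smooth_derivative: "germ_smooth z f \<Longrightarrow> germ_smooth z (\<lambda>x. frechet_derivative f (at x) v)"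
  unfolding germ_smooth_def smooth_on_def by (metis Ck_on.simps(2))

lemma germ_smooth_compose:
  fixes f :: "'a::real_normed_vector \<Rightarrow> 'c::euclidean_space" and g :: "'c \<Rightarrow> 'd::real_normed_vector"
  assumes "germ_smooth z f" "germ_smooth (f z) g"
  shows "germ_smooth z (\<lambda>x. g (f x))"
proof -
  obtain T where T: "open T" "z \<in> T" "smooth_on T f" using assms by (auto simp: germ_smooth_def)
  obtain T' where T': "open T'" "f z \<in> T'" "smooth_on T' g" using assms by (auto simp: germ_smooth_def)
  have "continuous_on T f" using T(3) Ck_on.simps(1) unfolding smooth_on_def by metis
  then have op: "open (T \<inter> f -` T')" using T T' by (simp add: continuous_on_open_vimage Int_commute)
  have "Ck_on k (T \<inter> f -` T') f" for k
    using T(3) Ck_on_subset[OF _ Int_lower1] unfolding smooth_on_def by blast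
  then have "Ck_on k (T \<inter> f -` T') (\<lambda>x. g (f x))" for k
    by (rule Ck_on_compose[OF op T'(1), rotated]) (use T' in \<open>auto simp: smooth_on_def\<close>)
  then show ?thesis using op T T' by (auto simp: germ_smooth_def smooth_on_def intro!: exI[of _ "T \<inter> f -` T'"])
qed

lemma germ_smooth_linear_compose:
  assumes "bounded_linear h" "germ_smooth z f"
  shows "germ_smooth z (\<lambda>x. h (f x))"
  by (rule germ_smooth2[OF assms(2,2)]) (rule Ck_on_linear_compose[OF _ assms(1)])

lemma germ_smooth_inverse:
  fixes f :: "'a::real_normed_vector \<Rightarrow> complex"
  assumes "germ_smooth z f" "f z \<noteq> 0"
  shows "germ_smooth z (\<lambda>x. inverse (f x))"
  by (rule germ_smooth_compose[OF assms(1)])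
    (use assms(2) Ck_on_inverse in \<open>auto simp: germ_smooth_def smooth_on_def open_Compl intro!: exI[of _ "- {0}"]\<close>)

lemma germ_smooth_vec:
  fixes f :: "'a::real_normed_vector \<Rightarrow> complex^'d::finite"
  assumes "\<And>k. germ_smooth z (\<lambda>x. f x $ k)"
  shows "germ_smooth z f"
proof -
  have lin: "bounded_linear (\<lambda>c. axis k c :: complex^'d)" for k
    unfolding linear_conv_bounded_linear[symmetric]
    by (intro linearI) (auto simp: axis_def vec_eq_iff)
  have "f = (\<lambda>x. \<Sum>k\<in>UNIV. axis k (f x $ k))"
    by (auto simp: vec_eq_iff axis_def sum.delta if_distrib cong: if_cong)
  moreover have "germ_smooth z (\<lambda>x. \<Sum>k\<in>UNIV. axis k (f x $ k) :: complex^'d)"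
    by (intro germ_smooth_sum germ_smooth_linear_compose[OF lin] assms) simp
  ultimately show ?thesis by simp
qed

lemma germ_smooth_cnj: "germ_smooth z f \<Longrightarrow> germ_smooth z (\<lambda>x. cnj (f x))"
  by (rule germ_smooth_linear_compose[OF bounded_linear_cnj])

lemma germ_smooth_nth: "germ_smooth z (\<lambda>x :: complex^'d::finite. x $ k)"
  by (rule germ_smooth_bounded_linear[OF bounded_linear_vec_nth])


section \<open>Wirtinger derivatives\<close>

text \<open>A real-linear functional on \<open>\<complex>\<^sup>d\<close> is the sum of a complex-linear and an antilinear one; the Wirtinger
  derivatives are the coefficients of the two parts of the derivative.\<close>

lemma frechet_derivative_wirtinger:
  assumes "f differentiable (at z)"
  shows "frechet_derivative f (at z) v = (\<Sum>k\<in>UNIV. dz k f z * v $ k + dzbar k f z * cnj (v $ k))"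
proof -
  define L where "L = frechet_derivative f (at z)"
  have lin: "linear L" using assms linear_frechet_derivative unfolding L_def by blast
  have comp: "L (axis k c) = dz k f z * c + dzbar k f z * cnj c" for k c
  proof -
    have "axis k c = Re c *\<^sub>R axis k 1 + Im c *\<^sub>R axis k \<i>"
      by (auto simp: vec_eq_iff axis_def complex_eq_iff)
    then have "L (axis k c) = Re c *\<^sub>R L (axis k 1) + Im c *\<^sub>R L (axis k \<i>)"
      using lin by (simp add: linear_add linear_scale)
    then show ?thesis
      unfolding dz_def dzbar_def L_def[symmetric] by (auto simp: complex_eq_iff field_simps)
  qed
  have "v = (\<Sum>k\<in>UNIV. axis k (v $ k))"
    by (auto simp: vec_eq_iff axis_def sum.delta if_distrib cong: if_cong)
  then have "L v = (\<Sum>k\<in>UNIV. L (axis k (v $ k)))" using lin by (metis linear_sum)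
  then show ?thesis by (simp only: comp) (simp only: L_def)
qed

text \<open>Since the two parts are unique, every rule for the real derivative yields the corresponding rules for the
  Wirtinger derivatives by comparison of coefficients.\<close>

lemma wirtinger_unique:
  assumes "(f has_derivative (\<lambda>v. \<Sum>k\<in>UNIV. p k * v $ k + q k * cnj (v $ k))) (at z)"
  shows "dz k f z = p k" "dzbar k f z = q k"
proof -
  have "frechet_derivative f (at z) (axis k c) = p k * c + q k * cnj c" for c
  proof -
    have "frechet_derivative f (at z) (axis k c) = (\<Sum>j\<in>UNIV. if j = k then p j * c + q j * cnj c else 0)"
      unfolding frechet_derivative_at[OF assms, symmetric] by (rule sum.cong) (auto simp: axis_def)
    then show ?thesis by simp
  qed
  then show "dz k f z = p k" "dzbar k f z = q k" by (auto simp: dz_def dzbar_def algebra_simps)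
qed

lemma has_derivative_wirtinger:
  "f differentiable (at z) \<Longrightarrow>
    (f has_derivative (\<lambda>v. \<Sum>k\<in>UNIV. dz k f z * v $ k + dzbar k f z * cnj (v $ k))) (at z)"
proof -
  assume d: "f differentiable (at z)"
  have "frechet_derivative f (at z) = (\<lambda>v. \<Sum>k\<in>UNIV. dz k f z * v $ k + dzbar k f z * cnj (v $ k))"
    by (rule ext) (rule frechet_derivative_wirtinger[OF d])
  then show ?thesis using d frechet_derivative_works[of f "at z"] by (simp only:)
qed

lemma wirtinger_add:
  assumes "f differentiable (at z)" "g differentiable (at z)"
  shows "dz k (\<lambda>x. f x + g x) z = dz k f z + dz k g z"
    "dzbar k (\<lambda>x. f x + g x) z = dzbar k f z + dzbar k g z"
proof -
  have "((\<lambda>x. f x + g x) has_derivative (\<lambda>v. \<Sum>k\<in>UNIV. (dz k f z + dz k g z) * v $ k +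
      (dzbar k f z + dzbar k g z) * cnj (v $ k))) (at z)"
    using has_derivative_add[OF assms[THEN has_derivative_wirtinger]]
    by (simp add: sum.distrib[symmetric] algebra_simps)
  from wirtinger_unique[OF this] show "dz k (\<lambda>x. f x + g x) z = dz k f z + dz k g z"
    "dzbar k (\<lambda>x. f x + g x) z = dzbar k f z + dzbar k g z" by auto
qed

lemma wirtinger_mult:
  assumes "f differentiable (at z)" "g differentiable (at z)"
  shows "dz k (\<lambda>x. f x * g x) z = f z * dz k g z + g z * dz k f z"
    "dzbar k (\<lambda>x. f x * g x) z = f z * dzbar k g z + g z * dzbar k f z"
proof -
  have "((\<lambda>x. f x * g x) has_derivative (\<lambda>v. \<Sum>k\<in>UNIV. (f z * dz k g z + g z * dz k f z) * v $ k +
      (f z * dzbar k g z + g z * dzbar k f z) * cnj (v $ k))) (at z)"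
    using has_derivative_mult[OF assms[THEN has_derivative_wirtinger]]
    by (simp add: sum.distrib[symmetric] sum_distrib_left sum_distrib_right algebra_simps)
  from wirtinger_unique[OF this] show "dz k (\<lambda>x. f x * g x) z = f z * dz k g z + g z * dz k f z"
    "dzbar k (\<lambda>x. f x * g x) z = f z * dzbar k g z + g z * dzbar k f z" by auto
qed

lemma wirtinger_cnj:
  assumes "f differentiable (at z)"
  shows "dz k (\<lambda>x. cnj (f x)) z = cnj (dzbar k f z)" "dzbar k (\<lambda>x. cnj (f x)) z = cnj (dz k f z)"
proof -
  have "((\<lambda>x. cnj (f x)) has_derivative (\<lambda>v. \<Sum>k\<in>UNIV. cnj (dzbar k f z) * v $ k +
      cnj (dz k f z) * cnj (v $ k))) (at z)"
    using bounded_linear.has_derivative[OF bounded_linear_cnj has_derivative_wirtinger[OF assms]]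
    by (simp add: sum.distrib[symmetric] algebra_simps)
  from wirtinger_unique[OF this] show "dz k (\<lambda>x. cnj (f x)) z = cnj (dzbar k f z)"
    "dzbar k (\<lambda>x. cnj (f x)) z = cnj (dz k f z)" by auto
qed

lemma wirtinger_const: "dz k (\<lambda>x. c) z = 0" "dzbar k (\<lambda>x. c) z = 0"
  by (simp_all add: dz_def dzbar_def)

lemma wirtinger_nth:
  "dz k (\<lambda>x. x $ j) z = (if k = j then 1 else 0)" "dzbar k (\<lambda>x. x $ j) z = 0"
proof -
  have "((\<lambda>x :: complex^'a. x $ j) has_derivative (\<lambda>v. \<Sum>k\<in>UNIV. (if k = j then 1 else 0) * v $ k + 0 * cnj (v $ k))) (at z)"
    using bounded_linear_imp_has_derivative[OF bounded_linear_vec_nth[of j]]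
    by (simp add: if_distrib[of "\<lambda>x. x * _"] cong: if_cong)
  from wirtinger_unique[OF this] show "dz k (\<lambda>x. x $ j) z = (if k = j then 1 else 0)"
    "dzbar k (\<lambda>x. x $ j) z = 0" by auto
qed

lemma wirtinger_cong:
  assumes "open T" "z \<in> T" "\<forall>x\<in>T. f x = g x" "f differentiable (at z)"
  shows "dz k f z = dz k g z" "dzbar k f z = dzbar k g z"
  using frechet_derivative_transform_within_open[OF assms(4,1,2)] assms(3) by (auto simp: dz_def dzbar_def)

text \<open>For a holomorphic inner map one of the two summands vanishes in each formula, so that the two kinds of
  derivatives do not mix.\<close>

lemma wirtinger_chain:
  fixes f :: "complex^'d::finite \<Rightarrow> complex" and g :: "complex^'c::finite \<Rightarrow> complex^'d"
  assumes f: "f differentiable (at (g z))" and g: "g differentiable (at z)"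
  shows "dz j (\<lambda>x. f (g x)) z = (\<Sum>k\<in>UNIV. dz k f (g z) * dz j (\<lambda>x. g x $ k) z
      + dzbar k f (g z) * cnj (dzbar j (\<lambda>x. g x $ k) z))"
    "dzbar j (\<lambda>x. f (g x)) z = (\<Sum>k\<in>UNIV. dz k f (g z) * dzbar j (\<lambda>x. g x $ k) z
      + dzbar k f (g z) * cnj (dz j (\<lambda>x. g x $ k) z))"
proof -
  define D where "D = frechet_derivative g (at z)"
  have D: "(g has_derivative D) (at z)" using g frechet_derivative_works unfolding D_def by blast
  have Dk: "D v $ k = frechet_derivative (\<lambda>x. g x $ k) (at z) v" for v k
    using frechet_derivative_at[OF bounded_linear.has_derivative[OF bounded_linear_vec_nth D]] by metis
  have "frechet_derivative (\<lambda>x. f (g x)) (at z) v = (\<Sum>k\<in>UNIV. dz k f (g z) * frechet_derivative (\<lambda>x. g x $ k) (at z) v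
      + dzbar k f (g z) * cnj (frechet_derivative (\<lambda>x. g x $ k) (at z) v))" for v
    using frechet_derivative_compose[OF g f] frechet_derivative_wirtinger[OF f]
    by (simp add: o_def Dk D_def[symmetric])
  note * = this
  show "dz j (\<lambda>x. f (g x)) z = (\<Sum>k\<in>UNIV. dz k f (g z) * dz j (\<lambda>x. g x $ k) z
      + dzbar k f (g z) * cnj (dzbar j (\<lambda>x. g x $ k) z))"
    "dzbar j (\<lambda>x. f (g x)) z = (\<Sum>k\<in>UNIV. dz k f (g z) * dzbar j (\<lambda>x. g x $ k) z
      + dzbar k f (g z) * cnj (dz j (\<lambda>x. g x $ k) z))"
    unfolding dz_def[of j "\<lambda>x. f (g x)"] dzbar_def[of j "\<lambda>x. f (g x)"] *
    unfolding sum_distrib_left sum_subtractf[symmetric] sum.distrib[symmetric] sum_divide_distrib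
    by (auto simp: dz_def[of j] dzbar_def[of j] field_simps intro!: sum.cong)
qed

lemma germ_smooth_wirtinger:
  assumes "germ_smooth z f"
  shows "germ_smooth z (dz k f)" "germ_smooth z (dzbar k f)"
proof -
  have "germ_smooth z (\<lambda>x. 1/2 * (frechet_derivative f (at x) (axis k 1) + c * frechet_derivative f (at x) (axis k \<i>)))" for c
    by (intro germ_smooth_mult germ_smooth_add germ_smooth_const germ_smooth_derivative assms)
  from this[of "-\<i>"] this[of "\<i>"] show "germ_smooth z (dz k f)" "germ_smooth z (dzbar k f)"
    by (simp_all add: dz_def[abs_def] dzbar_def[abs_def])
qed

section \<open>Complex manifolds\<close>

definition coord :: "('p, 'd::finite) chart \<Rightarrow> 'd \<Rightarrow> 'p \<Rightarrow> complex" where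
  "coord c i p = snd c p $ i"

abbreviation chart_inv :: "('p, 'd::finite) chart \<Rightarrow> complex^'d \<Rightarrow> 'p" where
  "chart_inv c \<equiv> inv_into (fst c) (snd c)"

locale complex_manifold =
  fixes A :: "('p::topological_space, 'd::finite) chart set"
  assumes atlas: "complex_atlas A"
begin

lemma chart_ex: "\<exists>c\<in>A. p \<in> fst c"
proof -
  have "p \<in> \<Union> (fst ` A)" using atlas unfolding complex_atlas_def by simp
  then show ?thesis by blast
qed

lemma chart_open: "c \<in> A \<Longrightarrow> open (fst c)"
  and chart_image_open0: "c \<in> A \<Longrightarrow> open (snd c ` fst c)"
  and chart_homeo: "c \<in> A \<Longrightarrow> homeomorphism (fst c) (snd c ` fst c) (snd c) (chart_inv c)"
  using atlas unfolding complex_atlas_def case_prod_beta by simp_all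

lemma chart_inv: "c \<in> A \<Longrightarrow> p \<in> fst c \<Longrightarrow> chart_inv c (snd c p) = p"
  using chart_homeo unfolding homeomorphism_def by blast

lemma chart_cont: "c \<in> A \<Longrightarrow> continuous_on (fst c) (snd c)"
  using chart_homeo unfolding homeomorphism_def by blast

lemma chart_image_open:
  assumes "c \<in> A" "open W"
  shows "open (snd c ` (fst c \<inter> W))"
proof -
  have "openin (top_of_set (fst c)) (fst c \<inter> W)" using assms(2) by (simp add: openin_open_Int)
  then have "openin (top_of_set (snd c ` fst c)) (snd c ` (fst c \<inter> W))"
    by (rule homeomorphism_imp_open_map[OF chart_homeo[OF assms(1)]])
  then show ?thesis using chart_image_open0[OF assms(1)] openin_open_eq by blast
qed

lemma chart_vimage_open:
  assumes "c \<in> A" "open T"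
  shows "open (fst c \<inter> snd c -` T)"
  using continuous_on_open_vimage[OF chart_open[OF assms(1)]] chart_cont[OF assms(1)] assms(2)
  by (metis Int_commute)

lemma transition_holo:
  assumes "c \<in> A" "c' \<in> A"
  shows "holo_on (snd c ` (fst c \<inter> fst c')) (\<lambda>z. snd c' (chart_inv c z) $ k)"
  using atlas assms unfolding complex_atlas_def case_prod_beta by simp

lemma transition_germ:
  assumes "c \<in> A" "c' \<in> A" "p \<in> fst c" "p \<in> fst c'"
  shows "germ_smooth (snd c p) (\<lambda>z. snd c' (chart_inv c z))"
    and "dzbar j (\<lambda>z. snd c' (chart_inv c z) $ k) (snd c p) = 0"
proof -
  have z: "snd c p \<in> snd c ` (fst c \<inter> fst c')" using assms by blast
  have op: "open (snd c ` (fst c \<inter> fst c'))" by (simp add: chart_image_open chart_open assms)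
  show "germ_smooth (snd c p) (\<lambda>z. snd c' (chart_inv c z))"
    by (rule germ_smooth_vec)
      (use transition_holo[OF assms(1,2)] z op in \<open>auto simp: holo_on_def germ_smooth_def\<close>)
  show "dzbar j (\<lambda>z. snd c' (chart_inv c z) $ k) (snd c p) = 0"
    using transition_holo[OF assms(1,2)] z unfolding holo_on_def by blast
qed

lemma near_chart:
  assumes "c \<in> A" "p \<in> fst c" "open W" "p \<in> W"
  shows "open (snd c ` (fst c \<inter> W))" "snd c p \<in> snd c ` (fst c \<inter> W)"
    "\<And>z. z \<in> snd c ` (fst c \<inter> W) \<Longrightarrow> chart_inv c z \<in> fst c \<inter> W \<and> snd c (chart_inv c z) = z"
  using assms chart_inv by (auto simp: chart_image_open)

text \<open>Smoothness near a point can be tested in a single chart because the coordinate changes are smooth.\<close>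

lemma smooth_at_iff:
  assumes c: "c \<in> A" "p \<in> fst c"
  shows "smooth_at A p f \<longleftrightarrow> germ_smooth (snd c p) (f \<circ> chart_inv c)"
proof
  assume "smooth_at A p f"
  then obtain W where W: "open W" "p \<in> W" "smooth_fun A W f" by (auto simp: smooth_at_def)
  have "smooth_on (snd c ` (fst c \<inter> W)) (f \<circ> chart_inv c)"
    using W(3) c(1) by (simp add: smooth_fun_def case_prod_beta)
  then show "germ_smooth (snd c p) (f \<circ> chart_inv c)"
    using near_chart[OF c W(1,2)] unfolding germ_smooth_def by blast
next
  assume "germ_smooth (snd c p) (f \<circ> chart_inv c)"
  then obtain T where T: "open T" "snd c p \<in> T" "smooth_on T (f \<circ> chart_inv c)"
    by (auto simp: germ_smooth_def)
  define W where "W = fst c \<inter> snd c -` T"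
  have W: "open W" "p \<in> W" using chart_vimage_open[OF c(1) T(1)] c(2) T(2) by (auto simp: W_def)
  have germ: "germ_smooth (snd c' q) (f \<circ> chart_inv c')" if c': "c' \<in> A" and q: "q \<in> fst c'" "q \<in> W" for c' q
  proof -
    have qc: "q \<in> fst c" using q by (simp add: W_def)
    have inv: "chart_inv c' (snd c' q) = q" using chart_inv c' q by blast
    have "germ_smooth (snd c q) (f \<circ> chart_inv c)"
      using T q unfolding W_def germ_smooth_def by blast
    then have "germ_smooth (snd c' q) (\<lambda>z. (f \<circ> chart_inv c) (snd c (chart_inv c' z)))"
      using germ_smooth_compose[OF transition_germ(1)[OF c' c(1) q(1) qc], of "f \<circ> chart_inv c"] inv by simp
    then show ?thesis
      by (rule germ_smooth_cong[OF _ near_chart(1,2)[OF c' q(1) chart_open[OF c(1)] qc]])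
        (use near_chart(3)[OF c' q(1) chart_open[OF c(1)] qc] chart_inv[OF c(1)] in auto)
  qed
  have "smooth_on (snd c' ` (fst c' \<inter> W)) (f \<circ> chart_inv c')" if "c' \<in> A" for c'
    unfolding smooth_on_iff_germ[OF chart_image_open[OF that W(1)]] using germ[OF that] by blast
  then have "smooth_fun A W f" by (simp add: smooth_fun_def case_prod_beta)
  then show "smooth_at A p f" using W by (auto simp: smooth_at_def)
qed

lemma smooth_fun_iff:
  assumes "open W"
  shows "smooth_fun A W f \<longleftrightarrow> (\<forall>p\<in>W. smooth_at A p f)"
proof
  assume R: "\<forall>p\<in>W. smooth_at A p f"
  have "smooth_on (snd c ` (fst c \<inter> W)) (f \<circ> chart_inv c)" if c: "c \<in> A" for c
    using smooth_on_iff_germ[OF chart_image_open[OF c assms]] R smooth_at_iff[OF c] by auto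
  then show "smooth_fun A W f" by (simp add: smooth_fun_def case_prod_beta)
qed (use assms in \<open>auto simp: smooth_at_def\<close>)

lemma smooth_at_nbhd:
  assumes "smooth_at A p f"
  obtains W where "open W" "p \<in> W" "\<And>q. q \<in> W \<Longrightarrow> smooth_at A q f"
  using assms unfolding smooth_at_def by blast

lemma smooth_at_cong:
  assumes "smooth_at A p f" "open W" "p \<in> W" "\<And>q. q \<in> W \<Longrightarrow> f q = g q"
  shows "smooth_at A p g"
proof -
  obtain c where c: "c \<in> A" "p \<in> fst c" using chart_ex by blast
  show ?thesis using assms(1) unfolding smooth_at_iff[OF c]
    by (rule germ_smooth_cong[OF _ near_chart(1,2)[OF c assms(2,3)]])
      (use near_chart(3)[OF c assms(2,3)] assms(4) in auto)
qed

lemma smooth_at_const: "smooth_at A p (\<lambda>x. k)"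
proof -
  obtain c where c: "c \<in> A" "p \<in> fst c" using chart_ex by blast
  show ?thesis unfolding smooth_at_iff[OF c] o_def by (rule germ_smooth_const)
qed

lemma smooth_at_add: "smooth_at A p f \<Longrightarrow> smooth_at A p g \<Longrightarrow> smooth_at A p (\<lambda>x. f x + g x)"
proof -
  obtain c where c: "c \<in> A" "p \<in> fst c" using chart_ex by blast
  show "smooth_at A p f \<Longrightarrow> smooth_at A p g \<Longrightarrow> ?thesis"
    unfolding smooth_at_iff[OF c] o_def by (rule germ_smooth_add)
qed

lemma smooth_at_mult: "smooth_at A p f \<Longrightarrow> smooth_at A p g \<Longrightarrow> smooth_at A p (\<lambda>x. f x * g x)"
proof -
  obtain c where c: "c \<in> A" "p \<in> fst c" using chart_ex by blast
  show "smooth_at A p f \<Longrightarrow> smooth_at A p g \<Longrightarrow> ?thesis"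
    unfolding smooth_at_iff[OF c] o_def by (rule germ_smooth_mult)
qed

lemma smooth_at_cnj: "smooth_at A p f \<Longrightarrow> smooth_at A p (\<lambda>x. cnj (f x))"
proof -
  obtain c where c: "c \<in> A" "p \<in> fst c" using chart_ex by blast
  show "smooth_at A p f \<Longrightarrow> ?thesis"
    unfolding smooth_at_iff[OF c] o_def by (rule germ_smooth_cnj)
qed

lemma smooth_at_cnj_iff: "smooth_at A p (\<lambda>x. cnj (f x)) \<longleftrightarrow> smooth_at A p f"
  using smooth_at_cnj[of p f] smooth_at_cnj[of p "\<lambda>x. cnj (f x)"] by auto

lemma smooth_at_inverse: "smooth_at A p f \<Longrightarrow> f p \<noteq> 0 \<Longrightarrow> smooth_at A p (\<lambda>x. inverse (f x))"
proof -
  obtain c where c: "c \<in> A" "p \<in> fst c" using chart_ex by blast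
  show "smooth_at A p f \<Longrightarrow> f p \<noteq> 0 \<Longrightarrow> ?thesis"
    unfolding smooth_at_iff[OF c] o_def by (rule germ_smooth_inverse) (simp_all add: chart_inv c)
qed

lemma smooth_at_sum:
  "(\<And>i. i \<in> I \<Longrightarrow> smooth_at A p (f i)) \<Longrightarrow> smooth_at A p (\<lambda>x. \<Sum>i\<in>I. f i x)"
  by (induction I rule: infinite_finite_induct) (auto intro: smooth_at_const smooth_at_add)

lemma smooth_at_prod:
  "(\<And>i. i \<in> I \<Longrightarrow> smooth_at A p (f i)) \<Longrightarrow> smooth_at A p (\<lambda>x. \<Prod>i\<in>I. f i x)"
  by (induction I rule: infinite_finite_induct) (auto intro: smooth_at_const smooth_at_mult)

lemma smooth_at_uminus: "smooth_at A p f \<Longrightarrow> smooth_at A p (\<lambda>x. - f x)"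
  using smooth_at_mult[OF smooth_at_const[of p "-1"]] by simp

lemma smooth_at_diff: "smooth_at A p f \<Longrightarrow> smooth_at A p g \<Longrightarrow> smooth_at A p (\<lambda>x. f x - g x)"
  using smooth_at_add[OF _ smooth_at_uminus] by fastforce

lemma smooth_at_coord:
  assumes "c \<in> A" "p \<in> fst c"
  shows "smooth_at A p (coord c i)"
  unfolding smooth_at_iff[OF assms]
  by (rule germ_smooth_cong[OF germ_smooth_nth[of _ i] near_chart(1,2)[OF assms open_UNIV UNIV_I]])
    (use near_chart(3)[OF assms open_UNIV UNIV_I] in \<open>auto simp: coord_def\<close>)

lemma smooth_at_pd:
  assumes "c \<in> A" "p \<in> fst c" "smooth_at A p f"
  shows "smooth_at A p (pd c i f)" "smooth_at A p (pdbar c i f)"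
  using assms(3) unfolding smooth_at_iff[OF assms(1,2)]
  by (rule germ_smooth_cong[OF germ_smooth_wirtinger(1)[of _ _ i] near_chart(1,2)[OF assms(1,2) open_UNIV UNIV_I]]
      germ_smooth_cong[OF germ_smooth_wirtinger(2)[of _ _ i] near_chart(1,2)[OF assms(1,2) open_UNIV UNIV_I]];
    use near_chart(3)[OF assms(1,2) open_UNIV UNIV_I] in \<open>auto simp: pd_def pdbar_def\<close>)+

lemma smooth_at_differentiable:
  assumes "c \<in> A" "p \<in> fst c" "smooth_at A p f"
  shows "(f \<circ> chart_inv c) differentiable (at (snd c p))"
  using assms smooth_at_iff germ_smooth_differentiable by blast

lemma pd_add:
  assumes "c \<in> A" "p \<in> fst c" "smooth_at A p f" "smooth_at A p g"
  shows "pd c i (\<lambda>x. f x + g x) p = pd c i f p + pd c i g p"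
    "pdbar c i (\<lambda>x. f x + g x) p = pdbar c i f p + pdbar c i g p"
  unfolding pd_def pdbar_def
  using wirtinger_add[OF smooth_at_differentiable[OF assms(1-3)] smooth_at_differentiable[OF assms(1,2,4)]]
  by (simp_all add: o_def)

lemma pd_mult:
  assumes "c \<in> A" "p \<in> fst c" "smooth_at A p f" "smooth_at A p g"
  shows "pd c i (\<lambda>x. f x * g x) p = f p * pd c i g p + g p * pd c i f p"
    "pdbar c i (\<lambda>x. f x * g x) p = f p * pdbar c i g p + g p * pdbar c i f p"
  unfolding pd_def pdbar_def
  using wirtinger_mult[OF smooth_at_differentiable[OF assms(1-3)] smooth_at_differentiable[OF assms(1,2,4)]]
  by (simp_all add: o_def chart_inv assms)

lemma pd_cnj:
  assumes "c \<in> A" "p \<in> fst c" "smooth_at A p f"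
  shows "pd c i (\<lambda>x. cnj (f x)) p = cnj (pdbar c i f p)"
    "pdbar c i (\<lambda>x. cnj (f x)) p = cnj (pd c i f p)"
  unfolding pd_def pdbar_def
  using wirtinger_cnj[OF smooth_at_differentiable[OF assms(1-3)]]
  by (simp_all add: o_def)

lemma pd_const: "pd c i (\<lambda>x. k) p = 0" "pdbar c i (\<lambda>x. k) p = 0"
  by (simp_all add: pd_def pdbar_def o_def wirtinger_const)

lemma pd_cong:
  assumes "c \<in> A" "p \<in> fst c" "smooth_at A p f" "open W" "p \<in> W" "\<And>q. q \<in> W \<Longrightarrow> f q = g q"
  shows "pd c i f p = pd c i g p" "pdbar c i f p = pdbar c i g p"
  unfolding pd_def pdbar_def
  by (rule wirtinger_cong[OF near_chart(1,2)[OF assms(1,2,4,5)]];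
    use near_chart(3)[OF assms(1,2,4,5)] assms(6) smooth_at_differentiable[OF assms(1-3)] in auto)+

lemma pd_coord:
  assumes "c \<in> A" "p \<in> fst c"
  shows "pd c i (coord c j) p = (if i = j then 1 else 0)" "pdbar c i (coord c j) p = 0"
proof -
  have d: "(\<lambda>x :: complex^'d. x $ j) differentiable (at (snd c p))"
    by (rule germ_smooth_differentiable[OF germ_smooth_nth])
  have e: "\<forall>z\<in>snd c ` (fst c \<inter> UNIV). z $ j = (coord c j \<circ> chart_inv c) z"
    using near_chart(3)[OF assms open_UNIV UNIV_I] by (simp add: coord_def)
  note w = wirtinger_cong[where f = "\<lambda>x. x $ j" and g = "coord c j \<circ> chart_inv c" and k = i,
      OF near_chart(1,2)[OF assms open_UNIV UNIV_I] e d]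
  show "pd c i (coord c j) p = (if i = j then 1 else 0)" "pdbar c i (coord c j) p = 0"
    unfolding pd_def pdbar_def w[symmetric] by (simp_all add: wirtinger_nth)
qed

lemma pdbar_coord:
  assumes "c \<in> A" "c' \<in> A" "p \<in> fst c" "p \<in> fst c'"
  shows "pdbar c j (coord c' i) p = 0"
  using transition_germ(2)[OF assms] by (simp add: pdbar_def coord_def o_def)

text \<open>Coordinate changes are holomorphic, so the derivatives of type (1,0) transform among themselves.\<close>

lemma pd_chain:
  assumes c: "c \<in> A" "p \<in> fst c" and c': "c' \<in> A" "p \<in> fst c'" and f: "smooth_at A p f"
  shows "pd c' j f p = (\<Sum>i\<in>UNIV. pd c' j (coord c i) p * pd c i f p)"
    "pdbar c' j f p = (\<Sum>i\<in>UNIV. cnj (pd c' j (coord c i) p) * pdbar c i f p)"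
proof -
  define \<tau> where "\<tau> = (\<lambda>z. snd c (chart_inv c' z))"
  have \<tau>: "\<tau> (snd c' p) = snd c p" using chart_inv c' by (simp add: \<tau>_def)
  have d1: "(f \<circ> chart_inv c) differentiable (at (\<tau> (snd c' p)))"
    using smooth_at_differentiable[OF c f] \<tau> by simp
  have d2: "\<tau> differentiable (at (snd c' p))"
    unfolding \<tau>_def by (rule germ_smooth_differentiable[OF transition_germ(1)[OF c'(1) c(1) c'(2) c(2)]])
  have e: "\<forall>z\<in>snd c' ` (fst c' \<inter> fst c). (f \<circ> chart_inv c') z = (f \<circ> chart_inv c) (\<tau> z)"
    using near_chart(3)[OF c' chart_open[OF c(1)] c(2)] chart_inv[OF c(1)] by (auto simp: \<tau>_def)
  note w = wirtinger_cong[where f = "f \<circ> chart_inv c'" and g = "\<lambda>z. (f \<circ> chart_inv c) (\<tau> z)" and k = j,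
      OF near_chart(1,2)[OF c' chart_open[OF c(1)] c(2)] e smooth_at_differentiable[OF c' f]]
  have k: "dzbar j (\<lambda>x. \<tau> x $ k) (snd c' p) = 0" for k
    unfolding \<tau>_def using transition_germ(2)[OF c'(1) c(1) c'(2) c(2)] .
  have k': "dz j (\<lambda>x. \<tau> x $ k) (snd c' p) = pd c' j (coord c k) p" for k
    by (simp add: pd_def coord_def o_def \<tau>_def)
  show "pd c' j f p = (\<Sum>i\<in>UNIV. pd c' j (coord c i) p * pd c i f p)"
    "pdbar c' j f p = (\<Sum>i\<in>UNIV. cnj (pd c' j (coord c i) p) * pdbar c i f p)"
    unfolding pd_def[of c' j f] pdbar_def[of c' j f] w wirtinger_chain[OF d1 d2] k k' \<tau>
    by (simp_all add: pd_def[of c] pdbar_def[of c] mult.commute)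
qed


section \<open>Complexified tangent vectors\<close>

text \<open>The complexified tangent space at \<open>p\<close>. Its elements are determined by their values on the
  coordinate functions \<open>x\<^sup>i\<close> and their conjugates; this allows to
  prove identities between vectors without choosing coefficients.\<close>

definition ctan :: "'p \<Rightarrow> 'p tvec set" where
  "ctan p = {v. \<exists>c\<in>A. p \<in> fst c \<and>
     (\<exists>a b. v = (\<lambda>f. if smooth_at A p f then \<Sum>i\<in>UNIV. a i * pd c i f p + b i * pdbar c i f p else 0))}"

lemma ctanI:
  assumes "c \<in> A" "p \<in> fst c"
    and "\<And>f. smooth_at A p f \<Longrightarrow> v f = (\<Sum>i\<in>UNIV. a i * pd c i f p + b i * pdbar c i f p)"
    and "\<And>f. \<not> smooth_at A p f \<Longrightarrow> v f = 0"
  shows "v \<in> ctan p"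
  unfolding ctan_def using assms by (intro CollectI bexI[of _ c] conjI exI[of _ a] exI[of _ b]) auto

lemma ctan_nonsmooth: "v \<in> ctan p \<Longrightarrow> \<not> smooth_at A p f \<Longrightarrow> v f = 0"
  unfolding ctan_def by auto

lemma ctan_repr:
  assumes v: "v \<in> ctan p" and c: "c \<in> A" "p \<in> fst c" and f: "smooth_at A p f"
  shows "v f = (\<Sum>i\<in>UNIV. v (coord c i) * pd c i f p + v (\<lambda>x. cnj (coord c i x)) * pdbar c i f p)"
proof -
  obtain c' a b where c': "c' \<in> A" "p \<in> fst c'" and
    v': "v = (\<lambda>f. if smooth_at A p f then \<Sum>i\<in>UNIV. a i * pd c' i f p + b i * pdbar c' i f p else 0)"
    using v unfolding ctan_def by blast
  note s = smooth_at_coord[OF c]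
  have v1: "v (coord c i) = (\<Sum>j\<in>UNIV. a j * pd c' j (coord c i) p)" for i
    using s c c' by (simp add: v' pdbar_coord)
  have v2: "v (\<lambda>x. cnj (coord c i x)) = (\<Sum>j\<in>UNIV. b j * cnj (pd c' j (coord c i) p))" for i
    using s c c' by (simp add: v' smooth_at_cnj pd_cnj[OF c' s] pdbar_coord)
  have "v f = (\<Sum>j\<in>UNIV. \<Sum>i\<in>UNIV. a j * pd c' j (coord c i) p * pd c i f p
      + b j * cnj (pd c' j (coord c i) p) * pdbar c i f p)"
    using f by (simp add: v' pd_chain[OF c c' f] sum_distrib_left sum.distrib mult.assoc)
  also have "\<dots> = (\<Sum>i\<in>UNIV. \<Sum>j\<in>UNIV. a j * pd c' j (coord c i) p * pd c i f p
      + b j * cnj (pd c' j (coord c i) p) * pdbar c i f p)"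
    by (rule sum.swap)
  finally show ?thesis by (simp add: v1 v2 sum.distrib sum_distrib_right)
qed

lemma ctan_eqI:
  assumes "v \<in> ctan p" "w \<in> ctan p" "c \<in> A" "p \<in> fst c"
    and "\<And>i. v (coord c i) = w (coord c i)"
    and "\<And>i. v (\<lambda>x. cnj (coord c i x)) = w (\<lambda>x. cnj (coord c i x))"
  shows "v = w"
proof
  fix f show "v f = w f"
    by (cases "smooth_at A p f")
      (simp_all add: assms(5,6) ctan_repr[OF assms(1,3,4)] ctan_repr[OF assms(2,3,4)]
        ctan_nonsmooth[OF assms(1)] ctan_nonsmooth[OF assms(2)])
qed

lemma ctan_lincomb:
  assumes "v \<in> ctan p" "w \<in> ctan p"
  shows "(\<lambda>f. r * v f + s * w f) \<in> ctan p"
proof -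
  obtain c where c: "c \<in> A" "p \<in> fst c" using chart_ex by blast
  show ?thesis
    by (rule ctanI[OF c, where a = "\<lambda>i. r * v (coord c i) + s * w (coord c i)" and
          b = "\<lambda>i. r * v (\<lambda>x. cnj (coord c i x)) + s * w (\<lambda>x. cnj (coord c i x))"])
      (simp_all add: ctan_nonsmooth[OF assms(1)] ctan_nonsmooth[OF assms(2)] ctan_repr[OF assms(1) c] ctan_repr[OF assms(2) c]
        sum_distrib_left sum.distrib[symmetric] algebra_simps)
qed

lemma ctan_zero: "(\<lambda>f. 0) \<in> ctan p"
proof -
  obtain c where c: "c \<in> A" "p \<in> fst c" using chart_ex by blast
  show ?thesis by (rule ctanI[OF c, where a = "\<lambda>_. 0" and b = "\<lambda>_. 0"]) simp_all
qed

lemma ctan_add: "v \<in> ctan p \<Longrightarrow> w \<in> ctan p \<Longrightarrow> (\<lambda>f. v f + w f) \<in> ctan p"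
  using ctan_lincomb[of v p w 1 1] by simp

lemma ctan_scale: "v \<in> ctan p \<Longrightarrow> (\<lambda>f. r * v f) \<in> ctan p"
  using ctan_lincomb[of v p v r 0] by simp

lemma ctan_sum:
  "(\<And>i. i \<in> I \<Longrightarrow> v i \<in> ctan p) \<Longrightarrow> (\<lambda>f. \<Sum>i\<in>I. v i f) \<in> ctan p"
  by (induction I rule: infinite_finite_induct) (auto intro: ctan_zero ctan_add)

lemma ctan_conj:
  assumes "v \<in> ctan p"
  shows "conj_tv v \<in> ctan p"
proof -
  obtain c where c: "c \<in> A" "p \<in> fst c" using chart_ex by blast
  show ?thesis
    by (rule ctanI[OF c, where b = "\<lambda>i. cnj (v (coord c i))" and a = "\<lambda>i. cnj (v (\<lambda>x. cnj (coord c i x)))"])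
      (simp_all add: conj_tv_def ctan_nonsmooth[OF assms] smooth_at_cnj_iff ctan_repr[OF assms c] pd_cnj[OF c]
        sum.distrib)
qed

lemma ctan_const: "v \<in> ctan p \<Longrightarrow> v (\<lambda>x. k) = 0"
  using chart_ex[of p] ctan_repr[of v p _ "\<lambda>x. k"] by (auto simp: smooth_at_const pd_const)

lemma ctan_cong:
  assumes "v \<in> ctan p" "smooth_at A p f" "open W" "p \<in> W" "\<And>q. q \<in> W \<Longrightarrow> f q = g q"
  shows "v f = v g"
proof -
  obtain c where c: "c \<in> A" "p \<in> fst c" using chart_ex by blast
  show ?thesis
    using ctan_repr[OF assms(1) c] assms(2) smooth_at_cong[OF assms(2-5)] pd_cong[OF c assms(2-5)] by simp
qed

lemma ctan_add_fun:
  assumes "v \<in> ctan p" "smooth_at A p f" "smooth_at A p g"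
  shows "v (\<lambda>x. f x + g x) = v f + v g"
proof -
  obtain c where c: "c \<in> A" "p \<in> fst c" using chart_ex by blast
  show ?thesis
    using ctan_repr[OF assms(1) c] assms smooth_at_add pd_add[OF c]
    by (simp add: sum.distrib[symmetric] algebra_simps)
qed

lemma ctan_mult_fun:
  assumes "v \<in> ctan p" "smooth_at A p f" "smooth_at A p g"
  shows "v (\<lambda>x. f x * g x) = f p * v g + g p * v f"
proof -
  obtain c where c: "c \<in> A" "p \<in> fst c" using chart_ex by blast
  show ?thesis
    using ctan_repr[OF assms(1) c] assms smooth_at_mult pd_mult[OF c]
    by (simp add: sum.distrib[symmetric] sum_distrib_left algebra_simps)
qed

lemma ctan_sum_fun:
  assumes "v \<in> ctan p" "\<And>i. i \<in> I \<Longrightarrow> smooth_at A p (f i)"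
  shows "v (\<lambda>x. \<Sum>i\<in>I. f i x) = (\<Sum>i\<in>I. v (f i))"
  using assms(2)
  by (induction I rule: infinite_finite_induct)
    (auto simp: ctan_const[OF assms(1)] ctan_add_fun[OF assms(1)] smooth_at_sum)

lemma smooth_at_vector_field:
  assumes c: "c \<in> A" "open W" "W \<subseteq> fst c" "p \<in> W" and v: "\<And>q. q \<in> W \<Longrightarrow> v q \<in> ctan q"
    and "\<And>i. smooth_at A p (\<lambda>q. v q (coord c i))"
    and "\<And>i. smooth_at A p (\<lambda>q. v q (\<lambda>x. cnj (coord c i x)))"
    and f: "smooth_at A p f"
  shows "smooth_at A p (\<lambda>q. v q f)"
proof -
  have p: "p \<in> fst c" using c by blast
  obtain W' where W': "open W'" "p \<in> W'" "\<And>q. q \<in> W' \<Longrightarrow> smooth_at A q f"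
    using smooth_at_nbhd[OF f] by blast
  have "smooth_at A p (\<lambda>q. \<Sum>i\<in>UNIV. v q (coord c i) * pd c i f q + v q (\<lambda>x. cnj (coord c i x)) * pdbar c i f q)"
    by (intro smooth_at_sum smooth_at_add smooth_at_mult assms smooth_at_pd p)
  then show ?thesis
    by (rule smooth_at_cong[where W = "W \<inter> W'"])
      (use c W' in \<open>auto intro!: ctan_repr[OF v c(1), symmetric]\<close>)
qed

text \<open>A complexified vector is of type (1,0) iff it annihilates the conjugate coordinates. The condition may be
  tested in any chart.\<close>

lemma hol_tangent_iff:
  assumes c: "c \<in> A" "p \<in> fst c"
  shows "v \<in> hol_tangent A p \<longleftrightarrow> v \<in> ctan p \<and> (\<forall>i. v (\<lambda>x. cnj (coord c i x)) = 0)"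
proof
  assume "v \<in> hol_tangent A p"
  then obtain c' a where c': "c' \<in> A" "p \<in> fst c'" and v: "v = (\<lambda>f. \<Sum>k\<in>UNIV. a k * pdvec A c' k p f)"
    unfolding hol_tangent_def by blast
  have "v \<in> ctan p"
    by (rule ctanI[OF c', where a = a and b = "\<lambda>_. 0"]) (auto simp: v pdvec_def)
  moreover have "v (\<lambda>x. cnj (coord c i x)) = 0" for i
    using c c' pd_cnj[OF c' smooth_at_coord[OF c]] by (simp add: v pdvec_def pdbar_coord cong: if_cong)
  ultimately show "v \<in> ctan p \<and> (\<forall>i. v (\<lambda>x. cnj (coord c i x)) = 0)" by blast
next
  assume R: "v \<in> ctan p \<and> (\<forall>i. v (\<lambda>x. cnj (coord c i x)) = 0)"
  have "v = (\<lambda>f. \<Sum>k\<in>UNIV. v (coord c k) * pdvec A c k p f)"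
  proof
    fix f show "v f = (\<Sum>k\<in>UNIV. v (coord c k) * pdvec A c k p f)"
      by (cases "smooth_at A p f")
        (use R ctan_repr[of v p c f] c ctan_nonsmooth[of v p f] in \<open>simp_all add: pdvec_def\<close>)
  qed
  then show "v \<in> hol_tangent A p" unfolding hol_tangent_def using c
    by (intro CollectI bexI[of _ c] conjI exI[of _ "\<lambda>k. v (coord c k)"])
qed

lemma hol_tangent_ctan: "v \<in> hol_tangent A p \<Longrightarrow> v \<in> ctan p"
  using hol_tangent_iff chart_ex by blast

lemma hol_tangent_repr:
  assumes "v \<in> hol_tangent A p" "c \<in> A" "p \<in> fst c" "smooth_at A p f"
  shows "v f = (\<Sum>i\<in>UNIV. v (coord c i) * pd c i f p)"
  using ctan_repr[of v p c f] assms hol_tangent_iff by simp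

lemma hol_tangent_eqI:
  assumes "v \<in> hol_tangent A p" "w \<in> hol_tangent A p" "c \<in> A" "p \<in> fst c"
    and "\<And>i. v (coord c i) = w (coord c i)"
  shows "v = w"
  by (rule ctan_eqI[of v p w c]) (use assms hol_tangent_iff in auto)

lemma hol_tangent_lincomb:
  "v \<in> hol_tangent A p \<Longrightarrow> w \<in> hol_tangent A p \<Longrightarrow> (\<lambda>f. r * v f + s * w f) \<in> hol_tangent A p"
proof -
  obtain c where c: "c \<in> A" "p \<in> fst c" using chart_ex by blast
  show "v \<in> hol_tangent A p \<Longrightarrow> w \<in> hol_tangent A p \<Longrightarrow> ?thesis"
    unfolding hol_tangent_iff[OF c] by (auto intro: ctan_lincomb)
qed

lemma hol_tangent_zero: "(\<lambda>f. 0) \<in> hol_tangent A p"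
proof -
  obtain c where c: "c \<in> A" "p \<in> fst c" using chart_ex by blast
  show ?thesis unfolding hol_tangent_iff[OF c] by (auto intro: ctan_zero)
qed

lemma hol_tangent_add:
  "v \<in> hol_tangent A p \<Longrightarrow> w \<in> hol_tangent A p \<Longrightarrow> (\<lambda>f. v f + w f) \<in> hol_tangent A p"
  using hol_tangent_lincomb[of v p w 1 1] by simp

lemma hol_tangent_scale: "v \<in> hol_tangent A p \<Longrightarrow> (\<lambda>f. r * v f) \<in> hol_tangent A p"
  using hol_tangent_lincomb[of v p v r 0] by simp

lemma hol_tangent_sum:
  "(\<And>i. i \<in> I \<Longrightarrow> v i \<in> hol_tangent A p) \<Longrightarrow> (\<lambda>f. \<Sum>i\<in>I. v i f) \<in> hol_tangent A p"
  by (induction I rule: infinite_finite_induct) (auto intro: hol_tangent_zero hol_tangent_add)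

lemma pdvec_hol_tangent:
  assumes "c \<in> A" "p \<in> fst c"
  shows "pdvec A c i p \<in> hol_tangent A p"
  unfolding hol_tangent_def using assms
  by (intro CollectI bexI[of _ c] conjI exI[of _ "\<lambda>k. if k = i then 1 else 0"])
    (auto simp: if_distrib[of "\<lambda>x. x * _"] cong: if_cong)

lemma pdvec_coord:
  assumes "c \<in> A" "p \<in> fst c"
  shows "pdvec A c i p (coord c j) = (if i = j then 1 else 0)"
  by (simp add: pdvec_def smooth_at_coord pd_coord assms)

text \<open>The Cauchy-Riemann equations are only required at \<open>p\<close> itself. This suffices for everything that depends
  on first derivatives at \<open>p\<close>.\<close>

definition holo_at :: "'p \<Rightarrow> ('p \<Rightarrow> complex) \<Rightarrow> bool" where
  "holo_at p f \<longleftrightarrow> smooth_at A p f \<and> (\<forall>c\<in>A. p \<in> fst c \<longrightarrow> (\<forall>i. pdbar c i f p = 0))"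

lemma holo_atI:
  assumes "c \<in> A" "p \<in> fst c" "smooth_at A p f" "\<And>i. pdbar c i f p = 0"
  shows "holo_at p f"
proof -
  have "pdbar c' j f p = 0" if "c' \<in> A" "p \<in> fst c'" for c' j
    by (subst pd_chain(2)[OF assms(1,2) that assms(3)]) (simp add: assms(4))
  then show ?thesis using assms(3) by (simp add: holo_at_def)
qed

lemma holo_at_coord: "c \<in> A \<Longrightarrow> p \<in> fst c \<Longrightarrow> holo_at p (coord c i)"
  by (simp add: holo_at_def smooth_at_coord pdbar_coord)

lemma holo_fun_holo_at:
  assumes "holo_fun A W f" "open W" "p \<in> W"
  shows "holo_at p f"
proof -
  have "smooth_fun A W f" using assms(1) by (simp add: holo_fun_def smooth_fun_def holo_on_def case_prod_beta)
  moreover have "pdbar c i f p = 0" if "c \<in> A" "p \<in> fst c" for c i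
    using assms that unfolding holo_fun_def holo_on_def pdbar_def case_prod_beta by blast
  ultimately show ?thesis using assms by (simp add: holo_at_def smooth_fun_iff)
qed

lemma hol_tangent_antiholo:
  assumes "v \<in> hol_tangent A p" "holo_at p f"
  shows "v (\<lambda>x. cnj (f x)) = 0"
proof -
  obtain c where c: "c \<in> A" "p \<in> fst c" using chart_ex by blast
  show ?thesis
    using hol_tangent_repr[OF assms(1) c, of "\<lambda>x. cnj (f x)"] assms(2) c
    by (simp add: holo_at_def smooth_at_cnj pd_cnj)
qed

text \<open>The component of type (1,0), independent of the chart by \<open>part10_chart\<close>.\<close>

definition part10 :: "('p, 'd) chart \<Rightarrow> 'p \<Rightarrow> 'p tvec \<Rightarrow> 'p tvec" where
  "part10 c p v = (\<lambda>f. \<Sum>i\<in>UNIV. v (coord c i) * pdvec A c i p f)"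

lemma part10_hol:
  assumes "c \<in> A" "p \<in> fst c"
  shows "part10 c p v \<in> hol_tangent A p"
  unfolding part10_def by (intro hol_tangent_sum hol_tangent_scale pdvec_hol_tangent assms)

lemma part10_coord:
  assumes "c \<in> A" "p \<in> fst c"
  shows "part10 c p v (coord c i) = v (coord c i)"
  by (simp add: part10_def pdvec_coord assms if_distrib[of "\<lambda>x. _ * x"] cong: if_cong)

lemma part10_holo:
  assumes "v \<in> ctan p" "holo_at p f" "c \<in> A" "p \<in> fst c"
  shows "part10 c p v f = v f"
  using assms ctan_repr[OF assms(1,3,4), of f] by (simp add: part10_def pdvec_def holo_at_def)

lemma part10_chart:
  assumes "v \<in> ctan p" "c \<in> A" "p \<in> fst c" "c' \<in> A" "p \<in> fst c'"
  shows "part10 c p v = part10 c' p v"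
proof (rule hol_tangent_eqI[OF part10_hol part10_hol, of c p c' c])
  show "part10 c p v (coord c i) = part10 c' p v (coord c i)" for i
    using assms by (simp add: part10_coord part10_holo holo_at_coord)
qed (use assms in auto)

lemma part10_of_hol:
  assumes "v \<in> hol_tangent A p" "c \<in> A" "p \<in> fst c"
  shows "part10 c p v = v"
  by (rule hol_tangent_eqI[OF part10_hol, of c p v c]) (use assms part10_coord in auto)

lemma part10_conj:
  assumes "v \<in> hol_tangent A p" "c \<in> A" "p \<in> fst c"
  shows "part10 c p (conj_tv v) = (\<lambda>f. 0)"
  using assms hol_tangent_iff by (simp add: part10_def conj_tv_def)

lemma part10_lincomb:
  "part10 c p (\<lambda>f. r * v f + s * w f) = (\<lambda>f. r * part10 c p v f + s * part10 c p w f)"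
  by (simp add: part10_def sum_distrib_left sum.distrib[symmetric] algebra_simps)

end

section \<open>The total space of a holomorphic vector bundle\<close>

text \<open>The coordinates \<open>(z, u)\<close> of the total space are vectors indexed by a sum type; these are the two
  projections.\<close>

definition base_part :: "complex^('n::finite + 'm::finite) \<Rightarrow> complex^'n" where
  "base_part w = (\<chi> k. w $ Inl k)"

definition fibre_part :: "complex^('n::finite + 'm::finite) \<Rightarrow> complex^'m" where
  "fibre_part w = (\<chi> \<alpha>. w $ Inr \<alpha>)"

lemma parts_eqI:
  assumes "base_part w = base_part w'" "fibre_part w = fibre_part w'"
  shows "w = w'"
proof -
  have "w $ i = w' $ i" for i
    by (cases i) (use assms in \<open>simp_all add: base_part_def fibre_part_def vec_eq_iff\<close>)
  then show ?thesis by (simp add: vec_eq_iff)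
qed

lemma base_part_germ: "germ_smooth z (base_part :: complex^('n::finite + 'm::finite) \<Rightarrow> _)"
  by (rule germ_smooth_vec) (simp add: base_part_def germ_smooth_nth)

lemma base_part_continuous: "continuous_on S (base_part :: complex^('n::finite + 'm::finite) \<Rightarrow> _)"
  unfolding base_part_def by (intro continuous_intros)

lemma fibre_part_continuous: "continuous_on S (fibre_part :: complex^('n::finite + 'm::finite) \<Rightarrow> _)"
  unfolding fibre_part_def by (intro continuous_intros)

lemma wirtinger_base_part:
  fixes z :: "complex^('n::finite + 'm::finite)"
  assumes "germ_smooth (base_part z) f"
  shows "dz (Inl k) (\<lambda>w. f (base_part w)) z = dz k f (base_part z)"
    "dz (Inr \<alpha>) (\<lambda>w. f (base_part w)) z = 0"
    "dzbar (Inl k) (\<lambda>w. f (base_part w)) z = dzbar k f (base_part z)"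
    "dzbar (Inr \<alpha>) (\<lambda>w. f (base_part w)) z = 0"
  unfolding wirtinger_chain[OF germ_smooth_differentiable[OF assms] germ_smooth_differentiable[OF base_part_germ]]
  by (simp_all add: base_part_def wirtinger_nth if_distrib[of "\<lambda>x. _ * x"] if_distrib[of cnj] cong: if_cong)

definition germ_holo :: "complex^'d::finite \<Rightarrow> (complex^'d \<Rightarrow> complex) \<Rightarrow> bool" where
  "germ_holo z f \<longleftrightarrow> germ_smooth z f \<and> (\<forall>j. dzbar j f z = 0)"

lemma germ_holo_add: "germ_holo z f \<Longrightarrow> germ_holo z g \<Longrightarrow> germ_holo z (\<lambda>w. f w + g w)"
  by (simp add: germ_holo_def germ_smooth_add wirtinger_add germ_smooth_differentiable)

lemma germ_holo_mult: "germ_holo z f \<Longrightarrow> germ_holo z g \<Longrightarrow> germ_holo z (\<lambda>w. f w * g w)"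
  by (simp add: germ_holo_def germ_smooth_mult wirtinger_mult germ_smooth_differentiable)

lemma germ_holo_sum:
  "finite I \<Longrightarrow> (\<And>i. i \<in> I \<Longrightarrow> germ_holo z (f i)) \<Longrightarrow> germ_holo z (\<lambda>w. \<Sum>i\<in>I. f i w)"
  by (induction I rule: finite_induct)
    (auto simp: germ_holo_add, simp add: germ_holo_def germ_smooth_const wirtinger_const)

lemma germ_holo_cong:
  assumes "germ_holo z f" "open T" "z \<in> T" "\<forall>w\<in>T. f w = g w"
  shows "germ_holo z g"
  using assms germ_smooth_cong[of z f T g] wirtinger_cong(2)[OF assms(2-4) germ_smooth_differentiable]
  by (simp add: germ_holo_def)

lemma germ_holo_nth: "germ_holo z (\<lambda>w. w $ i)"
  by (simp add: germ_holo_def germ_smooth_nth wirtinger_nth)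

lemma holo_on_germ: "open S \<Longrightarrow> (\<And>z. z \<in> S \<Longrightarrow> germ_holo z f) \<Longrightarrow> holo_on S f"
  using smooth_on_iff_germ[of S f] by (auto simp: holo_on_def germ_holo_def)

locale holo_bundle =
  fixes E :: "('b::topological_space, 'e::topological_space, 'n::finite, 'm::finite) algebroid"
  assumes vb: "holomorphic_vector_bundle E"
begin

lemma base_atlas: "complex_atlas (atlas E)"
  and proj_continuous: "continuous_on UNIV (proj E)"
  and triv_cover: "\<Union> (fst ` trivs E) = UNIV"
  and proj_vadd: "proj E e = proj E e' \<Longrightarrow> proj E (vadd E e e') = proj E e"
  and proj_vscale: "proj E (vscale E r e) = proj E e"
  using vb unfolding holomorphic_vector_bundle_def by simp_all

lemma triv_ex: "\<exists>t\<in>trivs E. x \<in> fst t"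
  using triv_cover by (metis UNIV_I UN_E)

lemma triv_open: "t \<in> trivs E \<Longrightarrow> open (fst t)"
  and triv_homeo: "t \<in> trivs E \<Longrightarrow>
    \<exists>g. homeomorphism (proj E -` fst t) (fst t \<times> UNIV) (\<lambda>e. (proj E e, snd t e)) g"
  and triv_vadd: "t \<in> trivs E \<Longrightarrow> proj E e \<in> fst t \<Longrightarrow> proj E e = proj E e' \<Longrightarrow>
    snd t (vadd E e e') = snd t e + snd t e'"
  and triv_vscale: "t \<in> trivs E \<Longrightarrow> proj E e \<in> fst t \<Longrightarrow> snd t (vscale E r e) = r *s snd t e"
  using vb unfolding holomorphic_vector_bundle_def case_prod_beta by simp_all

lemma triv_transition:
  assumes "t \<in> trivs E" "t' \<in> trivs E"
  obtains M :: "'b \<Rightarrow> complex^'m^'m"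
  where "\<And>\<alpha> \<beta>. holo_fun (atlas E) (fst t \<inter> fst t') (\<lambda>x. M x $ \<alpha> $ \<beta>)"
    "\<And>e. proj E e \<in> fst t \<inter> fst t' \<Longrightarrow> snd t' e = M (proj E e) *v snd t e"
  using vb assms unfolding holomorphic_vector_bundle_def case_prod_beta by meson

sublocale base: complex_manifold "atlas E"
  by unfold_locales (rule base_atlas)

lemma triv_eqI:
  assumes "t \<in> trivs E" "proj E e \<in> fst t" "proj E e = proj E e'" "snd t e = snd t e'"
  shows "e = e'"
proof -
  obtain g where g: "homeomorphism (proj E -` fst t) (fst t \<times> UNIV) (\<lambda>e. (proj E e, snd t e)) g"
    using triv_homeo[OF assms(1)] by blast
  have "g (proj E e, snd t e) = e" using homeomorphism_apply1[OF g, of e] assms(2) by simp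
  moreover have "g (proj E e', snd t e') = e'"
    using homeomorphism_apply1[OF g, of e'] assms(2) unfolding assms(3) by simp
  ultimately show ?thesis unfolding assms(3,4) by (rule trans[OF sym])
qed

text \<open>The vector over \<open>x\<close> with given fibre coordinates.\<close>

definition lift :: "'b set \<times> ('e \<Rightarrow> complex^'m) \<Rightarrow> 'b \<Rightarrow> complex^'m \<Rightarrow> 'e" where
  "lift t x a = (THE e. proj E e = x \<and> snd t e = a)"

lemma lift_unique:
  assumes "t \<in> trivs E" "proj E e \<in> fst t"
  shows "lift t (proj E e) (snd t e) = e"
  unfolding lift_def by (rule the_equality) (use triv_eqI[OF assms(1)] assms(2) in auto)

lemma lift_props:
  assumes "t \<in> trivs E" "x \<in> fst t"
  shows "proj E (lift t x a) = x" "snd t (lift t x a) = a"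
proof -
  obtain g where g: "homeomorphism (proj E -` fst t) (fst t \<times> UNIV) (\<lambda>e. (proj E e, snd t e)) g"
    using triv_homeo[OF assms(1)] by blast
  have e: "(proj E (g (x, a)), snd t (g (x, a))) = (x, a)"
    using homeomorphism_apply2[OF g, of "(x, a)"] assms(2) by simp
  then have "lift t x a = g (x, a)"
    using lift_unique[OF assms(1), of "g (x, a)"] assms(2) by simp
  then show "proj E (lift t x a) = x" "snd t (lift t x a) = a" using e by auto
qed

lemma frame_lift: "frame E c \<alpha> x = lift (snd c) x (axis \<alpha> 1)"
  by (simp add: frame_def lift_def)

lemma bcharts_iff: "c \<in> bcharts E \<longleftrightarrow> fst c \<in> atlas E \<and> snd c \<in> trivs E"
  by (cases c) (simp add: bcharts_def)

lemma bdom_iff: "e \<in> bdom E c \<longleftrightarrow> proj E e \<in> fst (fst c) \<and> proj E e \<in> fst (snd c)"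
  by (simp add: bdom_def base_dom_def)

lemma fst_echart: "fst (echart E c) = bdom E c"
  by (simp add: echart_def)

lemma echart_parts:
  "base_part (snd (echart E c) e) = snd (fst c) (proj E e)"
  "fibre_part (snd (echart E c) e) = snd (snd c) e"
  by (simp_all add: echart_def base_part_def fibre_part_def vec_eq_iff)

lemma coord_echart:
  "coord (echart E c) (Inl k) e = coord (fst c) k (proj E e)"
  "coord (echart E c) (Inr \<alpha>) e = snd (snd c) e $ \<alpha>"
  by (simp_all add: coord_def echart_def)


lemma base_dom_open: "c \<in> bcharts E \<Longrightarrow> open (base_dom c)"
  by (auto simp: bcharts_iff base_dom_def intro!: open_Int base.chart_open triv_open)

lemma bdom_open: "c \<in> bcharts E \<Longrightarrow> open (bdom E c)"
  unfolding bdom_def using base_dom_open proj_continuous by (intro open_vimage)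

lemma bdom_bchart_ex: "\<exists>c\<in>bcharts E. e \<in> bdom E c"
proof -
  obtain b t where "b \<in> atlas E" "proj E e \<in> fst b" "t \<in> trivs E" "proj E e \<in> fst t"
    using base.chart_ex triv_ex by meson
  then show ?thesis by (intro bexI[of _ "(b, t)"]) (simp_all add: bcharts_iff bdom_iff)
qed

lemma echart_inj:
  assumes c: "c \<in> bcharts E"
  shows "inj_on (snd (echart E c)) (bdom E c)"
proof (rule inj_onI)
  fix e e' assume e: "e \<in> bdom E c" "e' \<in> bdom E c" and eq: "snd (echart E c) e = snd (echart E c) e'"
  have "snd (fst c) (proj E e) = snd (fst c) (proj E e')" "snd (snd c) e = snd (snd c) e'"
    using echart_parts eq by metis+
  moreover from this(1) have "proj E e = proj E e'"
    using base.chart_inv[of "fst c"] e c by (metis bcharts_iff bdom_iff)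
  ultimately show "e = e'" using triv_eqI[of "snd c" e e'] e c by (auto simp: bcharts_iff bdom_iff)
qed

lemma echart_inv: "c \<in> bcharts E \<Longrightarrow> e \<in> bdom E c \<Longrightarrow> chart_inv (echart E c) (snd (echart E c) e) = e"
  by (simp add: fst_echart echart_inj)

text \<open>Over a set \<open>S\<close> in the base, the coordinate image is \<open>z(S) \<times> \<complex>\<^sup>m\<close>, because the fibre coordinates are
  arbitrary.\<close>

lemma echart_image:
  assumes c: "c \<in> bcharts E" and S: "S \<subseteq> base_dom c"
  shows "snd (echart E c) ` (proj E -` S) = base_part -` (snd (fst c) ` S)"
proof (intro equalityI subsetI)
  fix w :: "complex^('n + 'm)" assume "w \<in> base_part -` (snd (fst c) ` S)"
  then obtain x where x: "x \<in> S" "base_part w = snd (fst c) x" by auto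
  define e where "e = lift (snd c) x (fibre_part w)"
  have "proj E e = x" "snd (snd c) e = fibre_part w"
    using lift_props[of "snd c" x] x S c by (auto simp: e_def bcharts_iff base_dom_def)
  then have "snd (echart E c) e = w" "e \<in> proj E -` S"
    using x by (auto intro!: parts_eqI simp: echart_parts)
  then show "w \<in> snd (echart E c) ` (proj E -` S)" by blast
qed (auto simp: echart_parts)

lemma echart_image_open:
  assumes c: "c \<in> bcharts E" and S: "S \<subseteq> base_dom c" "open S"
  shows "open (snd (echart E c) ` (proj E -` S))"
proof -
  have "fst (fst c) \<inter> S = S" using S by (auto simp: base_dom_def)
  then have "open (snd (fst c) ` S)"
    using base.chart_image_open[of "fst c" S] c S by (simp add: bcharts_iff)
  then show ?thesis
    unfolding echart_image[OF c S(1)] using base_part_continuous by (intro open_vimage)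
qed

text \<open>The inverse is \<open>(z, u) \<mapsto> g (z\<inverse>, u)\<close>, where \<open>g\<close> is the inverse of the trivialization.\<close>

lemma echart_homeo:
  assumes c: "c \<in> bcharts E"
  shows "homeomorphism (bdom E c) (snd (echart E c) ` bdom E c) (snd (echart E c)) (chart_inv (echart E c))"
proof -
  have t: "snd c \<in> trivs E" and b: "fst c \<in> atlas E" using c by (simp_all add: bcharts_iff)
  obtain g where g: "homeomorphism (proj E -` fst (snd c)) (fst (snd c) \<times> UNIV)
      (\<lambda>e. (proj E e, snd (snd c) e)) g"
    using triv_homeo[OF t] by blast
  let ?\<psi> = "snd (echart E c)" and ?G = "\<lambda>w. g (chart_inv (fst c) (base_part w), fibre_part w)"
  have G: "?G (?\<psi> e) = e" if "e \<in> bdom E c" for e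
    using that base.chart_inv[OF b] homeomorphism_apply1[OF g, of e] by (auto simp: echart_parts bdom_iff)
  have pc: "continuous_on (bdom E c) (proj E)"
    using proj_continuous continuous_on_subset by blast
  have cpair: "continuous_on (bdom E c) (\<lambda>e. (proj E e, snd (snd c) e))"
    using homeomorphism_cont1[OF g] by (rule continuous_on_subset) (auto simp: bdom_iff)
  have cfib: "continuous_on (bdom E c) (\<lambda>e. snd (snd c) e)"
    using continuous_on_snd[OF cpair] by simp
  have cbase: "continuous_on (bdom E c) (\<lambda>e. snd (fst c) (proj E e))"
    by (rule continuous_on_compose2[OF base.chart_cont[OF b] pc]) (auto simp: bdom_iff)
  have "continuous_on (bdom E c) (\<lambda>e. ?\<psi> e $ i)" for i
  proof (cases i)
    case (Inl k)
    then show ?thesis using continuous_on_component[OF cbase, of k] by (simp add: echart_def)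
  next
    case (Inr \<alpha>)
    then show ?thesis using continuous_on_component[OF cfib, of \<alpha>] by (simp add: echart_def)
  qed
  then have c1: "continuous_on (bdom E c) ?\<psi>"
    using continuous_on_vec_lambda[of "bdom E c" "\<lambda>i e. ?\<psi> e $ i"] by (simp add: vec_nth_inverse)
  have ci: "continuous_on (snd (fst c) ` fst (fst c)) (chart_inv (fst c))"
    using base.chart_homeo[OF b] homeomorphism_cont2 by blast
  have "continuous_on (?\<psi> ` bdom E c) (\<lambda>w. chart_inv (fst c) (base_part w))"
    by (rule continuous_on_compose2[OF ci base_part_continuous]) (auto simp: echart_parts bdom_iff)
  then have cG: "continuous_on (?\<psi> ` bdom E c) ?G"
    by (intro continuous_on_compose2[OF homeomorphism_cont2[OF g]] continuous_on_Pair fibre_part_continuous)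
      (auto simp: echart_parts bdom_iff base.chart_inv[OF b])
  have c2: "continuous_on (?\<psi> ` bdom E c) (chart_inv (echart E c))"
    by (rule continuous_on_eq[OF cG]) (use G echart_inv[OF c] in auto)
  show ?thesis
    using c1 c2 echart_inv[OF c] by (auto simp: homeomorphism_def image_image)
qed

lemma proj_echart_inv:
  assumes "c \<in> bcharts E" "w \<in> snd (echart E c) ` bdom E c"
  shows "proj E (chart_inv (echart E c) w) = chart_inv (fst c) (base_part w)"
    "chart_inv (echart E c) w \<in> bdom E c" "snd (echart E c) (chart_inv (echart E c) w) = w"
  using assms echart_inv[OF assms(1)] base.chart_inv[of "fst c"]
  by (auto simp: echart_parts bdom_iff bcharts_iff)


lemma pullback_chart:
  assumes c: "c \<in> bcharts E" "e \<in> bdom E c"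
  shows "open (snd (echart E c) ` bdom E c)" "snd (echart E c) e \<in> snd (echart E c) ` bdom E c"
    "\<forall>w\<in>snd (echart E c) ` bdom E c. (f \<circ> chart_inv (fst c)) (base_part w) = ((f \<circ> proj E) \<circ> chart_inv (echart E c)) w"
  using c echart_image_open[OF c(1) subset_refl base_dom_open[OF c(1)]]
  by (auto simp: bdom_def[symmetric] proj_echart_inv o_def)

text \<open>In the coordinates of the total space, a function pulled back from the base depends on \<open>z\<close> only.\<close>

lemma pullback:
  assumes c: "c \<in> bcharts E" "e \<in> bdom E c" and f: "smooth_at (atlas E) (proj E e) f"
  shows "germ_smooth (snd (echart E c) e) ((f \<circ> proj E) \<circ> chart_inv (echart E c))"
    "pd (echart E c) (Inl k) (f \<circ> proj E) e = pd (fst c) k f (proj E e)"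
    "pd (echart E c) (Inr \<alpha>) (f \<circ> proj E) e = 0"
    "pdbar (echart E c) (Inl k) (f \<circ> proj E) e = pdbar (fst c) k f (proj E e)"
    "pdbar (echart E c) (Inr \<alpha>) (f \<circ> proj E) e = 0"
proof -
  have b: "fst c \<in> atlas E" "proj E e \<in> fst (fst c)" using c by (auto simp: bcharts_iff bdom_iff)
  have g: "germ_smooth (base_part (snd (echart E c) e)) (f \<circ> chart_inv (fst c))"
    using f base.smooth_at_iff[OF b] by (simp add: echart_parts)
  have g': "germ_smooth (snd (echart E c) e) (\<lambda>w. (f \<circ> chart_inv (fst c)) (base_part w))"
    by (rule germ_smooth_compose[OF base_part_germ g])
  show "germ_smooth (snd (echart E c) e) ((f \<circ> proj E) \<circ> chart_inv (echart E c))"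
    by (rule germ_smooth_cong[OF g' pullback_chart(1,2)[OF c]]) (use pullback_chart(3)[OF c] in blast)
  note w = wirtinger_cong[OF pullback_chart[OF c] germ_smooth_differentiable[OF g']]
  show "pd (echart E c) (Inl k) (f \<circ> proj E) e = pd (fst c) k f (proj E e)"
    "pd (echart E c) (Inr \<alpha>) (f \<circ> proj E) e = 0"
    "pdbar (echart E c) (Inl k) (f \<circ> proj E) e = pdbar (fst c) k f (proj E e)"
    "pdbar (echart E c) (Inr \<alpha>) (f \<circ> proj E) e = 0"
    unfolding pd_def[of "echart E c"] pdbar_def[of "echart E c"] w[symmetric] wirtinger_base_part[OF g]
    by (simp_all add: echart_parts pd_def pdbar_def)
qed

lemma pullback_germ_holo:
  assumes c: "c \<in> bcharts E" "e \<in> bdom E c" and f: "base.holo_at (proj E e) f"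
  shows "germ_holo (snd (echart E c) e) (\<lambda>w. f (proj E (chart_inv (echart E c) w)))"
proof -
  have s: "smooth_at (atlas E) (proj E e) f" using f by (simp add: base.holo_at_def)
  have "dzbar j ((f \<circ> proj E) \<circ> chart_inv (echart E c)) (snd (echart E c) e) = 0" for j
    using pullback(4,5)[OF c s] f c
    by (cases j) (auto simp: pdbar_def[of "echart E c"] base.holo_at_def bcharts_iff bdom_iff)
  then show ?thesis using pullback(1)[OF c s] by (simp add: germ_holo_def o_def)
qed

text \<open>The new base coordinates are pulled back from the base, and the new fibre coordinates are linear in the
  old ones with holomorphic coefficients pulled back from the base.\<close>

lemma echart_transition:
  assumes c: "c \<in> bcharts E" and c': "c' \<in> bcharts E"
  shows "holo_on (snd (echart E c) ` (bdom E c \<inter> bdom E c')) (\<lambda>w. snd (echart E c') (chart_inv (echart E c) w) $ i)"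
proof (rule holo_on_germ)
  have "bdom E c \<inter> bdom E c' = proj E -` (base_dom c \<inter> base_dom c')" by (auto simp: bdom_def)
  moreover have "open (base_dom c \<inter> base_dom c')" using base_dom_open c c' by blast
  ultimately show op: "open (snd (echart E c) ` (bdom E c \<inter> bdom E c'))"
    using echart_image_open[OF c, of "base_dom c \<inter> base_dom c'"] by simp
  fix z assume z: "z \<in> snd (echart E c) ` (bdom E c \<inter> bdom E c')"
  then obtain e where e: "e \<in> bdom E c" "e \<in> bdom E c'" "z = snd (echart E c) e" by auto
  show "germ_holo z (\<lambda>w. snd (echart E c') (chart_inv (echart E c) w) $ i)"
  proof (cases i)
    case (Inl k)
    have "base.holo_at (proj E e) (coord (fst c') k)"
      using c' e by (intro base.holo_at_coord) (auto simp: bcharts_iff bdom_iff)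
    from pullback_germ_holo[OF c e(1) this] show ?thesis
      by (simp add: Inl echart_def coord_def e(3))
  next
    case (Inr \<alpha>)
    obtain M :: "'b \<Rightarrow> complex^'m^'m"
      where M: "\<And>\<alpha> \<beta>. holo_fun (atlas E) (fst (snd c) \<inter> fst (snd c')) (\<lambda>x. M x $ \<alpha> $ \<beta>)"
        "\<And>e. proj E e \<in> fst (snd c) \<inter> fst (snd c') \<Longrightarrow> snd (snd c') e = M (proj E e) *v snd (snd c) e"
      using triv_transition[of "snd c" "snd c'"] c c' by (auto simp: bcharts_iff)
    have "base.holo_at (proj E e) (\<lambda>x. M x $ \<alpha> $ \<beta>)" for \<beta>
      using base.holo_fun_holo_at[OF M(1)] e c c' triv_open by (auto simp: bcharts_iff bdom_iff open_Int)
    then have "germ_holo z (\<lambda>w. \<Sum>\<beta>\<in>UNIV. M (proj E (chart_inv (echart E c) w)) $ \<alpha> $ \<beta> * w $ Inr \<beta>)"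
      unfolding e(3) by (intro germ_holo_sum germ_holo_mult pullback_germ_holo[OF c e(1)] germ_holo_nth) simp_all
    then show ?thesis
    proof (rule germ_holo_cong[OF _ op z], intro ballI)
      fix w assume "w \<in> snd (echart E c) ` (bdom E c \<inter> bdom E c')"
      then obtain e where e: "e \<in> bdom E c" "e \<in> bdom E c'" "w = snd (echart E c) e" by auto
      show "(\<Sum>\<beta>\<in>UNIV. M (proj E (chart_inv (echart E c) w)) $ \<alpha> $ \<beta> * w $ Inr \<beta>) =
          snd (echart E c') (chart_inv (echart E c) w) $ i"
        using e M(2)[of e] echart_inv[OF c e(1)]
        by (simp add: Inr echart_def bdom_iff matrix_vector_mult_def)
    qed
  qed
qed

lemma total_atlas: "complex_atlas (eatlas E)"
proof -
  have "open (snd (echart E c) ` bdom E c)" if "c \<in> bcharts E" for c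
    using echart_image_open[OF that subset_refl base_dom_open[OF that]] by (simp add: bdom_def)
  then show ?thesis
    unfolding complex_atlas_def case_prod_beta eatlas_def
    using bdom_bchart_ex bdom_open echart_homeo echart_transition by (auto simp: fst_echart)
qed

sublocale tot: complex_manifold "eatlas E"
  by unfold_locales (rule total_atlas)

end

lemma sum_UNIV_plus:
  fixes f :: "'a::finite + 'b::finite \<Rightarrow> 'c::comm_monoid_add"
  shows "(\<Sum>i\<in>UNIV. f i) = (\<Sum>k\<in>UNIV. f (Inl k)) + (\<Sum>\<alpha>\<in>UNIV. f (Inr \<alpha>))"
  by (subst UNIV_Plus_UNIV[symmetric], subst sum.Plus) simp_all

context holo_bundle
begin

lemma echart_mem: "c \<in> bcharts E \<Longrightarrow> echart E c \<in> eatlas E"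
  by (simp add: eatlas_def)

lemma at_echart:
  assumes "c \<in> bcharts E" "e \<in> bdom E c"
  shows "echart E c \<in> eatlas E" "e \<in> fst (echart E c)"
  using assms by (simp_all add: echart_mem fst_echart)

lemma tot_smooth_pullback:
  assumes "smooth_at (atlas E) (proj E e) f"
  shows "smooth_at (eatlas E) e (\<lambda>x. f (proj E x))"
proof -
  obtain c where c: "c \<in> bcharts E" "e \<in> bdom E c" using bdom_bchart_ex by blast
  show ?thesis
    using pullback(1)[OF c assms] tot.smooth_at_iff[OF at_echart[OF c]] by (simp add: o_def)
qed

lemma tot_holo_pullback:
  assumes "base.holo_at (proj E e) f"
  shows "tot.holo_at e (\<lambda>x. f (proj E x))"
proof -
  obtain c where c: "c \<in> bcharts E" "e \<in> bdom E c" using bdom_bchart_ex by blast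
  have b: "fst c \<in> atlas E" "proj E e \<in> fst (fst c)" using c by (auto simp: bcharts_iff bdom_iff)
  have s: "smooth_at (atlas E) (proj E e) f" using assms by (simp add: base.holo_at_def)
  have "pdbar (echart E c) i (f \<circ> proj E) e = 0" for i
    using pullback(4,5)[OF c s] assms b by (cases i) (simp_all add: base.holo_at_def)
  then show ?thesis
    using tot.holo_atI[OF at_echart[OF c] tot_smooth_pullback[OF s]] by (simp add: o_def)
qed

lemma evec_hol: "c \<in> bcharts E \<Longrightarrow> u \<in> bdom E c \<Longrightarrow> evec E c i u \<in> hol_tangent (eatlas E) u"
  unfolding evec_def by (rule tot.pdvec_hol_tangent[OF at_echart])

lemma evec_apply: "smooth_at (eatlas E) u f \<Longrightarrow> evec E c i u f = pd (echart E c) i f u"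
  by (simp add: evec_def pdvec_def)

lemma evec_coord: "c \<in> bcharts E \<Longrightarrow> u \<in> bdom E c \<Longrightarrow>
    evec E c i u (coord (echart E c) j) = (if i = j then 1 else 0)"
  unfolding evec_def by (rule tot.pdvec_coord[OF at_echart])

text \<open>The transition functions \<open>M\<^sup>\<alpha>\<^sub>\<beta>\<close> of the fibre coordinates.\<close>

definition tmat :: "('b, 'e, 'n, 'm) bchart \<Rightarrow> ('b, 'e, 'n, 'm) bchart \<Rightarrow> 'b \<Rightarrow> complex^'m^'m" where
  "tmat c c' = (SOME M. (\<forall>\<alpha> \<beta>. holo_fun (atlas E) (fst (snd c) \<inter> fst (snd c')) (\<lambda>x. M x $ \<alpha> $ \<beta>)) \<and>
     (\<forall>e. proj E e \<in> fst (snd c) \<inter> fst (snd c') \<longrightarrow> snd (snd c') e = M (proj E e) *v snd (snd c) e))"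

lemma tmat_props:
  assumes "c \<in> bcharts E" "c' \<in> bcharts E"
  shows "\<forall>\<alpha> \<beta>. holo_fun (atlas E) (fst (snd c) \<inter> fst (snd c')) (\<lambda>x. tmat c c' x $ \<alpha> $ \<beta>)"
    "\<forall>e. proj E e \<in> fst (snd c) \<inter> fst (snd c') \<longrightarrow> snd (snd c') e = tmat c c' (proj E e) *v snd (snd c) e"
proof -
  obtain M :: "'b \<Rightarrow> complex^'m^'m"
    where "\<And>\<alpha> \<beta>. holo_fun (atlas E) (fst (snd c) \<inter> fst (snd c')) (\<lambda>x. M x $ \<alpha> $ \<beta>)"
      "\<And>e. proj E e \<in> fst (snd c) \<inter> fst (snd c') \<Longrightarrow> snd (snd c') e = M (proj E e) *v snd (snd c) e"
    using triv_transition[of "snd c" "snd c'"] assms by (auto simp: bcharts_iff)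
  then have "\<exists>M. (\<forall>\<alpha> \<beta>. holo_fun (atlas E) (fst (snd c) \<inter> fst (snd c')) (\<lambda>x. M x $ \<alpha> $ \<beta>)) \<and>
     (\<forall>e. proj E e \<in> fst (snd c) \<inter> fst (snd c') \<longrightarrow> snd (snd c') e = M (proj E e) *v snd (snd c) e)"
    by blast
  from someI_ex[OF this]
  show "\<forall>\<alpha> \<beta>. holo_fun (atlas E) (fst (snd c) \<inter> fst (snd c')) (\<lambda>x. tmat c c' x $ \<alpha> $ \<beta>)"
    "\<forall>e. proj E e \<in> fst (snd c) \<inter> fst (snd c') \<longrightarrow> snd (snd c') e = tmat c c' (proj E e) *v snd (snd c) e"
    unfolding tmat_def by auto
qed

lemma tmat_holo:
  assumes "c \<in> bcharts E" "c' \<in> bcharts E" "u \<in> bdom E c" "u \<in> bdom E c'"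
  shows "tot.holo_at u (\<lambda>x. tmat c c' (proj E x) $ \<alpha> $ \<beta>)"
  using assms triv_open
  by (intro tot_holo_pullback base.holo_fun_holo_at[OF tmat_props(1)[OF assms(1,2), rule_format]])
    (auto simp: bcharts_iff bdom_iff open_Int)

lemma tmat_smooth:
  assumes "c \<in> bcharts E" "c' \<in> bcharts E" "u \<in> bdom E c" "u \<in> bdom E c'"
  shows "smooth_at (eatlas E) u (\<lambda>x. tmat c c' (proj E x) $ \<alpha> $ \<beta>)"
  using tmat_holo[OF assms] by (simp add: tot.holo_at_def)

lemma tmat_apply:
  assumes "c \<in> bcharts E" "c' \<in> bcharts E" "u \<in> bdom E c" "u \<in> bdom E c'" "proj E e = proj E u"
  shows "snd (snd c') e = tmat c c' (proj E u) *v snd (snd c) e"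
  using tmat_props(2)[OF assms(1,2)] assms by (simp add: bdom_iff)

lemma matrix_eqI: "(\<And>a. A *v a = B *v a) \<Longrightarrow> A = (B :: complex^'i::finite^'j::finite)"
  using matrix_eq by blast

lemma tmat_inverse:
  assumes "c \<in> bcharts E" "c' \<in> bcharts E" "u \<in> bdom E c" "u \<in> bdom E c'"
  shows "tmat c' c (proj E u) ** tmat c c' (proj E u) = mat 1"
proof (rule matrix_eqI)
  fix a
  have t: "snd c \<in> trivs E" "proj E u \<in> fst (snd c)" using assms by (auto simp: bcharts_iff bdom_iff)
  note l = lift_props[OF t, of a]
  show "(tmat c' c (proj E u) ** tmat c c' (proj E u)) *v a = mat 1 *v a"
    using tmat_apply[OF assms l(1)] tmat_apply[OF assms(2,1,4,3) l(1)] l(2)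
    by (simp add: matrix_vector_mul_assoc[symmetric])
qed

lemma fibre_coord_transition:
  assumes "c \<in> bcharts E" "c' \<in> bcharts E" "x \<in> bdom E c" "x \<in> bdom E c'"
  shows "coord (echart E c') (Inr \<gamma>) x = (\<Sum>\<alpha>\<in>UNIV. tmat c c' (proj E x) $ \<gamma> $ \<alpha> * coord (echart E c) (Inr \<alpha>) x)"
  using tmat_apply[OF assms refl] by (simp add: coord_echart matrix_vector_mult_def)

text \<open>Fibre derivatives annihilate functions pulled back from the base, in particular the new base coordinates and
  the entries of \<open>M\<close>. So there is no contribution from the derivatives of the transition functions.\<close>

lemma evec_transition:
  assumes c: "c \<in> bcharts E" and c': "c' \<in> bcharts E" and u: "u \<in> bdom E c" "u \<in> bdom E c'"
  shows "evec E c (Inr \<alpha>) u = (\<lambda>f. \<Sum>\<gamma>\<in>UNIV. tmat c c' (proj E u) $ \<gamma> $ \<alpha> * evec E c' (Inr \<gamma>) u f)"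
proof (rule tot.hol_tangent_eqI[OF _ _ at_echart[OF c' u(2)]])
  show "evec E c (Inr \<alpha>) u \<in> hol_tangent (eatlas E) u" by (rule evec_hol[OF c u(1)])
  show "(\<lambda>f. \<Sum>\<gamma>\<in>UNIV. tmat c c' (proj E u) $ \<gamma> $ \<alpha> * evec E c' (Inr \<gamma>) u f) \<in> hol_tangent (eatlas E) u"
    by (intro tot.hol_tangent_sum tot.hol_tangent_scale evec_hol[OF c' u(2)])
  note ctan = tot.hol_tangent_ctan[OF evec_hol[OF c u(1)], of "Inr \<alpha>"]
  have b': "fst c' \<in> atlas E" "proj E u \<in> fst (fst c')" using c' u by (auto simp: bcharts_iff bdom_iff)
  have kill: "evec E c (Inr \<alpha>) u (\<lambda>x. f (proj E x)) = 0" if "smooth_at (atlas E) (proj E u) f" for f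
    using pullback(3)[OF c u(1) that] tot_smooth_pullback[OF that] by (simp add: evec_apply o_def)
  have killM: "evec E c (Inr \<alpha>) u (\<lambda>x. tmat c c' (proj E x) $ \<gamma> $ \<beta>) = 0" for \<gamma> \<beta>
  proof (rule kill)
    show "smooth_at (atlas E) (proj E u) (\<lambda>x. tmat c c' x $ \<gamma> $ \<beta>)"
      using base.holo_fun_holo_at[OF tmat_props(1)[OF c c', rule_format, of \<gamma> \<beta>], of "proj E u"] c c' u triv_open
      by (auto simp: bcharts_iff bdom_iff open_Int base.holo_at_def)
  qed
  show "evec E c (Inr \<alpha>) u (coord (echart E c') i) =
      (\<Sum>\<gamma>\<in>UNIV. tmat c c' (proj E u) $ \<gamma> $ \<alpha> * evec E c' (Inr \<gamma>) u (coord (echart E c') i))" for i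
  proof (cases i)
    case (Inl k)
    have "coord (echart E c') (Inl k) = (\<lambda>x. coord (fst c') k (proj E x))" by (rule ext) (rule coord_echart)
    then have "evec E c (Inr \<alpha>) u (coord (echart E c') (Inl k)) = 0"
      using kill[OF base.smooth_at_coord[OF b', of k]] by simp
    then show ?thesis by (simp add: Inl evec_coord[OF c' u(2)])
  next
    case (Inr \<delta>)
    let ?s = "\<lambda>x. \<Sum>\<beta>\<in>UNIV. tmat c c' (proj E x) $ \<delta> $ \<beta> * coord (echart E c) (Inr \<beta>) x"
    note sm = tmat_smooth[OF c c' u] tot.smooth_at_coord[OF at_echart[OF c u(1)]]
    have "evec E c (Inr \<alpha>) u (coord (echart E c') (Inr \<delta>)) = evec E c (Inr \<alpha>) u ?s"
      by (rule tot.ctan_cong[OF ctan tot.smooth_at_coord[OF at_echart[OF c' u(2)]], of "bdom E c \<inter> bdom E c'"])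
        (use c c' u fibre_coord_transition[OF c c'] in \<open>auto simp: bdom_open\<close>)
    also have "\<dots> = (\<Sum>\<beta>\<in>UNIV. tmat c c' (proj E u) $ \<delta> $ \<beta> * (if \<alpha> = \<beta> then 1 else 0))"
      by (subst tot.ctan_sum_fun[OF ctan])
        (auto intro!: tot.smooth_at_mult sm sum.cong simp: tot.ctan_mult_fun[OF ctan] sm evec_coord[OF c u(1)] killM)
    finally show ?thesis by (simp add: Inr evec_coord[OF c' u(2)] if_distrib[of "\<lambda>x. _ * x"] cong: if_cong)
  qed
qed

lemma pd_fibre_coord:
  assumes c: "c \<in> bcharts E" and c': "c' \<in> bcharts E" and u: "u \<in> bdom E c" "u \<in> bdom E c'"
  shows "pd (echart E c) (Inr \<sigma>) (coord (echart E c') (Inl k)) u = 0"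
    "pd (echart E c) (Inr \<sigma>) (coord (echart E c') (Inr \<delta>)) u = tmat c c' (proj E u) $ \<delta> $ \<sigma>"
  using fun_cong[OF evec_transition[OF c c' u, of \<sigma>], of "coord (echart E c') (Inl k)"]
    fun_cong[OF evec_transition[OF c c' u, of \<sigma>], of "coord (echart E c') (Inr \<delta>)"]
  by (simp_all add: evec_apply[OF tot.smooth_at_coord[OF at_echart[OF c' u(2)]]] tot.pd_coord[OF at_echart[OF c' u(2)]]
      if_distrib[of "\<lambda>x. _ * x"] cong: if_cong)

lemma slit_iff:
  assumes "c \<in> bcharts E" "u \<in> bdom E c"
  shows "u \<in> slit E \<longleftrightarrow> snd (snd c) u \<noteq> 0"
proof -
  have t: "snd c \<in> trivs E" "proj E u \<in> fst (snd c)" using assms by (auto simp: bcharts_iff bdom_iff)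
  have "snd (snd c) (vscale E 0 u) = 0" using triv_vscale[OF t] by simp
  then show ?thesis
    using triv_eqI[OF t(1), of "vscale E 0 u" u] t proj_vscale[of 0 u] unfolding slit_def by auto
qed

lemma slit_open: "open (slit E)"
proof (subst open_subopen, rule ballI)
  fix u assume u: "u \<in> slit E"
  obtain c where c: "c \<in> bcharts E" "u \<in> bdom E c" using bdom_bchart_ex by blast
  have "open (- {w :: complex^('n + 'm). fibre_part w = 0})"
    using closed_Collect_eq[OF fibre_part_continuous continuous_on_const[of UNIV 0]] by (intro open_Compl)
  then have "open (fst (echart E c) \<inter> snd (echart E c) -` (- {w. fibre_part w = 0}))"
    by (rule tot.chart_vimage_open[OF echart_mem[OF c(1)]])
  moreover have "fst (echart E c) \<inter> snd (echart E c) -` (- {w. fibre_part w = 0}) = bdom E c \<inter> slit E"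
    using slit_iff[OF c(1)] by (auto simp: fst_echart echart_parts)
  ultimately show "\<exists>T. open T \<and> u \<in> T \<and> T \<subseteq> slit E" using c u by (intro exI[of _ "bdom E c \<inter> slit E"]) auto
qed

end


section \<open>The fundamental tensor of a complex Finsler structure\<close>

locale finsler_bundle = holo_bundle E
  for E :: "('b::topological_space, 'e::topological_space, 'n::finite, 'm::finite) algebroid" +
  fixes F :: "'e \<Rightarrow> real"
  assumes finsler: "complex_finsler E F" and convex: "convex_finsler E F"
begin

abbreviation cF :: "'e \<Rightarrow> complex" where "cF \<equiv> \<lambda>e. complex_of_real (F e)"

text \<open>The functions \<open>\<partial>F / \<partial>(cnj u\<^sup>\<sigma>)\<close>: both the fundamental tensor and the nonlinear connection are made from
  their derivatives of type (1,0).\<close>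

definition dF :: "('b, 'e, 'n, 'm) bchart \<Rightarrow> 'm \<Rightarrow> 'e \<Rightarrow> complex" where
  "dF c \<sigma> = pdbar (echart E c) (Inr \<sigma>) cF"

lemma smooth_F: "u \<in> slit E \<Longrightarrow> smooth_at (eatlas E) u cF"
  using finsler tot.smooth_fun_iff[OF slit_open] by (simp add: complex_finsler_def)

lemma smooth_dF: "c \<in> bcharts E \<Longrightarrow> u \<in> bdom E c \<Longrightarrow> u \<in> slit E \<Longrightarrow> smooth_at (eatlas E) u (dF c \<sigma>)"
  unfolding dF_def by (rule tot.smooth_at_pd(2)[OF at_echart smooth_F])

lemma hmet_dF: "hmet E F c \<alpha> \<sigma> = pd (echart E c) (Inr \<alpha>) (dF c \<sigma>)"
  by (simp add: hmet_def dF_def)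

lemma smooth_hmet:
  "c \<in> bcharts E \<Longrightarrow> u \<in> bdom E c \<Longrightarrow> u \<in> slit E \<Longrightarrow> smooth_at (eatlas E) u (hmet E F c \<alpha> \<sigma>)"
  unfolding hmet_dF by (rule tot.smooth_at_pd(1)[OF at_echart smooth_dF])

lemma hmet_evec:
  "c \<in> bcharts E \<Longrightarrow> u \<in> bdom E c \<Longrightarrow> u \<in> slit E \<Longrightarrow> hmet E F c \<alpha> \<sigma> u = evec E c (Inr \<alpha>) u (dF c \<sigma>)"
  by (simp add: hmet_dF evec_apply smooth_dF)

lemma dF_transition:
  assumes c: "c \<in> bcharts E" and c': "c' \<in> bcharts E" and u: "u \<in> bdom E c" "u \<in> bdom E c'" "u \<in> slit E"
  shows "dF c \<sigma> u = (\<Sum>\<delta>\<in>UNIV. cnj (tmat c c' (proj E u) $ \<delta> $ \<sigma>) * dF c' \<delta> u)"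
proof -
  show ?thesis
    unfolding dF_def tot.pd_chain(2)[OF at_echart[OF c' u(2)] at_echart[OF c u(1)] smooth_F[OF u(3)]]
    by (simp add: sum_UNIV_plus pd_fibre_coord[OF c c' u(1,2)])
qed

text \<open>The entries of \<open>cnj M\<close> are antiholomorphic, and hence constants for a vector of type (1,0).\<close>

lemma hol_dF_transition:
  assumes c: "c \<in> bcharts E" and c': "c' \<in> bcharts E" and u: "u \<in> bdom E c" "u \<in> bdom E c'" "u \<in> slit E"
    and v: "v \<in> hol_tangent (eatlas E) u"
  shows "v (dF c \<sigma>) = (\<Sum>\<delta>\<in>UNIV. cnj (tmat c c' (proj E u) $ \<delta> $ \<sigma>) * v (dF c' \<delta>))"
proof -
  note ctan = tot.hol_tangent_ctan[OF v]
  note sm = tmat_smooth[OF c c' u(1,2), THEN tot.smooth_at_cnj] smooth_dF[OF c' u(2,3)]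
  have "v (dF c \<sigma>) = v (\<lambda>x. \<Sum>\<delta>\<in>UNIV. cnj (tmat c c' (proj E x) $ \<delta> $ \<sigma>) * dF c' \<delta> x)"
    by (rule tot.ctan_cong[OF ctan smooth_dF[OF c u(1,3)], of "slit E \<inter> (bdom E c \<inter> bdom E c')"])
      (use c c' u dF_transition[OF c c'] in \<open>auto simp: bdom_open slit_open open_Int\<close>)
  then show ?thesis
    by (simp add: tot.ctan_sum_fun[OF ctan] tot.ctan_mult_fun[OF ctan] tot.smooth_at_mult sm
        tot.hol_tangent_antiholo[OF v tmat_holo[OF c c' u(1,2)]])
qed

lemma hmet_transition:
  assumes c: "c \<in> bcharts E" and c': "c' \<in> bcharts E" and u: "u \<in> bdom E c" "u \<in> bdom E c'" "u \<in> slit E"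
  shows "hmet E F c \<alpha> \<sigma> u = (\<Sum>\<delta>\<in>UNIV. \<Sum>\<gamma>\<in>UNIV. cnj (tmat c c' (proj E u) $ \<delta> $ \<sigma>) *
      (tmat c c' (proj E u) $ \<gamma> $ \<alpha> * hmet E F c' \<gamma> \<delta> u))"
proof -
  have "hmet E F c \<alpha> \<sigma> u =
      (\<Sum>\<delta>\<in>UNIV. cnj (tmat c c' (proj E u) $ \<delta> $ \<sigma>) * evec E c (Inr \<alpha>) u (dF c' \<delta>))"
    unfolding hmet_evec[OF c u(1,3)] by (rule hol_dF_transition[OF c c' u evec_hol[OF c u(1)]])
  then show ?thesis
    by (simp add: evec_transition[OF c c' u(1,2)] hmet_evec[OF c' u(2,3)] sum_distrib_left)
qed

lemma hmat_invertible:
  assumes c: "c \<in> bcharts E" "u \<in> bdom E c" "u \<in> slit E"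
  shows "invertible (\<chi> \<alpha> \<tau>. hmet E F c \<alpha> \<tau> u)"
proof -
  let ?H = "(\<chi> \<alpha> \<tau>. hmet E F c \<alpha> \<tau> u) :: complex^'m^'m"
  have "a = 0" if a: "?H *v a = 0" for a
  proof (rule ccontr)
    assume "a \<noteq> 0"
    \<comment> \<open>The conjugate is chosen so that the Hermitian form at \<open>\<xi>\<close> becomes the pairing of \<open>\<xi>\<close> with \<open>h a\<close>.\<close>
    define \<xi> :: "complex^'m" where "\<xi> = (\<chi> i. cnj (a $ i))"
    have "\<xi> \<noteq> 0" using \<open>a \<noteq> 0\<close> by (auto simp: \<xi>_def vec_eq_iff)
    then have "Re (\<Sum>\<alpha>\<in>UNIV. \<Sum>\<beta>\<in>UNIV. hmet E F c \<alpha> \<beta> u * \<xi> $ \<alpha> * cnj (\<xi> $ \<beta>)) > 0"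
      using convex c unfolding convex_finsler_def Let_def by blast
    moreover have "(\<Sum>\<alpha>\<in>UNIV. \<Sum>\<beta>\<in>UNIV. hmet E F c \<alpha> \<beta> u * \<xi> $ \<alpha> * cnj (\<xi> $ \<beta>))
        = (\<Sum>\<alpha>\<in>UNIV. \<xi> $ \<alpha> * (?H *v a) $ \<alpha>)"
      by (simp add: matrix_vector_mult_def \<xi>_def sum_distrib_left ac_simps)
    ultimately show False using a by simp
  qed
  then have "a = b" if "?H *v a = ?H *v b" for a b
    using that matrix_vector_mult_diff_distrib[of ?H a b] by (metis eq_iff_diff_eq_0)
  then have "inj ((*v) ?H)" by (rule injI)
  then show ?thesis using matrix_left_invertible_injective invertible_left_inverse by blast
qed

lemma hinv_hmet:
  assumes c: "c \<in> bcharts E" "u \<in> bdom E c" "u \<in> slit E"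
  shows "(\<Sum>\<sigma>\<in>UNIV. hmet E F c \<alpha> \<sigma> u * hinv E F c \<sigma> \<gamma> u) = (if \<alpha> = \<gamma> then 1 else 0)"
    "(\<Sum>\<alpha>\<in>UNIV. hinv E F c \<sigma> \<alpha> u * hmet E F c \<alpha> \<tau> u) = (if \<sigma> = \<tau> then 1 else 0)"
proof -
  let ?H = "(\<chi> \<alpha> \<tau>. hmet E F c \<alpha> \<tau> u) :: complex^'m^'m"
  have "?H ** matrix_inv ?H = mat 1 \<and> matrix_inv ?H ** ?H = mat 1"
    using hmat_invertible[OF c] unfolding invertible_def matrix_inv_def by (rule someI_ex)
  then have "(?H ** matrix_inv ?H) $ \<alpha> $ \<gamma> = mat 1 $ \<alpha> $ \<gamma>" "(matrix_inv ?H ** ?H) $ \<sigma> $ \<tau> = mat 1 $ \<sigma> $ \<tau>" by auto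
  then show "(\<Sum>\<sigma>\<in>UNIV. hmet E F c \<alpha> \<sigma> u * hinv E F c \<sigma> \<gamma> u) = (if \<alpha> = \<gamma> then 1 else 0)"
    "(\<Sum>\<alpha>\<in>UNIV. hinv E F c \<sigma> \<alpha> u * hmet E F c \<alpha> \<tau> u) = (if \<sigma> = \<tau> then 1 else 0)"
    by (simp_all add: matrix_matrix_mult_def mat_def hinv_def)
qed

text \<open>Lowering an index with \<open>h\<close> and raising it again with its inverse.\<close>

lemma lower_raise:
  assumes c: "c \<in> bcharts E" "u \<in> bdom E c" "u \<in> slit E"
  shows "(\<Sum>\<alpha>\<in>UNIV. hmet E F c \<alpha> \<tau> u * (\<Sum>\<sigma>\<in>UNIV. hinv E F c \<sigma> \<alpha> u * p \<sigma>)) = p \<tau>"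
proof -
  have "(\<Sum>\<alpha>\<in>UNIV. hmet E F c \<alpha> \<tau> u * (\<Sum>\<sigma>\<in>UNIV. hinv E F c \<sigma> \<alpha> u * p \<sigma>)) =
     (\<Sum>\<sigma>\<in>UNIV. (\<Sum>\<alpha>\<in>UNIV. hinv E F c \<sigma> \<alpha> u * hmet E F c \<alpha> \<tau> u) * p \<sigma>)"
    unfolding sum_distrib_left sum_distrib_right by (subst sum.swap) (simp add: ac_simps)
  then show ?thesis by (simp add: hinv_hmet[OF c] if_distrib[of "\<lambda>x. x * _"] cong: if_cong)
qed

lemma lower_inj:
  assumes c: "c \<in> bcharts E" "u \<in> bdom E c" "u \<in> slit E"
    and eq: "\<And>\<sigma>. (\<Sum>\<alpha>\<in>UNIV. hmet E F c \<alpha> \<sigma> u * x $ \<alpha>) = (\<Sum>\<alpha>\<in>UNIV. hmet E F c \<alpha> \<sigma> u * y $ \<alpha>)"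
  shows "x = y"
proof -
  have "(\<Sum>\<sigma>\<in>UNIV. hinv E F c \<sigma> \<gamma> u * (\<Sum>\<alpha>\<in>UNIV. hmet E F c \<alpha> \<sigma> u * z $ \<alpha>)) = z $ \<gamma>" for z \<gamma>
  proof -
    have "(\<Sum>\<sigma>\<in>UNIV. hinv E F c \<sigma> \<gamma> u * (\<Sum>\<alpha>\<in>UNIV. hmet E F c \<alpha> \<sigma> u * z $ \<alpha>)) =
       (\<Sum>\<alpha>\<in>UNIV. (\<Sum>\<sigma>\<in>UNIV. hmet E F c \<alpha> \<sigma> u * hinv E F c \<sigma> \<gamma> u) * z $ \<alpha>)"
      unfolding sum_distrib_left sum_distrib_right by (subst sum.swap) (simp add: ac_simps)
    then show ?thesis by (simp add: hinv_hmet[OF c] if_distrib[of "\<lambda>x. x * _"] cong: if_cong)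
  qed
  note raise = this
  have "x $ \<gamma> = y $ \<gamma>" for \<gamma>
    unfolding raise[of \<gamma> x, symmetric] raise[of \<gamma> y, symmetric] by (simp only: eq)
  then show ?thesis by (simp add: vec_eq_iff)
qed

text \<open>Lowered objects transform with \<open>cnj M\<close>. Since lowering is injective, an object whose
  lowered components transform in this way transforms itself with \<open>M\<close>. Both chart independence
  proofs below reduce to this.\<close>

lemma raise_transition:
  assumes c: "c \<in> bcharts E" and c': "c' \<in> bcharts E" and u: "u \<in> bdom E c" "u \<in> bdom E c'" "u \<in> slit E"
    and eq: "\<And>\<sigma>. (\<Sum>\<alpha>\<in>UNIV. hmet E F c \<alpha> \<sigma> u * x $ \<alpha>) =
      (\<Sum>\<delta>\<in>UNIV. cnj (tmat c c' (proj E u) $ \<delta> $ \<sigma>) * (\<Sum>\<gamma>\<in>UNIV. hmet E F c' \<gamma> \<delta> u * y $ \<gamma>))"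
  shows "y = tmat c c' (proj E u) *v x"
proof (rule lower_inj[OF c' u(2,3)])
  let ?M = "tmat c c' (proj E u)" and ?W = "tmat c' c (proj E u)"
  define P where "P \<delta> = (\<Sum>\<gamma>\<in>UNIV. hmet E F c' \<gamma> \<delta> u * y $ \<gamma>)" for \<delta>
  define Q where "Q \<delta> = (\<Sum>\<gamma>\<in>UNIV. hmet E F c' \<gamma> \<delta> u * (?M *v x) $ \<gamma>)" for \<delta>
  have MW: "(\<Sum>\<sigma>\<in>UNIV. ?M $ \<delta> $ \<sigma> * ?W $ \<sigma> $ \<tau>) = (if \<delta> = \<tau> then 1 else 0)" for \<delta> \<tau>
  proof -
    have "(?M ** ?W) $ \<delta> $ \<tau> = mat 1 $ \<delta> $ \<tau>" by (simp add: tmat_inverse[OF c' c u(2,1)])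
    then show ?thesis by (simp add: matrix_matrix_mult_def mat_def)
  qed
  have "(\<Sum>\<alpha>\<in>UNIV. hmet E F c \<alpha> \<sigma> u * x $ \<alpha>) = (\<Sum>\<delta>\<in>UNIV. cnj (?M $ \<delta> $ \<sigma>) * Q \<delta>)" for \<sigma>
  proof -
    have "(\<Sum>\<alpha>\<in>UNIV. hmet E F c \<alpha> \<sigma> u * x $ \<alpha>) =
        (\<Sum>\<alpha>\<in>UNIV. \<Sum>\<delta>\<in>UNIV. \<Sum>\<gamma>\<in>UNIV. cnj (?M $ \<delta> $ \<sigma>) * (hmet E F c' \<gamma> \<delta> u * (?M $ \<gamma> $ \<alpha> * x $ \<alpha>)))"
      by (simp add: hmet_transition[OF c c' u] sum_distrib_left sum_distrib_right ac_simps)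
    also have "\<dots> = (\<Sum>\<delta>\<in>UNIV. \<Sum>\<alpha>\<in>UNIV. \<Sum>\<gamma>\<in>UNIV. cnj (?M $ \<delta> $ \<sigma>) * (hmet E F c' \<gamma> \<delta> u * (?M $ \<gamma> $ \<alpha> * x $ \<alpha>)))"
      by (rule sum.swap)
    also have "\<dots> = (\<Sum>\<delta>\<in>UNIV. \<Sum>\<gamma>\<in>UNIV. \<Sum>\<alpha>\<in>UNIV. cnj (?M $ \<delta> $ \<sigma>) * (hmet E F c' \<gamma> \<delta> u * (?M $ \<gamma> $ \<alpha> * x $ \<alpha>)))"
      by (rule sum.cong[OF refl sum.swap])
    finally show ?thesis by (simp add: Q_def matrix_vector_mult_def sum_distrib_left)
  qed
  then have PQ: "(\<Sum>\<delta>\<in>UNIV. cnj (?M $ \<delta> $ \<sigma>) * P \<delta>) = (\<Sum>\<delta>\<in>UNIV. cnj (?M $ \<delta> $ \<sigma>) * Q \<delta>)" for \<sigma>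
    using eq[of \<sigma>] by (simp add: P_def)
  have cancel: "(\<Sum>\<sigma>\<in>UNIV. cnj (?W $ \<sigma> $ \<tau>) * (\<Sum>\<delta>\<in>UNIV. cnj (?M $ \<delta> $ \<sigma>) * R \<delta>)) = R \<tau>" for R \<tau>
  proof -
    have "(\<Sum>\<sigma>\<in>UNIV. cnj (?W $ \<sigma> $ \<tau>) * (\<Sum>\<delta>\<in>UNIV. cnj (?M $ \<delta> $ \<sigma>) * R \<delta>)) =
       (\<Sum>\<delta>\<in>UNIV. cnj (\<Sum>\<sigma>\<in>UNIV. ?M $ \<delta> $ \<sigma> * ?W $ \<sigma> $ \<tau>) * R \<delta>)"
      unfolding cnj_sum sum_distrib_left sum_distrib_right by (subst sum.swap) (simp add: ac_simps)
    then show ?thesis by (simp add: MW if_distrib[of "\<lambda>x. cnj x * _"] cong: if_cong)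
  qed
  have "P \<tau> = Q \<tau>" for \<tau> using cancel[of \<tau> P] cancel[of \<tau> Q] PQ by simp
  then show "(\<Sum>\<alpha>\<in>UNIV. hmet E F c' \<alpha> \<sigma> u * y $ \<alpha>) = (\<Sum>\<alpha>\<in>UNIV. hmet E F c' \<alpha> \<sigma> u * (?M *v x) $ \<alpha>)" for \<sigma>
    by (simp add: P_def Q_def)
qed

text \<open>Smoothness of the inverse matrix, by Cramer's rule.\<close>

lemma hinv_cramer:
  assumes c: "c \<in> bcharts E" "u \<in> bdom E c" "u \<in> slit E"
  shows "hinv E F c \<sigma> \<beta> u =
    det (\<chi> i j. if j = \<sigma> then axis \<beta> 1 $ i else hmet E F c i j u) * inverse (det (\<chi> i j. hmet E F c i j u))"
    "det (\<chi> i j. hmet E F c i j u) \<noteq> 0"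
proof -
  let ?H = "(\<chi> i j. hmet E F c i j u) :: complex^'m^'m"
  show d: "det ?H \<noteq> 0" using hmat_invertible[OF c] invertible_det_nz by blast
  have "?H ** matrix_inv ?H = mat 1"
    using hmat_invertible[OF c] unfolding invertible_def matrix_inv_def by (rule someI2_ex) simp
  then have "?H *v (matrix_inv ?H *v axis \<beta> 1) = axis \<beta> 1"
    by (simp add: matrix_vector_mul_assoc)
  then have "matrix_inv ?H *v axis \<beta> 1 = (\<chi> k. det (\<chi> i j. if j = k then axis \<beta> 1 $ i else ?H $ i $ j) / det ?H)"
    using cramer[OF d] by blast
  then have "(matrix_inv ?H *v axis \<beta> 1) $ \<sigma> = det (\<chi> i j. if j = \<sigma> then axis \<beta> 1 $ i else ?H $ i $ j) / det ?H"
    by simp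
  moreover have "(matrix_inv ?H *v axis \<beta> 1) $ \<sigma> = matrix_inv ?H $ \<sigma> $ \<beta>"
    by (simp add: matrix_vector_mult_def axis_def if_distrib[of "\<lambda>x. _ * x"] cong: if_cong)
  ultimately show "hinv E F c \<sigma> \<beta> u =
    det (\<chi> i j. if j = \<sigma> then axis \<beta> 1 $ i else hmet E F c i j u) * inverse (det ?H)"
    by (simp add: hinv_def divide_inverse cong: if_cong)
qed

lemma smooth_hinv:
  assumes c: "c \<in> bcharts E" "u \<in> bdom E c" "u \<in> slit E"
  shows "smooth_at (eatlas E) u (hinv E F c \<sigma> \<beta>)"
proof -
  have det: "smooth_at (eatlas E) u (\<lambda>x. det (\<chi> i j. f i j x))"
    if "\<And>i j. smooth_at (eatlas E) u (f i j)" for f :: "'m \<Rightarrow> 'm \<Rightarrow> 'e \<Rightarrow> complex"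
    unfolding det_def by (simp, intro tot.smooth_at_sum tot.smooth_at_mult tot.smooth_at_const tot.smooth_at_prod that)
  have "smooth_at (eatlas E) u (\<lambda>x. if j = \<sigma> then axis \<beta> 1 $ i else hmet E F c i j x)" for i j
    by (cases "j = \<sigma>") (simp_all add: tot.smooth_at_const smooth_hmet[OF c])
  then have "smooth_at (eatlas E) u (\<lambda>u. det (\<chi> i j. if j = \<sigma> then axis \<beta> 1 $ i else hmet E F c i j u) *
      inverse (det (\<chi> i j. hmet E F c i j u)))"
    by (intro tot.smooth_at_mult tot.smooth_at_inverse det smooth_hmet[OF c] hinv_cramer(2)[OF c])
  then show ?thesis
    by (rule tot.smooth_at_cong[of _ _ "slit E \<inter> bdom E c"])
      (use c in \<open>auto simp: bdom_open slit_open open_Int hinv_cramer(1)[OF c(1)]\<close>)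
qed

lemma smooth_cfN:
  assumes c: "c \<in> bcharts E" "u \<in> bdom E c" "u \<in> slit E"
  shows "smooth_at (eatlas E) u (cfN E F c k \<beta>)"
  unfolding cfN_def dF_def[symmetric]
  by (intro tot.smooth_at_sum tot.smooth_at_mult smooth_hinv[OF c] tot.smooth_at_pd(1) at_echart[OF c(1,2)] smooth_dF c)

text \<open>The vertical component of a vector of type (1,0) with respect to the nonlinear connection. By
  the next lemma its lowered components are the derivatives of the functions \<open>\<partial>F/\<partial>cnj u\<^sup>\<sigma>\<close>; in
  particular the horizontal vectors are those along which all these derivatives vanish.\<close>

definition vert :: "('b, 'e, 'n, 'm) bchart \<Rightarrow> 'e \<Rightarrow> 'e tvec \<Rightarrow> complex^'m" where
  "vert c u v = (\<chi> \<beta>. v (coord (echart E c) (Inr \<beta>)) +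
     (\<Sum>k\<in>UNIV. cfN E F c k \<beta> u * v (coord (echart E c) (Inl k))))"

lemma lower_vert:
  assumes c: "c \<in> bcharts E" "u \<in> bdom E c" "u \<in> slit E" and v: "v \<in> hol_tangent (eatlas E) u"
  shows "(\<Sum>\<beta>\<in>UNIV. hmet E F c \<beta> \<sigma> u * vert c u v $ \<beta>) = v (dF c \<sigma>)"
proof -
  have "(\<Sum>\<beta>\<in>UNIV. hmet E F c \<beta> \<sigma> u * (\<Sum>k\<in>UNIV. cfN E F c k \<beta> u * v (coord (echart E c) (Inl k))))
      = (\<Sum>k\<in>UNIV. (\<Sum>\<beta>\<in>UNIV. hmet E F c \<beta> \<sigma> u * cfN E F c k \<beta> u) * v (coord (echart E c) (Inl k)))"
    unfolding sum_distrib_left sum_distrib_right by (subst sum.swap) (simp add: ac_simps)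
  also have "\<dots> = (\<Sum>k\<in>UNIV. pd (echart E c) (Inl k) (dF c \<sigma>) u * v (coord (echart E c) (Inl k)))"
    unfolding cfN_def dF_def[symmetric] lower_raise[OF c] ..
  finally show ?thesis
    using tot.hol_tangent_repr[OF v at_echart[OF c(1,2)] smooth_dF[OF c]]
    by (simp add: vert_def sum_UNIV_plus hmet_dF algebra_simps sum.distrib)
qed

lemma vert_transition:
  assumes c: "c \<in> bcharts E" and c': "c' \<in> bcharts E" and u: "u \<in> bdom E c" "u \<in> bdom E c'" "u \<in> slit E"
    and v: "v \<in> hol_tangent (eatlas E) u"
  shows "vert c' u v = tmat c c' (proj E u) *v vert c u v"
  by (rule raise_transition[OF c c' u])
    (simp add: lower_vert[OF c u(1,3) v] lower_vert[OF c' u(2,3) v] hol_dF_transition[OF c c' u v])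

end

context finsler_bundle
begin

section \<open>The covariant derivative in a chart\<close>

text \<open>\<open>v\<close> is a complexified tangent vector at \<open>u\<close>, and \<open>b\<close> are the components of a section, defined near \<open>u\<close>.
  The connection form \<open>h\<inverse> \<partial>h\<close> only sees the part of \<open>v\<close> of type (1,0).\<close>

definition nabla :: "('b, 'e, 'n, 'm) bchart \<Rightarrow> 'e tvec \<Rightarrow> ('e \<Rightarrow> complex^'m) \<Rightarrow> 'e \<Rightarrow> complex^'m" where
  "nabla c v b u = (\<chi> \<gamma>. v (\<lambda>x. b x $ \<gamma>) +
     (\<Sum>\<sigma>\<in>UNIV. hinv E F c \<sigma> \<gamma> u * (\<Sum>\<alpha>\<in>UNIV. b u $ \<alpha> * tot.part10 (echart E c) u v (hmet E F c \<alpha> \<sigma>))))"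

lemma lower_nabla:
  assumes c: "c \<in> bcharts E" "u \<in> bdom E c" "u \<in> slit E"
  shows "(\<Sum>\<gamma>\<in>UNIV. hmet E F c \<gamma> \<tau> u * nabla c v b u $ \<gamma>) =
    (\<Sum>\<alpha>\<in>UNIV. hmet E F c \<alpha> \<tau> u * v (\<lambda>x. b x $ \<alpha>) + b u $ \<alpha> * tot.part10 (echart E c) u v (hmet E F c \<alpha> \<tau>))"
  by (simp add: nabla_def distrib_left sum.distrib lower_raise[OF c])

lemma hol_hmet_transition:
  assumes c: "c \<in> bcharts E" and c': "c' \<in> bcharts E" and u: "u \<in> bdom E c" "u \<in> bdom E c'" "u \<in> slit E"
    and w: "w \<in> hol_tangent (eatlas E) u"
  shows "w (hmet E F c \<alpha> \<sigma>) = (\<Sum>\<delta>\<in>UNIV. \<Sum>\<gamma>\<in>UNIV. cnj (tmat c c' (proj E u) $ \<delta> $ \<sigma>) *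
      (tmat c c' (proj E u) $ \<gamma> $ \<alpha> * w (hmet E F c' \<gamma> \<delta>) +
       hmet E F c' \<gamma> \<delta> u * w (\<lambda>x. tmat c c' (proj E x) $ \<gamma> $ \<alpha>)))"
proof -
  note ctan = tot.hol_tangent_ctan[OF w]
  note sm = tmat_smooth[OF c c' u(1,2)] tmat_smooth[OF c c' u(1,2), THEN tot.smooth_at_cnj] smooth_hmet[OF c' u(2,3)]
  have "w (hmet E F c \<alpha> \<sigma>) = w (\<lambda>x. \<Sum>\<delta>\<in>UNIV. \<Sum>\<gamma>\<in>UNIV. cnj (tmat c c' (proj E x) $ \<delta> $ \<sigma>) *
      (tmat c c' (proj E x) $ \<gamma> $ \<alpha> * hmet E F c' \<gamma> \<delta> x))"
    by (rule tot.ctan_cong[OF ctan smooth_hmet[OF c u(1,3)], of "slit E \<inter> (bdom E c \<inter> bdom E c')"])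
      (use c c' u hmet_transition[OF c c'] in \<open>auto simp: bdom_open slit_open open_Int\<close>)
  then show ?thesis
    by (simp add: tot.ctan_sum_fun[OF ctan] tot.ctan_mult_fun[OF ctan] tot.smooth_at_mult tot.smooth_at_sum sm
        tot.hol_tangent_antiholo[OF w tmat_holo[OF c c' u(1,2)]])
qed

text \<open>Let \<open>b' = M b\<close>. Both sides are compared after lowering an index. There the derivative \<open>v(M)\<close>
  arises on one side from the product rule for \<open>b'\<close>, and on the other from that for
  \<open>h = M\<^sup>t h' (cnj M)\<close>; the two contributions agree because \<open>M\<close> is holomorphic, so that \<open>v\<close> and its
  (1,0)-part coincide on \<open>M\<close> and the (1,0)-part annihilates \<open>cnj M\<close>.\<close>

lemma nabla_transition:
  assumes c: "c \<in> bcharts E" and c': "c' \<in> bcharts E" and u: "u \<in> bdom E c" "u \<in> bdom E c'" "u \<in> slit E"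
    and v: "v \<in> tot.ctan u" and b: "\<And>\<alpha>. smooth_at (eatlas E) u (\<lambda>x. b x $ \<alpha>)"
    and W: "open W" "u \<in> W" "\<And>x. x \<in> W \<Longrightarrow> b' x = tmat c c' (proj E x) *v b x"
  shows "nabla c' v b' u = tmat c c' (proj E u) *v nabla c v b u"
proof (rule raise_transition[OF c c' u])
  fix \<sigma>
  let ?M = "\<lambda>\<gamma> \<alpha> x. tmat c c' (proj E x) $ \<gamma> $ \<alpha>"
  define w where "w = tot.part10 (echart E c) u v"
  have w': "tot.part10 (echart E c') u v = w"
    unfolding w_def by (rule tot.part10_chart[OF v at_echart[OF c' u(2)] at_echart[OF c u(1)]])
  have w: "w \<in> hol_tangent (eatlas E) u" unfolding w_def by (rule tot.part10_hol[OF at_echart[OF c u(1)]])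
  have wM: "w (?M \<gamma> \<alpha>) = v (?M \<gamma> \<alpha>)" for \<gamma> \<alpha>
    unfolding w_def by (rule tot.part10_holo[OF v tmat_holo[OF c c' u(1,2)] at_echart[OF c u(1)]])
  note sm = tmat_smooth[OF c c' u(1,2)] b
  have vb': "v (\<lambda>x. b' x $ \<gamma>) = (\<Sum>\<alpha>\<in>UNIV. ?M \<gamma> \<alpha> u * v (\<lambda>x. b x $ \<alpha>) + b u $ \<alpha> * v (?M \<gamma> \<alpha>))" for \<gamma>
  proof -
    have "v (\<lambda>x. \<Sum>\<alpha>\<in>UNIV. ?M \<gamma> \<alpha> x * b x $ \<alpha>) = v (\<lambda>x. b' x $ \<gamma>)"
      by (rule tot.ctan_cong[OF v _ W(1,2)])
        (auto simp: W(3) matrix_vector_mult_def intro!: tot.smooth_at_sum tot.smooth_at_mult sm)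
    then show ?thesis by (simp add: tot.ctan_sum_fun[OF v] tot.ctan_mult_fun[OF v] tot.smooth_at_mult sm)
  qed
  have b'u: "b' u $ \<gamma> = (\<Sum>\<alpha>\<in>UNIV. ?M \<gamma> \<alpha> u * b u $ \<alpha>)" for \<gamma>
    using W by (simp add: matrix_vector_mult_def)
  define T where "T \<alpha> \<delta> \<gamma> = cnj (?M \<delta> \<sigma> u) * (hmet E F c' \<gamma> \<delta> u * (?M \<gamma> \<alpha> u * v (\<lambda>x. b x $ \<alpha>) + b u $ \<alpha> * v (?M \<gamma> \<alpha>))
      + ?M \<gamma> \<alpha> u * b u $ \<alpha> * w (hmet E F c' \<gamma> \<delta>))" for \<alpha> \<delta> \<gamma>
  have "(\<Sum>\<alpha>\<in>UNIV. hmet E F c \<alpha> \<sigma> u * nabla c v b u $ \<alpha>) = (\<Sum>\<alpha>\<in>UNIV. \<Sum>\<delta>\<in>UNIV. \<Sum>\<gamma>\<in>UNIV. T \<alpha> \<delta> \<gamma>)"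
    unfolding lower_nabla[OF c u(1,3)] unfolding w_def[symmetric] hol_hmet_transition[OF c c' u w] hmet_transition[OF c c' u] wM
    by (simp add: T_def sum_distrib_left sum_distrib_right sum.distrib[symmetric] algebra_simps)
  also have "\<dots> = (\<Sum>\<delta>\<in>UNIV. \<Sum>\<alpha>\<in>UNIV. \<Sum>\<gamma>\<in>UNIV. T \<alpha> \<delta> \<gamma>)" by (rule sum.swap)
  also have "\<dots> = (\<Sum>\<delta>\<in>UNIV. \<Sum>\<gamma>\<in>UNIV. \<Sum>\<alpha>\<in>UNIV. T \<alpha> \<delta> \<gamma>)" by (rule sum.cong[OF refl sum.swap])
  also have "\<dots> = (\<Sum>\<delta>\<in>UNIV. cnj (?M \<delta> \<sigma> u) * (\<Sum>\<gamma>\<in>UNIV. hmet E F c' \<gamma> \<delta> u * nabla c' v b' u $ \<gamma>))"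
    unfolding lower_nabla[OF c' u(2,3)] w' vb' b'u
    by (simp add: T_def sum_distrib_left sum_distrib_right sum.distrib[symmetric] algebra_simps)
  finally show "(\<Sum>\<alpha>\<in>UNIV. hmet E F c \<alpha> \<sigma> u * nabla c v b u $ \<alpha>) =
      (\<Sum>\<delta>\<in>UNIV. cnj (?M \<delta> \<sigma> u) * (\<Sum>\<gamma>\<in>UNIV. hmet E F c' \<gamma> \<delta> u * nabla c' v b' u $ \<gamma>))" .
qed

lemma nabla_add:
  assumes "v \<in> tot.ctan u" "\<And>\<alpha>. smooth_at (eatlas E) u (\<lambda>x. b x $ \<alpha>)" "\<And>\<alpha>. smooth_at (eatlas E) u (\<lambda>x. b' x $ \<alpha>)"
  shows "nabla c v (\<lambda>x. b x + b' x) u = nabla c v b u + nabla c v b' u"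
  by (simp add: nabla_def vec_eq_iff tot.ctan_add_fun[OF assms] distrib_left distrib_right sum.distrib)

lemma nabla_mult:
  assumes "v \<in> tot.ctan u" "smooth_at (eatlas E) u f" "\<And>\<alpha>. smooth_at (eatlas E) u (\<lambda>x. b x $ \<alpha>)"
  shows "nabla c v (\<lambda>x. f x *s b x) u = f u *s nabla c v b u + v f *s b u"
  by (simp add: nabla_def vec_eq_iff tot.ctan_mult_fun[OF assms] sum_distrib_left algebra_simps)

lemma nabla_lincomb:
  "nabla c (\<lambda>f. r * v f + s * w f) b u = r *s nabla c v b u + s *s nabla c w b u"
  by (simp add: nabla_def vec_eq_iff tot.part10_lincomb sum_distrib_left sum.distrib[symmetric] algebra_simps)

lemma nabla_cong:
  assumes "v \<in> tot.ctan u" "\<And>\<alpha>. smooth_at (eatlas E) u (\<lambda>x. b x $ \<alpha>)" "open W" "u \<in> W" "\<And>x. x \<in> W \<Longrightarrow> b x = b' x"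
  shows "nabla c v b u = nabla c v b' u"
proof -
  have "v (\<lambda>x. b x $ \<gamma>) = v (\<lambda>x. b' x $ \<gamma>)" for \<gamma>
    by (rule tot.ctan_cong[OF assms(1,2,3,4)]) (simp add: assms(5))
  then show ?thesis using assms(4,5) by (simp add: nabla_def)
qed

lemma nabla_const:
  assumes "v \<in> tot.ctan u" "open W" "u \<in> W" "\<forall>x\<in>W. b x = a"
  shows "nabla c v b u = (\<chi> \<gamma>. \<Sum>\<sigma>\<in>UNIV. hinv E F c \<sigma> \<gamma> u * (\<Sum>\<alpha>\<in>UNIV. a $ \<alpha> * tot.part10 (echart E c) u v (hmet E F c \<alpha> \<sigma>)))"
proof -
  have "nabla c v (\<lambda>_. a) u = nabla c v b u"
    by (rule nabla_cong[OF assms(1) tot.smooth_at_const assms(2,3)]) (simp add: assms(4))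
  then show ?thesis by (simp add: nabla_def tot.ctan_const[OF assms(1)])
qed

lemma smooth_nabla:
  assumes c: "c \<in> bcharts E" and W: "open W" "W \<subseteq> slit E" "W \<subseteq> bdom E c" "u \<in> W"
    and v: "\<And>x. x \<in> W \<Longrightarrow> v x \<in> tot.ctan x"
    and vs: "\<And>i. smooth_at (eatlas E) u (\<lambda>x. v x (coord (echart E c) i))"
      "\<And>i. smooth_at (eatlas E) u (\<lambda>x. v x (\<lambda>y. cnj (coord (echart E c) i y)))"
    and b: "\<And>\<alpha>. smooth_at (eatlas E) u (\<lambda>x. b x $ \<alpha>)"
  shows "smooth_at (eatlas E) u (\<lambda>x. nabla c (v x) b x $ \<gamma>)"
proof -
  have u: "u \<in> slit E" "u \<in> bdom E c" using W by auto
  have sub: "W \<subseteq> fst (echart E c)" using W by (simp add: fst_echart)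
  note field = tot.smooth_at_vector_field[OF echart_mem[OF c] W(1) sub W(4)]
  have at: "x \<in> bdom E c" if "x \<in> W" for x using W that by blast
  have hol: "tot.part10 (echart E c) x (v x) \<in> hol_tangent (eatlas E) x" if "x \<in> W" for x
    by (rule tot.part10_hol[OF at_echart[OF c at[OF that]]])
  have "smooth_at (eatlas E) u (\<lambda>x. v x (\<lambda>y. b y $ \<gamma>))"
    by (rule field[OF v vs b])
  moreover have "smooth_at (eatlas E) u (\<lambda>x. tot.part10 (echart E c) x (v x) (hmet E F c \<alpha> \<sigma>))" for \<alpha> \<sigma>
  proof (rule field[OF tot.hol_tangent_ctan[OF hol]])
    show "smooth_at (eatlas E) u (\<lambda>x. tot.part10 (echart E c) x (v x) (coord (echart E c) i))" for i
      by (rule tot.smooth_at_cong[OF vs(1)[of i] W(1,4)])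
        (rule tot.part10_coord[OF at_echart[OF c at], symmetric])
    show "smooth_at (eatlas E) u (\<lambda>x. tot.part10 (echart E c) x (v x) (\<lambda>y. cnj (coord (echart E c) i y)))" for i
      by (rule tot.smooth_at_cong[OF tot.smooth_at_const[of u 0] W(1,4)])
        (use hol tot.hol_tangent_iff[OF at_echart[OF c at]] in auto)
  qed (use smooth_hmet[OF c u(2,1)] in auto)
  ultimately show ?thesis
    unfolding nabla_def
    by (simp, intro tot.smooth_at_add tot.smooth_at_sum tot.smooth_at_mult smooth_hinv[OF c u(2,1)] b)
qed


section \<open>The nonlinear connection\<close>

lemma deltak_hol:
  assumes "c \<in> bcharts E" "u \<in> bdom E c"
  shows "deltak E N c k u \<in> hol_tangent (eatlas E) u"
proof -
  have "(\<lambda>f. \<Sum>\<beta>\<in>UNIV. N c k \<beta> u * evec E c (Inr \<beta>) u f) \<in> hol_tangent (eatlas E) u"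
    by (intro tot.hol_tangent_sum tot.hol_tangent_scale evec_hol[OF assms])
  from tot.hol_tangent_lincomb[OF evec_hol[OF assms, of "Inl k"] this, of 1 "-1"]
  show ?thesis by (simp add: deltak_def)
qed

lemma deltak_coord:
  assumes "c \<in> bcharts E" "u \<in> bdom E c"
  shows "deltak E N c k u (coord (echart E c) (Inl j)) = (if k = j then 1 else 0)"
    "deltak E N c k u (coord (echart E c) (Inr \<beta>)) = - N c k \<beta> u"
  by (simp_all add: deltak_def evec_coord[OF assms] if_distrib[of "\<lambda>x. _ * x"] cong: if_cong)

text \<open>The condition on the right is independent of the chart, which makes the \<open>\<delta>\<^sub>k\<close> of all charts span the same
  distribution. It says that the lowered vertical component vanishes.\<close>

lemma span_delta_iff:
  assumes c: "c \<in> bcharts E" "u \<in> bdom E c" "u \<in> slit E"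
  shows "(\<exists>a. v = (\<lambda>f. \<Sum>k\<in>UNIV. a k * deltak E (cfN E F) c k u f)) \<longleftrightarrow>
    v \<in> hol_tangent (eatlas E) u \<and> (\<forall>\<sigma>. v (dF c \<sigma>) = 0)"
proof
  assume "\<exists>a. v = (\<lambda>f. \<Sum>k\<in>UNIV. a k * deltak E (cfN E F) c k u f)"
  then obtain a where v: "v = (\<lambda>f. \<Sum>k\<in>UNIV. a k * deltak E (cfN E F) c k u f)" by blast
  have hol: "v \<in> hol_tangent (eatlas E) u"
    unfolding v by (intro tot.hol_tangent_sum tot.hol_tangent_scale deltak_hol c)
  have "vert c u v = 0"
    by (simp add: vert_def v deltak_coord[OF c(1,2)] vec_eq_iff sum_negf if_distrib[of "\<lambda>x. _ * x"] if_distrib[of "\<lambda>x. x * _"] mult.commute[of "a _"] cong: if_cong)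
  then show "v \<in> hol_tangent (eatlas E) u \<and> (\<forall>\<sigma>. v (dF c \<sigma>) = 0)"
    using hol lower_vert[OF c hol] by (metis (mono_tags, lifting) mult_zero_right sum.neutral zero_index)
next
  assume R: "v \<in> hol_tangent (eatlas E) u \<and> (\<forall>\<sigma>. v (dF c \<sigma>) = 0)"
  have "vert c u v = 0"
    by (rule lower_inj[OF c]) (use R lower_vert[OF c] in simp)
  then have "v (coord (echart E c) (Inr \<beta>)) + (\<Sum>k\<in>UNIV. cfN E F c k \<beta> u * v (coord (echart E c) (Inl k))) = 0" for \<beta>
    by (simp add: vert_def vec_eq_iff)
  then have vert: "v (coord (echart E c) (Inr \<beta>)) = - (\<Sum>k\<in>UNIV. cfN E F c k \<beta> u * v (coord (echart E c) (Inl k)))" for \<beta>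
    by (simp add: add_eq_0_iff2)
  have "v = (\<lambda>f. \<Sum>k\<in>UNIV. v (coord (echart E c) (Inl k)) * deltak E (cfN E F) c k u f)"
  proof (rule tot.hol_tangent_eqI[OF _ _ at_echart[OF c(1,2)]])
    show "v (coord (echart E c) i) = (\<Sum>k\<in>UNIV. v (coord (echart E c) (Inl k)) * deltak E (cfN E F) c k u (coord (echart E c) i))" for i
      by (cases i) (simp_all add: deltak_coord[OF c(1,2)] vert sum_negf if_distrib[of "\<lambda>x. _ * x"] if_distrib[of "\<lambda>x. x * _"] mult.commute[of "v _"] cong: if_cong)
  qed (use R c in \<open>auto intro!: tot.hol_tangent_sum tot.hol_tangent_scale deltak_hol\<close>)
  then show "\<exists>a. v = (\<lambda>f. \<Sum>k\<in>UNIV. a k * deltak E (cfN E F) c k u f)"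
    by (rule exI[where x = "\<lambda>k. v (coord (echart E c) (Inl k))"])
qed

lemma nonlinear_connection_cfN: "nonlinear_connection E (cfN E F)"
  unfolding nonlinear_connection_def
proof (intro conjI)
  show "\<forall>c\<in>bcharts E. \<forall>k \<beta>. smooth_fun (eatlas E) (slit E \<inter> bdom E c) (cfN E F c k \<beta>)"
    using smooth_cfN by (auto simp: tot.smooth_fun_iff slit_open bdom_open open_Int)
  define H where "H u = {v \<in> hol_tangent (eatlas E) u. \<forall>c\<in>bcharts E. u \<in> bdom E c \<longrightarrow> (\<forall>\<sigma>. v (dF c \<sigma>) = 0)}" for u
  have "H u = {v. \<exists>a. v = (\<lambda>f. \<Sum>k\<in>UNIV. a k * deltak E (cfN E F) c k u f)}"
    if c: "c \<in> bcharts E" "u \<in> slit E \<inter> bdom E c" for c u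
  proof -
    have "(\<forall>c'\<in>bcharts E. u \<in> bdom E c' \<longrightarrow> (\<forall>\<sigma>. v (dF c' \<sigma>) = 0)) \<longleftrightarrow> (\<forall>\<sigma>. v (dF c \<sigma>) = 0)"
      if "v \<in> hol_tangent (eatlas E) u" for v
    proof (intro iffI ballI impI allI)
      fix c' \<sigma> assume "\<forall>\<sigma>. v (dF c \<sigma>) = 0" "c' \<in> bcharts E" "u \<in> bdom E c'"
      then show "v (dF c' \<sigma>) = 0"
        by (subst hol_dF_transition[OF _ c(1), of c' u v]) (use c that in auto)
    qed (use c in blast)
    then show ?thesis using span_delta_iff[OF c(1)] c by (auto simp: H_def)
  qed
  then show "\<exists>H. \<forall>c\<in>bcharts E. \<forall>u\<in>slit E \<inter> bdom E c.
      H u = {v. \<exists>a. v = (\<lambda>f. \<Sum>k\<in>UNIV. a k * deltak E (cfN E F) c k u f)}" by blast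
qed

end

section \<open>Sections of the complexified tangent bundle\<close>

lemma conj_tv_conj: "conj_tv (conj_tv v) = v"
  by (simp add: conj_tv_def)

lemma conj_tv_add: "conj_tv (\<lambda>f. v f + w f) = (\<lambda>f. conj_tv v f + conj_tv w f)"
  by (simp add: conj_tv_def)

lemma conj_tv_mult: "conj_tv (\<lambda>f. r * v f) = (\<lambda>f. cnj r * conj_tv v f)"
  by (simp add: conj_tv_def)

lemma conj_tv_zero: "conj_tv (\<lambda>f. 0) = (\<lambda>f. 0)"
  by (simp add: conj_tv_def)

lemma conj_tv_cnj: "conj_tv v (\<lambda>x. cnj (f x)) = cnj (v f)"
  by (simp add: conj_tv_def)

lemma conj_tv_apply: "conj_tv v f = cnj (v (\<lambda>x. cnj (f x)))"
  by (simp add: conj_tv_def)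

context holo_bundle
begin

lemma evec_cnj_coord: "c \<in> bcharts E \<Longrightarrow> u \<in> bdom E c \<Longrightarrow>
    evec E c i u (\<lambda>x. cnj (coord (echart E c) j x)) = 0"
  using evec_hol tot.hol_tangent_iff[OF at_echart] by blast

lemma tangent_comb:
  assumes c: "c \<in> bcharts E" "u \<in> bdom E c"
    and v: "v = (\<lambda>f. (\<Sum>i\<in>UNIV. a i * evec E c i u f) + (\<Sum>i\<in>UNIV. a' i * conj_tv (evec E c i u) f))"
  shows "v \<in> tot.ctan u" "v (coord (echart E c) j) = a j" "v (\<lambda>x. cnj (coord (echart E c) j x)) = a' j"
proof -
  show "v \<in> tot.ctan u"
    unfolding v by (intro tot.ctan_add tot.ctan_sum tot.ctan_scale tot.ctan_conj tot.hol_tangent_ctan evec_hol c)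
  show "v (coord (echart E c) j) = a j"
    by (simp add: v evec_coord[OF c] conj_tv_apply evec_cnj_coord[OF c] if_distrib[of "\<lambda>x. _ * x"] cong: if_cong)
  show "v (\<lambda>x. cnj (coord (echart E c) j x)) = a' j"
    by (simp add: v evec_coord[OF c] conj_tv_cnj evec_cnj_coord[OF c] if_distrib[of "\<lambda>x. _ * x"] if_distrib[of cnj] cong: if_cong)
qed

lemma tangent_expand:
  assumes c: "c \<in> bcharts E" "u \<in> bdom E c" and v: "v \<in> tot.ctan u"
  shows "v = (\<lambda>f. (\<Sum>i\<in>UNIV. v (coord (echart E c) i) * evec E c i u f) +
      (\<Sum>i\<in>UNIV. v (\<lambda>x. cnj (coord (echart E c) i x)) * conj_tv (evec E c i u) f))"
  by (rule tot.ctan_eqI[OF v _ at_echart[OF c]]) (simp_all add: tangent_comb[OF c refl])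

lemma smooth_fun_germs:
  assumes "open W" "c \<in> bcharts E"
  shows "smooth_fun (eatlas E) (W \<inter> bdom E c) f \<longleftrightarrow> (\<forall>u\<in>W \<inter> bdom E c. smooth_at (eatlas E) u f)"
  using assms by (simp add: tot.smooth_fun_iff bdom_open open_Int)

text \<open>The coefficients of a section are its values on coordinate functions, so their smoothness can be expressed
  without existential quantifiers.\<close>

lemma tangent_section_iff:
  assumes W: "open W"
  shows "tangent_section E W \<xi> \<longleftrightarrow> (\<forall>u\<in>W. \<xi> u \<in> tot.ctan u) \<and>
    (\<forall>c\<in>bcharts E. \<forall>u\<in>W \<inter> bdom E c. \<forall>i. smooth_at (eatlas E) u (\<lambda>x. \<xi> x (coord (echart E c) i)) \<and>
       smooth_at (eatlas E) u (\<lambda>x. \<xi> x (\<lambda>y. cnj (coord (echart E c) i y))))"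
proof (intro iffI conjI ballI)
  fix u assume T: "tangent_section E W \<xi>" and u: "u \<in> W"
  obtain c where c: "c \<in> bcharts E" "u \<in> bdom E c" using bdom_bchart_ex by blast
  then obtain a a' where "\<forall>u\<in>W \<inter> bdom E c. \<xi> u =
      (\<lambda>f. (\<Sum>i\<in>UNIV. a i u * evec E c i u f) + (\<Sum>i\<in>UNIV. a' i u * conj_tv (evec E c i u) f))"
    using T unfolding tangent_section_def by blast
  then have e: "\<xi> u = (\<lambda>f. (\<Sum>i\<in>UNIV. a i u * evec E c i u f) + (\<Sum>i\<in>UNIV. a' i u * conj_tv (evec E c i u) f))"
    using u c by blast
  show "\<xi> u \<in> tot.ctan u" by (rule tangent_comb(1)[OF c e])
next
  fix c u assume T: "tangent_section E W \<xi>" and c: "c \<in> bcharts E" and u: "u \<in> W \<inter> bdom E c"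
  obtain a a' where s: "\<forall>i. smooth_fun (eatlas E) (W \<inter> bdom E c) (a i) \<and> smooth_fun (eatlas E) (W \<inter> bdom E c) (a' i)"
    and e: "\<forall>u\<in>W \<inter> bdom E c. \<xi> u =
      (\<lambda>f. (\<Sum>i\<in>UNIV. a i u * evec E c i u f) + (\<Sum>i\<in>UNIV. a' i u * conj_tv (evec E c i u) f))"
    using T c unfolding tangent_section_def by blast
  have sm: "smooth_at (eatlas E) u (a i)" "smooth_at (eatlas E) u (a' i)" for i
    using s u unfolding smooth_fun_germs[OF W c] by blast+
  have op: "open (W \<inter> bdom E c)" using W bdom_open c by blast
  show "\<forall>i. smooth_at (eatlas E) u (\<lambda>x. \<xi> x (coord (echart E c) i)) \<and>
       smooth_at (eatlas E) u (\<lambda>x. \<xi> x (\<lambda>y. cnj (coord (echart E c) i y)))"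
  proof (intro allI conjI)
    fix i
    show "smooth_at (eatlas E) u (\<lambda>x. \<xi> x (coord (echart E c) i))"
    proof (rule tot.smooth_at_cong[OF sm(1)[of i] op u])
      fix x assume x: "x \<in> W \<inter> bdom E c"
      show "a i x = \<xi> x (coord (echart E c) i)"
        using tangent_comb(2)[OF c _ bspec[OF e x], of i] x by simp
    qed
    show "smooth_at (eatlas E) u (\<lambda>x. \<xi> x (\<lambda>y. cnj (coord (echart E c) i y)))"
    proof (rule tot.smooth_at_cong[OF sm(2)[of i] op u])
      fix x assume x: "x \<in> W \<inter> bdom E c"
      show "a' i x = \<xi> x (\<lambda>y. cnj (coord (echart E c) i y))"
        using tangent_comb(3)[OF c _ bspec[OF e x], of i] x by simp
    qed
  qed
next
  assume R: "(\<forall>u\<in>W. \<xi> u \<in> tot.ctan u) \<and>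
    (\<forall>c\<in>bcharts E. \<forall>u\<in>W \<inter> bdom E c. \<forall>i. smooth_at (eatlas E) u (\<lambda>x. \<xi> x (coord (echart E c) i)) \<and>
       smooth_at (eatlas E) u (\<lambda>x. \<xi> x (\<lambda>y. cnj (coord (echart E c) i y))))"
  show "tangent_section E W \<xi>"
    unfolding tangent_section_def
  proof (intro ballI exI conjI)
    fix c assume c: "c \<in> bcharts E"
    show "\<forall>i. smooth_fun (eatlas E) (W \<inter> bdom E c) (\<lambda>x. \<xi> x (coord (echart E c) i)) \<and>
        smooth_fun (eatlas E) (W \<inter> bdom E c) (\<lambda>x. \<xi> x (\<lambda>y. cnj (coord (echart E c) i y)))"
      using R c unfolding smooth_fun_germs[OF W c] by blast
    show "\<xi> u = (\<lambda>f. (\<Sum>i\<in>UNIV. \<xi> u (coord (echart E c) i) * evec E c i u f) +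
        (\<Sum>i\<in>UNIV. \<xi> u (\<lambda>y. cnj (coord (echart E c) i y)) * conj_tv (evec E c i u) f))"
      if "u \<in> W \<inter> bdom E c" for u
      using that R by (intro tangent_expand[OF c]) auto
  qed
qed

definition vertical_at :: "'e \<Rightarrow> 'e tvec \<Rightarrow> bool" where
  "vertical_at u v \<longleftrightarrow> (\<forall>c\<in>bcharts E. u \<in> bdom E c \<longrightarrow>
     (\<forall>k. v (coord (echart E c) (Inl k)) = 0 \<and> v (\<lambda>x. cnj (coord (echart E c) (Inl k) x)) = 0))"

text \<open>Expansions in the fibre derivatives are expansions in all coordinate derivatives whose coefficients along the
  base directions are 0.\<close>

lemma vertical_section_iff:
  assumes W: "open W"
  shows "vertical_section E W \<eta> \<longleftrightarrow> tangent_section E W \<eta> \<and> (\<forall>u\<in>W. vertical_at u (\<eta> u))"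
proof (intro iffI conjI ballI)
  assume V: "vertical_section E W \<eta>"
  have *: "\<exists>b b'. (\<forall>\<alpha>. smooth_fun (eatlas E) (W \<inter> bdom E c) (b \<alpha>) \<and> smooth_fun (eatlas E) (W \<inter> bdom E c) (b' \<alpha>)) \<and>
        (\<forall>u\<in>W \<inter> bdom E c. \<eta> u =
           (\<lambda>f. (\<Sum>i\<in>UNIV. case_sum (\<lambda>_. 0) (\<lambda>\<alpha>. b \<alpha> u) i * evec E c i u f)
              + (\<Sum>i\<in>UNIV. case_sum (\<lambda>_. 0) (\<lambda>\<alpha>. b' \<alpha> u) i * conj_tv (evec E c i u) f)))"
    if "c \<in> bcharts E" for c
    using V that unfolding vertical_section_def by (simp add: sum_UNIV_plus)
  show "tangent_section E W \<eta>"
    unfolding tangent_section_def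
  proof
    fix c assume c: "c \<in> bcharts E"
    obtain b b' where b: "\<forall>\<alpha>. smooth_fun (eatlas E) (W \<inter> bdom E c) (b \<alpha>) \<and> smooth_fun (eatlas E) (W \<inter> bdom E c) (b' \<alpha>)"
      and e: "\<forall>u\<in>W \<inter> bdom E c. \<eta> u =
           (\<lambda>f. (\<Sum>i\<in>UNIV. case_sum (\<lambda>_. 0) (\<lambda>\<alpha>. b \<alpha> u) i * evec E c i u f)
              + (\<Sum>i\<in>UNIV. case_sum (\<lambda>_. 0) (\<lambda>\<alpha>. b' \<alpha> u) i * conj_tv (evec E c i u) f))"
      using *[OF c] by blast
    have s: "smooth_fun (eatlas E) (W \<inter> bdom E c) (\<lambda>u. case_sum (\<lambda>_. 0) (\<lambda>\<alpha>. b \<alpha> u) i)"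
      if "\<forall>\<alpha>. smooth_fun (eatlas E) (W \<inter> bdom E c) (b \<alpha>)" for b and i :: "'n + 'm"
      using that unfolding smooth_fun_germs[OF W c] by (cases i) (auto intro: tot.smooth_at_const)
    show "\<exists>a a'. (\<forall>i. smooth_fun (eatlas E) (W \<inter> bdom E c) (a i) \<and> smooth_fun (eatlas E) (W \<inter> bdom E c) (a' i)) \<and>
        (\<forall>u\<in>W \<inter> bdom E c. \<eta> u =
           (\<lambda>f. (\<Sum>i\<in>UNIV. a i u * evec E c i u f) + (\<Sum>i\<in>UNIV. a' i u * conj_tv (evec E c i u) f)))"
      by (rule exI[of _ "\<lambda>i u. case_sum (\<lambda>_. 0) (\<lambda>\<alpha>. b \<alpha> u) i"],
          rule exI[of _ "\<lambda>i u. case_sum (\<lambda>_. 0) (\<lambda>\<alpha>. b' \<alpha> u) i"])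
        (use b e s in blast)
  qed
  fix u assume u: "u \<in> W"
  show "vertical_at u (\<eta> u)"
    unfolding vertical_at_def
  proof (intro ballI impI allI)
    fix c k assume c: "c \<in> bcharts E" "u \<in> bdom E c"
    obtain b b' where "\<forall>u\<in>W \<inter> bdom E c. \<eta> u =
           (\<lambda>f. (\<Sum>i\<in>UNIV. case_sum (\<lambda>_. 0) (\<lambda>\<alpha>. b \<alpha> u) i * evec E c i u f)
              + (\<Sum>i\<in>UNIV. case_sum (\<lambda>_. 0) (\<lambda>\<alpha>. b' \<alpha> u) i * conj_tv (evec E c i u) f))"
      using *[OF c(1)] by blast
    then have "\<eta> u = (\<lambda>f. (\<Sum>i\<in>UNIV. case_sum (\<lambda>_. 0) (\<lambda>\<alpha>. b \<alpha> u) i * evec E c i u f)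
              + (\<Sum>i\<in>UNIV. case_sum (\<lambda>_. 0) (\<lambda>\<alpha>. b' \<alpha> u) i * conj_tv (evec E c i u) f))"
      using u c by blast
    from tangent_comb(2,3)[OF c this, of "Inl k"]
    show "\<eta> u (coord (echart E c) (Inl k)) = 0 \<and> \<eta> u (\<lambda>x. cnj (coord (echart E c) (Inl k) x)) = 0" by simp
  qed
next
  assume R: "tangent_section E W \<eta> \<and> (\<forall>u\<in>W. vertical_at u (\<eta> u))"
  show "vertical_section E W \<eta>"
    unfolding vertical_section_def
  proof (intro ballI exI conjI)
    fix c assume c: "c \<in> bcharts E"
    show "\<forall>\<alpha>. smooth_fun (eatlas E) (W \<inter> bdom E c) (\<lambda>x. \<eta> x (coord (echart E c) (Inr \<alpha>))) \<and>
        smooth_fun (eatlas E) (W \<inter> bdom E c) (\<lambda>x. \<eta> x (\<lambda>y. cnj (coord (echart E c) (Inr \<alpha>) y)))"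
      using R c unfolding smooth_fun_germs[OF W c] tangent_section_iff[OF W] by blast
    show "\<eta> u = (\<lambda>f. (\<Sum>\<alpha>\<in>UNIV. \<eta> u (coord (echart E c) (Inr \<alpha>)) * evec E c (Inr \<alpha>) u f) +
        (\<Sum>\<alpha>\<in>UNIV. \<eta> u (\<lambda>y. cnj (coord (echart E c) (Inr \<alpha>) y)) * conj_tv (evec E c (Inr \<alpha>) u) f))"
      if u: "u \<in> W \<inter> bdom E c" for u
    proof -
      have "\<eta> u \<in> tot.ctan u" "vertical_at u (\<eta> u)" using R u tangent_section_iff[OF W] by auto
      then show ?thesis
        using tangent_expand[OF c _ \<open>\<eta> u \<in> tot.ctan u\<close>] u c by (simp add: sum_UNIV_plus vertical_at_def)
    qed
  qed
qed

lemma tangent_section_conj: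
  assumes "open W" "tangent_section E W \<xi>"
  shows "tangent_section E W (\<lambda>x. conj_tv (\<xi> x))"
  using assms(2) unfolding tangent_section_iff[OF assms(1)]
  by (auto simp: conj_tv_apply[of _ "coord _ _"] conj_tv_cnj intro: tot.ctan_conj tot.smooth_at_cnj)

lemma vertical_section_conj:
  assumes "open W" "vertical_section E W \<eta>"
  shows "vertical_section E W (\<lambda>x. conj_tv (\<eta> x))"
  using assms(2) tangent_section_conj[OF assms(1)] unfolding vertical_section_iff[OF assms(1)]
  by (auto simp: vertical_at_def conj_tv_apply[of _ "coord _ _"] conj_tv_cnj)

text \<open>For a field of type (1,0), smoothness of the coefficients in one chart implies smoothness in all others.\<close>

lemma hol_field_section:
  assumes W: "open W" "W \<subseteq> bdom E c" and c: "c \<in> bcharts E"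
    and hol: "\<And>u. u \<in> W \<Longrightarrow> \<xi> u \<in> hol_tangent (eatlas E) u"
    and sm: "\<And>u i. u \<in> W \<Longrightarrow> smooth_at (eatlas E) u (\<lambda>x. \<xi> x (coord (echart E c) i))"
  shows "tangent_section E W \<xi>"
proof -
  have ct: "\<xi> u \<in> tot.ctan u" if "u \<in> W" for u using hol that tot.hol_tangent_ctan by blast
  have sub: "W \<subseteq> fst (echart E c)" using W by (simp add: fst_echart)
  have z: "\<xi> u (\<lambda>x. cnj (coord (echart E c') i x)) = 0" if "c' \<in> bcharts E" "u \<in> W" "u \<in> bdom E c'" for c' u i
    using hol tot.hol_tangent_iff[OF at_echart[of c' u]] that by blast
  show ?thesis
    unfolding tangent_section_iff[OF W(1)]
  proof (intro conjI ballI allI)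
    fix c' u i assume c': "c' \<in> bcharts E" and u: "u \<in> W \<inter> bdom E c'"
    have op: "open (W \<inter> bdom E c')" using W bdom_open c' by blast
    have s0: "smooth_at (eatlas E) u (\<lambda>x. \<xi> x (\<lambda>y. cnj (coord (echart E d) j y)))"
      if "d \<in> bcharts E" "W \<inter> bdom E c' \<subseteq> bdom E d" for d j
    proof (rule tot.smooth_at_cong[OF tot.smooth_at_const[of u 0] op u])
      fix x assume "x \<in> W \<inter> bdom E c'"
      then show "0 = \<xi> x (\<lambda>y. cnj (coord (echart E d) j y))" using z[of d x j] that by auto
    qed
    show "smooth_at (eatlas E) u (\<lambda>x. \<xi> x (\<lambda>y. cnj (coord (echart E c') i y)))" by (rule s0) (use c' in auto)
    show "smooth_at (eatlas E) u (\<lambda>x. \<xi> x (coord (echart E c') i))"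
      by (rule tot.smooth_at_vector_field[OF echart_mem[OF c] W(1) sub _ ct])
        (use u c c' W in \<open>auto intro!: sm s0 tot.smooth_at_coord at_echart\<close>)
  qed (rule ct)
qed

definition vcomp :: "('b, 'e, 'n, 'm) bchart \<Rightarrow> 'e tvec \<Rightarrow> complex^'m" where
  "vcomp c v = (\<chi> \<gamma>. v (coord (echart E c) (Inr \<gamma>)))"

definition vvec :: "('b, 'e, 'n, 'm) bchart \<Rightarrow> 'e \<Rightarrow> complex^'m \<Rightarrow> 'e tvec" where
  "vvec c u b = (\<lambda>f. \<Sum>\<gamma>\<in>UNIV. b $ \<gamma> * evec E c (Inr \<gamma>) u f)"

lemma vcomp_transition:
  assumes c: "c \<in> bcharts E" and c': "c' \<in> bcharts E" and u: "u \<in> bdom E c" "u \<in> bdom E c'"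
    and v: "v \<in> tot.ctan u" "vertical_at u v"
  shows "vcomp c' v = tmat c c' (proj E u) *v vcomp c v"
  using v(2) c u tot.ctan_repr[OF v(1) at_echart[OF c u(1)] tot.smooth_at_coord[OF at_echart[OF c' u(2)]]]
  by (simp add: vcomp_def vec_eq_iff matrix_vector_mult_def vertical_at_def sum_UNIV_plus pd_fibre_coord[OF c c' u]
      tot.pdbar_coord[OF at_echart(1)[OF c u(1)] at_echart(1)[OF c' u(2)] at_echart(2)[OF c u(1)] at_echart(2)[OF c' u(2)]]
      mult.commute)

lemma vvec_transition:
  assumes c: "c \<in> bcharts E" and c': "c' \<in> bcharts E" and u: "u \<in> bdom E c" "u \<in> bdom E c'"
  shows "vvec c' u (tmat c c' (proj E u) *v b) = vvec c u b"
proof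
  fix f
  have "vvec c u b f = (\<Sum>\<alpha>\<in>UNIV. \<Sum>\<gamma>\<in>UNIV. b $ \<alpha> * (tmat c c' (proj E u) $ \<gamma> $ \<alpha> * evec E c' (Inr \<gamma>) u f))"
    by (simp add: vvec_def evec_transition[OF c c' u] sum_distrib_left)
  also have "\<dots> = (\<Sum>\<gamma>\<in>UNIV. \<Sum>\<alpha>\<in>UNIV. b $ \<alpha> * (tmat c c' (proj E u) $ \<gamma> $ \<alpha> * evec E c' (Inr \<gamma>) u f))"
    by (rule sum.swap)
  finally show "vvec c' u (tmat c c' (proj E u) *v b) f = vvec c u b f"
    by (simp add: vvec_def matrix_vector_mult_def sum_distrib_left ac_simps)
qed

lemma vvec_hol: "c \<in> bcharts E \<Longrightarrow> u \<in> bdom E c \<Longrightarrow> vvec c u b \<in> hol_tangent (eatlas E) u"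
  unfolding vvec_def by (intro tot.hol_tangent_sum tot.hol_tangent_scale evec_hol)

lemma vvec_coord:
  assumes "c \<in> bcharts E" "u \<in> bdom E c"
  shows "vvec c u b (coord (echart E c) (Inl k)) = 0" "vvec c u b (coord (echart E c) (Inr \<gamma>)) = b $ \<gamma>"
  by (simp_all add: vvec_def evec_coord[OF assms] if_distrib[of "\<lambda>x. _ * x"] cong: if_cong)

lemma vvec_linear: "vvec c u (r *s a + s *s b) = (\<lambda>f. r * vvec c u a f + s * vvec c u b f)"
  by (simp add: vvec_def sum_distrib_left sum.distrib[symmetric] algebra_simps)

lemma vvec_zero: "vvec c u 0 = (\<lambda>f. 0)"
  by (simp add: vvec_def)

lemma vvec_add: "vvec c u (a + b) = (\<lambda>f. vvec c u a f + vvec c u b f)"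
  using vvec_linear[of c u 1 a 1 b] by simp

text \<open>The (0,1)-part of a vector is the conjugate of the (1,0)-part of its conjugate.\<close>

lemma vertical_expand:
  assumes c: "c \<in> bcharts E" "u \<in> bdom E c" and v: "v \<in> tot.ctan u" "vertical_at u v"
  shows "v = (\<lambda>f. vvec c u (vcomp c v) f + conj_tv (vvec c u (vcomp c (conj_tv v))) f)"
proof (rule tot.ctan_eqI[OF v(1) _ at_echart[OF c]])
  note hol = vvec_hol[OF c]
  have cnj0: "vvec c u b (\<lambda>x. cnj (coord (echart E c) i x)) = 0" for b i
    using hol tot.hol_tangent_iff[OF at_echart[OF c]] by blast
  show "(\<lambda>f. vvec c u (vcomp c v) f + conj_tv (vvec c u (vcomp c (conj_tv v))) f) \<in> tot.ctan u"
    by (intro tot.ctan_add tot.ctan_conj tot.hol_tangent_ctan hol)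
  fix i
  show "v (coord (echart E c) i) = vvec c u (vcomp c v) (coord (echart E c) i) +
      conj_tv (vvec c u (vcomp c (conj_tv v))) (coord (echart E c) i)"
    using v(2) c by (cases i)
      (simp_all add: vertical_at_def vvec_coord[OF c] conj_tv_apply[of _ "coord _ _"] cnj0 vcomp_def)
  show "v (\<lambda>x. cnj (coord (echart E c) i x)) = vvec c u (vcomp c v) (\<lambda>x. cnj (coord (echart E c) i x)) +
      conj_tv (vvec c u (vcomp c (conj_tv v))) (\<lambda>x. cnj (coord (echart E c) i x))"
    using v(2) c by (cases i)
      (simp_all add: vertical_at_def vvec_coord[OF c] conj_tv_cnj conj_tv_apply[of _ "coord _ _"] cnj0 vcomp_def)
qed

lemma vertical_chart:
  assumes c: "c \<in> bcharts E" "u \<in> bdom E c" and v: "v \<in> tot.ctan u"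
    and z: "\<And>k. v (coord (echart E c) (Inl k)) = 0" "\<And>k. v (\<lambda>x. cnj (coord (echart E c) (Inl k) x)) = 0"
  shows "vertical_at u v"
  unfolding vertical_at_def
proof (intro ballI impI allI)
  fix c' k assume c': "c' \<in> bcharts E" "u \<in> bdom E c'"
  note s = tot.smooth_at_coord[OF at_echart[OF c']]
  note pb = tot.pdbar_coord[OF at_echart(1)[OF c] at_echart(1)[OF c'] at_echart(2)[OF c] at_echart(2)[OF c']]
  show "v (coord (echart E c') (Inl k)) = 0 \<and> v (\<lambda>x. cnj (coord (echart E c') (Inl k) x)) = 0"
    using tot.ctan_repr[OF v at_echart[OF c] s] tot.ctan_repr[OF v at_echart[OF c] tot.smooth_at_cnj[OF s]]
    by (simp add: sum_UNIV_plus z pb tot.pd_cnj[OF at_echart[OF c] s] pd_fibre_coord[OF c(1) c'(1) c(2) c'(2)])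
qed

definition chart_at :: "'e \<Rightarrow> ('b, 'e, 'n, 'm) bchart" where
  "chart_at u = (SOME c. c \<in> bcharts E \<and> u \<in> bdom E c)"

lemma chart_at: "chart_at u \<in> bcharts E" "u \<in> bdom E (chart_at u)"
proof -
  have "\<exists>c. c \<in> bcharts E \<and> u \<in> bdom E c" using bdom_bchart_ex by blast
  from someI_ex[OF this] show "chart_at u \<in> bcharts E" "u \<in> bdom E (chart_at u)"
    by (simp_all add: chart_at_def)
qed

end


section \<open>The vertical connection\<close>

context finsler_bundle
begin

text \<open>The (1,0)-part of the covariant derivative; the (0,1)-part is obtained by conjugation. It is
  computed in an arbitrarily chosen chart, which is harmless by \<open>vert_D_chart\<close>.\<close>

definition vert_D :: "('e \<Rightarrow> 'e tvec) \<Rightarrow> ('e \<Rightarrow> 'e tvec) \<Rightarrow> 'e \<Rightarrow> 'e tvec" where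
  "vert_D \<xi> \<eta> u =
     vvec (chart_at u) u (nabla (chart_at u) (\<xi> u) (\<lambda>x. vcomp (chart_at u) (\<eta> x)) u)"

definition vert_conn :: "'e vconnection" where
  "vert_conn W \<xi> \<eta> u = (\<lambda>f. vert_D \<xi> \<eta> u f + conj_tv (vert_D (\<lambda>x. conj_tv (\<xi> x)) (\<lambda>x. conj_tv (\<eta> x)) u) f)"

lemma smooth_vcomp:
  assumes "open W" "vertical_section E W \<eta>" "c \<in> bcharts E" "u \<in> W" "u \<in> bdom E c"
  shows "smooth_at (eatlas E) u (\<lambda>x. vcomp c (\<eta> x) $ \<alpha>)"
  using assms(2-5) unfolding vertical_section_iff[OF assms(1)] tangent_section_iff[OF assms(1)]
  by (simp add: vcomp_def)

lemma tangent_section_ctan: "open W \<Longrightarrow> tangent_section E W \<xi> \<Longrightarrow> u \<in> W \<Longrightarrow> \<xi> u \<in> tot.ctan u"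
  by (simp add: tangent_section_iff)

text \<open>The components of \<open>\<eta>\<close> and the fibre derivatives transform inversely to each other, and \<open>nabla\<close> respects the
  transformation of components.\<close>

lemma vert_D_chart:
  assumes W: "open W" "u \<in> W" "u \<in> slit E" and \<eta>: "vertical_section E W \<eta>" and \<xi>: "\<xi> u \<in> tot.ctan u"
    and c: "c \<in> bcharts E" "u \<in> bdom E c"
  shows "vert_D \<xi> \<eta> u = vvec c u (nabla c (\<xi> u) (\<lambda>x. vcomp c (\<eta> x)) u)"
proof -
  define d where "d = chart_at u"
  have d: "d \<in> bcharts E" "u \<in> bdom E d" using chart_at by (simp_all add: d_def)
  have op: "open (W \<inter> (bdom E d \<inter> bdom E c))" using W bdom_open c d by blast
  have "nabla c (\<xi> u) (\<lambda>x. vcomp c (\<eta> x)) u = tmat d c (proj E u) *v nabla d (\<xi> u) (\<lambda>x. vcomp d (\<eta> x)) u"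
    by (rule nabla_transition[OF d(1) c(1) d(2) c(2) W(3) \<xi> smooth_vcomp[OF W(1) \<eta> d(1) W(2) d(2)] op])
      (use W c d \<eta> in \<open>auto simp: vertical_section_iff tangent_section_iff intro!: vcomp_transition\<close>)
  then show ?thesis
    by (simp add: vert_D_def d_def[symmetric] vvec_transition[OF d(1) c(1) d(2) c(2)])
qed

lemma vert_D_cong:
  assumes W: "open W" "u \<in> W" "vertical_section E W \<eta>" "\<xi> u \<in> tot.ctan u"
    and "\<xi> u = \<xi>' u" "\<And>x. x \<in> W \<Longrightarrow> \<eta> x = \<eta>' x"
  shows "vert_D \<xi> \<eta> u = vert_D \<xi>' \<eta>' u"
proof -
  have "nabla (chart_at u) (\<xi> u) (\<lambda>x. vcomp (chart_at u) (\<eta> x)) u = nabla (chart_at u) (\<xi> u) (\<lambda>x. vcomp (chart_at u) (\<eta>' x)) u"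
    by (rule nabla_cong[OF W(4) smooth_vcomp[OF W(1,3) chart_at(1) W(2) chart_at(2)] W(1,2)]) (simp add: assms(6))
  then show ?thesis by (simp add: vert_D_def assms(5))
qed

lemma vert_D_lincomb:
  "vert_D (\<lambda>x f. r x * \<xi> x f + s x * \<xi>' x f) \<eta> u = (\<lambda>f. r u * vert_D \<xi> \<eta> u f + s u * vert_D \<xi>' \<eta> u f)"
  by (simp add: vert_D_def nabla_lincomb vvec_linear)

lemma vert_D_add:
  assumes "open W" "u \<in> W" "\<xi> u \<in> tot.ctan u" "vertical_section E W \<eta>" "vertical_section E W \<eta>'"
  shows "vert_D \<xi> (\<lambda>x f. \<eta> x f + \<eta>' x f) u = (\<lambda>f. vert_D \<xi> \<eta> u f + vert_D \<xi> \<eta>' u f)"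
proof -
  define c where "c = chart_at u"
  have c: "c \<in> bcharts E" "u \<in> bdom E c" using chart_at by (simp_all add: c_def)
  have "(\<lambda>x. vcomp c (\<lambda>f. \<eta> x f + \<eta>' x f)) = (\<lambda>x. vcomp c (\<eta> x) + vcomp c (\<eta>' x))"
    by (simp add: vcomp_def vec_eq_iff fun_eq_iff)
  then show ?thesis
    using nabla_add[OF assms(3) smooth_vcomp[OF assms(1,4) c(1) assms(2) c(2)] smooth_vcomp[OF assms(1,5) c(1) assms(2) c(2)], of c]
    by (simp add: vert_D_def c_def[symmetric] vvec_add)
qed

lemma vert_D_mult:
  assumes "open W" "u \<in> W" "\<xi> u \<in> tot.ctan u" "vertical_section E W \<eta>" "smooth_at (eatlas E) u g"
  shows "vert_D \<xi> (\<lambda>x f. g x * \<eta> x f) u = (\<lambda>f. g u * vert_D \<xi> \<eta> u f + \<xi> u g * vvec (chart_at u) u (vcomp (chart_at u) (\<eta> u)) f)"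
proof -
  define c where "c = chart_at u"
  have c: "c \<in> bcharts E" "u \<in> bdom E c" using chart_at by (simp_all add: c_def)
  have "(\<lambda>x. vcomp c (\<lambda>f. g x * \<eta> x f)) = (\<lambda>x. g x *s vcomp c (\<eta> x))"
    by (simp add: vcomp_def vec_eq_iff fun_eq_iff)
  then show ?thesis
    using nabla_mult[OF assms(3,5) smooth_vcomp[OF assms(1,4) c(1) assms(2) c(2)], of c]
    by (simp add: vert_D_def c_def[symmetric] vvec_linear)
qed

lemma vert_D_section:
  assumes W: "open W" "W \<subseteq> slit E" and \<xi>: "tangent_section E W \<xi>" and \<eta>: "vertical_section E W \<eta>"
  shows "vertical_section E W (vert_D \<xi> \<eta>)"
proof -
  have hol: "vert_D \<xi> \<eta> u \<in> hol_tangent (eatlas E) u" for u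
    unfolding vert_D_def by (rule vvec_hol[OF chart_at])
  have coord: "vert_D \<xi> \<eta> x (coord (echart E c) i) =
      (case i of Inl k \<Rightarrow> 0 | Inr \<gamma> \<Rightarrow> nabla c (\<xi> x) (\<lambda>x. vcomp c (\<eta> x)) x $ \<gamma>)"
    if "x \<in> W" "c \<in> bcharts E" "x \<in> bdom E c" for c x i
    using vert_D_chart[where \<xi> = \<xi>, OF W(1) that(1) _ \<eta> tangent_section_ctan[OF W(1) \<xi> that(1)] that(2,3)] that W(2)
    by (cases i) (auto simp: vvec_coord)
  have cnj0: "vert_D \<xi> \<eta> x (\<lambda>y. cnj (coord (echart E c) i y)) = 0" if "c \<in> bcharts E" "x \<in> bdom E c" for c x i
    using hol tot.hol_tangent_iff[OF at_echart[OF that]] by blast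
  have "smooth_at (eatlas E) u (\<lambda>x. vert_D \<xi> \<eta> x (coord (echart E c) i))"
    if c: "c \<in> bcharts E" and u: "u \<in> W \<inter> bdom E c" for c u i
  proof -
    have op: "open (W \<inter> bdom E c)" using W bdom_open c by blast
    have "smooth_at (eatlas E) u (\<lambda>x. nabla c (\<xi> x) (\<lambda>x. vcomp c (\<eta> x)) x $ \<gamma>)" for \<gamma>
      by (rule smooth_nabla[OF c op _ _ u])
        (use W c u \<xi> tangent_section_iff[OF W(1)] smooth_vcomp[OF W(1) \<eta> c] in auto)
    then have "smooth_at (eatlas E) u (\<lambda>x. case i of Inl k \<Rightarrow> 0 | Inr \<gamma> \<Rightarrow> nabla c (\<xi> x) (\<lambda>x. vcomp c (\<eta> x)) x $ \<gamma>)"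
      by (cases i) (simp_all add: tot.smooth_at_const)
    then show ?thesis by (rule tot.smooth_at_cong[OF _ op u]) (use coord c in auto)
  qed
  moreover have "smooth_at (eatlas E) u (\<lambda>x. vert_D \<xi> \<eta> x (\<lambda>y. cnj (coord (echart E c) i y)))"
    if c: "c \<in> bcharts E" and u: "u \<in> W \<inter> bdom E c" for c u i
    by (rule tot.smooth_at_cong[OF tot.smooth_at_const[of u 0], of "bdom E c"]) (use c u bdom_open cnj0 in auto)
  ultimately show ?thesis
    unfolding vertical_section_iff[OF W(1)] tangent_section_iff[OF W(1)] vertical_at_def
    using coord cnj0 tot.hol_tangent_ctan[OF hol] by auto
qed

lemma vertical_section_add:
  assumes W: "open W" and "vertical_section E W \<eta>" "vertical_section E W \<eta>'"
  shows "vertical_section E W (\<lambda>x f. \<eta> x f + \<eta>' x f)"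
  using assms(2,3) unfolding vertical_section_iff[OF W] tangent_section_iff[OF W] vertical_at_def
  by (auto intro!: tot.ctan_add tot.smooth_at_add)

lemma smooth_fun_at: "open W \<Longrightarrow> smooth_fun (eatlas E) W g \<Longrightarrow> u \<in> W \<Longrightarrow> smooth_at (eatlas E) u g"
  by (simp add: tot.smooth_fun_iff)

lemma vertical_connection_vert_conn: "vertical_connection E vert_conn"
  unfolding vertical_connection_def
proof (intro conjI allI impI ballI)
  fix W \<xi> \<eta> assume W: "open W" "W \<subseteq> slit E" and s: "tangent_section E W \<xi>" "vertical_section E W \<eta>"
  note s' = tangent_section_conj[OF W(1) s(1)] vertical_section_conj[OF W(1) s(2)]
  show "vertical_section E W (vert_conn W \<xi> \<eta>)"
    unfolding vert_conn_def
    by (rule vertical_section_add[OF W(1) vert_D_section[OF W s] vertical_section_conj[OF W(1) vert_D_section[OF W s']]])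
  fix u assume u: "u \<in> W"
  show "vert_conn W (\<lambda>x. conj_tv (\<xi> x)) (\<lambda>x. conj_tv (\<eta> x)) u = conj_tv (vert_conn W \<xi> \<eta> u)"
    by (simp add: vert_conn_def conj_tv_add conj_tv_conj add.commute)
  show "vert_conn W \<xi> (\<lambda>x f. r * \<eta> x f) u = (\<lambda>f. r * vert_conn W \<xi> \<eta> u f)" for r
    using vert_D_mult[where \<xi> = \<xi>, OF W(1) u tangent_section_ctan[OF W(1) s(1) u] s(2) tot.smooth_at_const[of u r]]
      vert_D_mult[where \<xi> = "\<lambda>x. conj_tv (\<xi> x)", OF W(1) u tangent_section_ctan[OF W(1) s'(1) u] s'(2) tot.smooth_at_const[of u "cnj r"]]
    by (simp add: vert_conn_def conj_tv_mult tot.ctan_const[OF tangent_section_ctan[OF W(1) s(1) u]]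
        tot.ctan_const[OF tangent_section_ctan[OF W(1) s'(1) u]] distrib_left)
  fix g assume g: "smooth_fun (eatlas E) W g"
  note gu = smooth_fun_at[OF W(1) g u]
  show "vert_conn W (\<lambda>x f. g x * \<xi> x f) \<eta> u = (\<lambda>f. g u * vert_conn W \<xi> \<eta> u f)"
    using vert_D_lincomb[of g \<xi> "\<lambda>_. 0" \<xi> \<eta> u]
      vert_D_lincomb[of "\<lambda>x. cnj (g x)" "\<lambda>x. conj_tv (\<xi> x)" "\<lambda>_. 0" "\<lambda>x. conj_tv (\<xi> x)" "\<lambda>x. conj_tv (\<eta> x)" u]
    by (simp add: vert_conn_def conj_tv_mult distrib_left)
  have v: "\<eta> u \<in> tot.ctan u" "vertical_at u (\<eta> u)"
    using s(2) u W(1) by (auto simp: vertical_section_iff tangent_section_iff)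
  have e: "\<eta> u f = vvec (chart_at u) u (vcomp (chart_at u) (\<eta> u)) f +
      conj_tv (vvec (chart_at u) u (vcomp (chart_at u) (conj_tv (\<eta> u)))) f" for f
    using vertical_expand[OF chart_at v] by metis
  show "vert_conn W \<xi> (\<lambda>x f. g x * \<eta> x f) u = (\<lambda>f. g u * vert_conn W \<xi> \<eta> u f + \<xi> u g * \<eta> u f)"
    by (rule ext) (simp add: vert_conn_def conj_tv_mult conj_tv_add conj_tv_cnj e distrib_left add_ac
        vert_D_mult[where \<xi> = \<xi>, OF W(1) u tangent_section_ctan[OF W(1) s(1) u] s(2) gu]
        vert_D_mult[where \<xi> = "\<lambda>x. conj_tv (\<xi> x)", OF W(1) u tangent_section_ctan[OF W(1) s'(1) u] s'(2) tot.smooth_at_cnj[OF gu]])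
next
  fix W W' \<xi> \<eta> \<xi>' \<eta>' u
  assume W: "open W" "W \<subseteq> slit E" "open W'" "W' \<subseteq> W" and s: "tangent_section E W \<xi>" "vertical_section E W \<eta>"
    and s': "tangent_section E W' \<xi>'" "vertical_section E W' \<eta>'"
    and eq: "\<forall>u\<in>W'. \<xi> u = \<xi>' u \<and> \<eta> u = \<eta>' u" and u: "u \<in> W'"
  note c = tangent_section_conj[OF W(3) s'(1)] vertical_section_conj[OF W(3) s'(2)]
  have "vert_D \<xi>' \<eta>' u = vert_D \<xi> \<eta> u"
    by (rule vert_D_cong[where \<xi> = \<xi>', OF W(3) u s'(2) tangent_section_ctan[OF W(3) s'(1) u]]) (use eq u in auto)
  moreover have "vert_D (\<lambda>x. conj_tv (\<xi>' x)) (\<lambda>x. conj_tv (\<eta>' x)) u = vert_D (\<lambda>x. conj_tv (\<xi> x)) (\<lambda>x. conj_tv (\<eta> x)) u"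
    by (rule vert_D_cong[where \<xi> = "\<lambda>x. conj_tv (\<xi>' x)", OF W(3) u c(2) tangent_section_ctan[OF W(3) c(1) u]]) (use eq u in auto)
  ultimately show "vert_conn W \<xi> \<eta> u = vert_conn W' \<xi>' \<eta>' u" by (simp add: vert_conn_def)
next
  fix W \<xi> \<xi>' \<eta> u
  assume W: "open W" "W \<subseteq> slit E" and s: "tangent_section E W \<xi>" "tangent_section E W \<xi>'" "vertical_section E W \<eta>"
    and u: "u \<in> W"
  show "vert_conn W (\<lambda>x f. \<xi> x f + \<xi>' x f) \<eta> u = (\<lambda>f. vert_conn W \<xi> \<eta> u f + vert_conn W \<xi>' \<eta> u f)"
    using vert_D_lincomb[of "\<lambda>_. 1" \<xi> "\<lambda>_. 1" \<xi>' \<eta> u]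
      vert_D_lincomb[of "\<lambda>_. 1" "\<lambda>x. conj_tv (\<xi> x)" "\<lambda>_. 1" "\<lambda>x. conj_tv (\<xi>' x)" "\<lambda>x. conj_tv (\<eta> x)" u]
    by (simp add: vert_conn_def conj_tv_add add_ac)
next
  fix W \<xi> \<eta> \<eta>' u
  assume W: "open W" "W \<subseteq> slit E" and s: "tangent_section E W \<xi>" "vertical_section E W \<eta>" "vertical_section E W \<eta>'"
    and u: "u \<in> W"
  show "vert_conn W \<xi> (\<lambda>x f. \<eta> x f + \<eta>' x f) u = (\<lambda>f. vert_conn W \<xi> \<eta> u f + vert_conn W \<xi> \<eta>' u f)"
    using vert_D_add[where \<xi> = \<xi>, OF W(1) u tangent_section_ctan[OF W(1) s(1) u] s(2,3)]
      vert_D_add[where \<xi> = "\<lambda>x. conj_tv (\<xi> x)", OF W(1) u tangent_section_ctan[OF W(1) tangent_section_conj[OF W(1) s(1)] u]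
        vertical_section_conj[OF W(1) s(2)] vertical_section_conj[OF W(1) s(3)]]
    by (simp add: vert_conn_def conj_tv_add add_ac)
qed

lemma evec_section:
  assumes c: "c \<in> bcharts E"
  shows "vertical_section E (slit E \<inter> bdom E c) (evec E c (Inr \<alpha>))"
proof -
  have W: "open (slit E \<inter> bdom E c)" using slit_open bdom_open c by blast
  have "tangent_section E (slit E \<inter> bdom E c) (evec E c (Inr \<alpha>))"
  proof (rule hol_field_section[OF W _ c])
    fix u i assume u: "u \<in> slit E \<inter> bdom E c"
    then show "evec E c (Inr \<alpha>) u \<in> hol_tangent (eatlas E) u" using evec_hol c by blast
    show "smooth_at (eatlas E) u (\<lambda>x. evec E c (Inr \<alpha>) x (coord (echart E c) i))"
      by (rule tot.smooth_at_cong[OF tot.smooth_at_const W u]) (use evec_coord[OF c] in auto)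
  qed simp
  moreover have "vertical_at u (evec E c (Inr \<alpha>) u)" if "u \<in> slit E \<inter> bdom E c" for u
    using that c by (intro vertical_chart[OF c] tot.hol_tangent_ctan evec_hol) (auto simp: evec_coord evec_cnj_coord)
  ultimately show ?thesis by (simp add: vertical_section_iff[OF W])
qed

text \<open>The components of the frame are constant, so only the connection form contributes, evaluated on the
  (1,0)-part of the field: this is the field itself for \<open>\<xi>\<close>, and 0 for its conjugate.\<close>

lemma vert_conn_frame:
  assumes c: "c \<in> bcharts E" "u \<in> bdom E c" "u \<in> slit E" and \<xi>: "\<xi> u \<in> hol_tangent (eatlas E) u"
  shows "vert_conn W \<xi> (evec E c (Inr \<alpha>)) u =
      (\<lambda>f. \<Sum>\<gamma>\<in>UNIV. (\<Sum>\<sigma>\<in>UNIV. hinv E F c \<sigma> \<gamma> u * \<xi> u (hmet E F c \<alpha> \<sigma>)) * evec E c (Inr \<gamma>) u f)"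
    and "vert_conn W \<xi> (\<lambda>x. conj_tv (evec E c (Inr \<alpha>) x)) u = (\<lambda>f. 0)"
proof -
  let ?W = "slit E \<inter> bdom E c" and ?e = "evec E c (Inr \<alpha>)"
  have W: "open ?W" "u \<in> ?W" using slit_open bdom_open[OF c(1)] c by auto
  note ct = tot.hol_tangent_ctan[OF \<xi>]
  note ct' = tot.ctan_conj[OF ct]
  note e = evec_section[OF c(1), of \<alpha>]
  note e' = vertical_section_conj[OF W(1) e]
  have comp: "\<forall>x\<in>?W. vcomp c (?e x) = axis \<alpha> 1" "\<forall>x\<in>?W. vcomp c (conj_tv (?e x)) = 0"
    by (auto simp: vcomp_def vec_eq_iff axis_def evec_coord[OF c(1)] conj_tv_apply evec_cnj_coord[OF c(1)])
  have p: "tot.part10 (echart E c) u (\<xi> u) = \<xi> u" "tot.part10 (echart E c) u (conj_tv (\<xi> u)) = (\<lambda>f. 0)"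
    using tot.part10_of_hol[OF \<xi> at_echart[OF c(1,2)]] tot.part10_conj[OF \<xi> at_echart[OF c(1,2)]] by auto
  have 1: "vert_D \<xi> ?e u = (\<lambda>f. \<Sum>\<gamma>\<in>UNIV. (\<Sum>\<sigma>\<in>UNIV. hinv E F c \<sigma> \<gamma> u * \<xi> u (hmet E F c \<alpha> \<sigma>)) * evec E c (Inr \<gamma>) u f)"
    unfolding vert_D_chart[where \<xi> = \<xi>, OF W c(3) e ct c(1,2)] nabla_const[where b = "\<lambda>x. vcomp c (?e x)", OF ct W comp(1)]
    by (simp add: vvec_def p axis_def if_distrib[of "\<lambda>x. x * _"] cong: if_cong)
  have 2: "vert_D (\<lambda>x. conj_tv (\<xi> x)) (\<lambda>x. conj_tv (?e x)) u = (\<lambda>f. 0)"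
    unfolding vert_D_chart[where \<xi> = "\<lambda>x. conj_tv (\<xi> x)", OF W c(3) e' ct' c(1,2)]
      nabla_const[where b = "\<lambda>x. vcomp c (conj_tv (?e x))", OF ct' W comp(2)]
    by (simp add: vvec_def)
  have 3: "vert_D \<xi> (\<lambda>x. conj_tv (?e x)) u = (\<lambda>f. 0)"
    unfolding vert_D_chart[where \<xi> = \<xi>, OF W c(3) e' ct c(1,2)]
      nabla_const[where b = "\<lambda>x. vcomp c (conj_tv (?e x))", OF ct W comp(2)]
    by (simp add: vvec_def)
  have 4: "vert_D (\<lambda>x. conj_tv (\<xi> x)) ?e u = (\<lambda>f. 0)"
    unfolding vert_D_chart[where \<xi> = "\<lambda>x. conj_tv (\<xi> x)", OF W c(3) e ct' c(1,2)]
      nabla_const[where b = "\<lambda>x. vcomp c (?e x)", OF ct' W comp(1)]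
    by (simp add: vvec_def p)
  show "vert_conn W \<xi> ?e u =
      (\<lambda>f. \<Sum>\<gamma>\<in>UNIV. (\<Sum>\<sigma>\<in>UNIV. hinv E F c \<sigma> \<gamma> u * \<xi> u (hmet E F c \<alpha> \<sigma>)) * evec E c (Inr \<gamma>) u f)"
    by (simp add: vert_conn_def 1 2 conj_tv_zero)
  show "vert_conn W \<xi> (\<lambda>x. conj_tv (?e x)) u = (\<lambda>f. 0)"
    by (simp add: vert_conn_def 3 4 conj_tv_zero conj_tv_conj)
qed

lemma vertical_coeffs_vert_conn:
  assumes c: "c \<in> bcharts E"
  shows "vertical_coeffs E (cfN E F) vert_conn c (cfLk E F c) (cfC E F c)"
  unfolding vertical_coeffs_def Let_def cfLk_def cfC_def
  using vert_conn_frame[OF c] deltak_hol[OF c] evec_hol[OF c] by simp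

end

section \<open>The prolongation in adapted frames\<close>

locale finsler_algebroid = finsler_bundle E F
  for E :: "('b::topological_space, 'e::topological_space, 'n::finite, 'm::finite) algebroid" and F +
  assumes anchor: "holomorphic_anchor E"
begin

lemma anchor_hol: "anchor E e \<in> hol_tangent (atlas E) (proj E e)"
  and anchor_vadd: "proj E e = proj E e' \<Longrightarrow> anchor E (vadd E e e') = (\<lambda>f. anchor E e f + anchor E e' f)"
  and anchor_vscale: "anchor E (vscale E r e) = (\<lambda>f. r * anchor E e f)"
  using anchor unfolding holomorphic_anchor_def by simp_all

lemma rho_holo: "c \<in> bcharts E \<Longrightarrow> holo_fun (atlas E) (base_dom c) (rho E c k \<alpha>)"
  using anchor unfolding holomorphic_anchor_def by blast

lemma smooth_rho:
  assumes "c \<in> bcharts E" "u \<in> bdom E c"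
  shows "smooth_at (eatlas E) u (\<lambda>x. rho E c k \<alpha> (proj E x))"
proof -
  have "proj E u \<in> base_dom c" using assms(2) by (simp add: bdom_def)
  then have "base.holo_at (proj E u) (rho E c k \<alpha>)"
    by (rule base.holo_fun_holo_at[OF rho_holo[OF assms(1)] base_dom_open[OF assms(1)]])
  then show ?thesis by (intro tot_smooth_pullback) (simp add: base.holo_at_def)
qed

lemma chart_triv:
  assumes "c \<in> bcharts E" "u \<in> bdom E c"
  shows "snd c \<in> trivs E" "proj E u \<in> fst (snd c)" "fst c \<in> atlas E" "proj E u \<in> fst (fst c)"
  using assms by (simp_all add: bcharts_iff bdom_iff)

lemma lift_vadd:
  assumes "t \<in> trivs E" "x \<in> fst t"
  shows "lift t x (a + b) = vadd E (lift t x a) (lift t x b)"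
proof (rule triv_eqI[OF assms(1)])
  note l = lift_props[OF assms]
  have p: "proj E (vadd E (lift t x a) (lift t x b)) = x" using proj_vadd l(1) by metis
  show "proj E (lift t x (a + b)) = proj E (vadd E (lift t x a) (lift t x b))" using p l(1) by simp
  show "snd t (lift t x (a + b)) = snd t (vadd E (lift t x a) (lift t x b))"
    using triv_vadd[OF assms(1), of "lift t x a" "lift t x b"] l assms(2) by simp
qed (simp add: lift_props[OF assms] assms(2))

lemma lift_vscale:
  assumes "t \<in> trivs E" "x \<in> fst t"
  shows "lift t x (r *s a) = vscale E r (lift t x a)"
  by (rule triv_eqI[OF assms(1)]) (simp_all add: lift_props[OF assms] assms proj_vscale triv_vscale)

text \<open>The anchor is only known to be additive and homogeneous on each fibre; the fibre coordinates identify the fibre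
  with \<open>\<complex>\<^sup>m\<close>, where this is linearity.\<close>

lemma anchor_expand:
  assumes c: "c \<in> bcharts E" "u \<in> bdom E c" and e: "proj E e = proj E u"
  shows "anchor E e (coord (fst c) k) = (\<Sum>\<alpha>\<in>UNIV. snd (snd c) e $ \<alpha> * rho E c k \<alpha> (proj E u))"
proof -
  note t = chart_triv(1,2)[OF c]
  define g where "g a = anchor E (lift (snd c) (proj E u) a) (coord (fst c) k)" for a
  have g_add: "g (a + b) = g a + g b" for a b
    by (simp add: g_def lift_vadd[OF t] anchor_vadd lift_props[OF t])
  have g_scale: "g (r *s a) = r * g a" for r a
    by (simp add: g_def lift_vscale[OF t] anchor_vscale)
  have g_sum: "g (\<Sum>\<alpha>\<in>I. f \<alpha>) = (\<Sum>\<alpha>\<in>I. g (f \<alpha>))" if "finite I" for I :: "'m set" and f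
    using that by (induction I rule: finite_induct) (use g_scale[of 0] in \<open>simp_all add: g_add\<close>)
  have "(\<lambda>y. snd (fst c) y $ k) = coord (fst c) k" by (simp add: coord_def fun_eq_iff)
  then have rho: "rho E c k \<alpha> (proj E u) = g (axis \<alpha> 1)" for \<alpha>
    by (simp add: rho_def frame_lift g_def)
  have "snd (snd c) e = (\<Sum>\<alpha>\<in>UNIV. snd (snd c) e $ \<alpha> *s axis \<alpha> 1)"
    by (simp add: vec_eq_iff axis_def if_distrib[of "\<lambda>x. _ * x"] cong: if_cong)
  then have "g (snd (snd c) e) = g (\<Sum>\<alpha>\<in>UNIV. snd (snd c) e $ \<alpha> *s axis \<alpha> 1)" by (rule arg_cong)
  also have "\<dots> = (\<Sum>\<alpha>\<in>UNIV. snd (snd c) e $ \<alpha> * g (axis \<alpha> 1))" by (simp add: g_sum g_scale)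
  finally show ?thesis
    using lift_unique[OF t(1), of e] t(2) e by (simp add: g_def rho)
qed

lemma pushfwd_hol:
  assumes v: "v \<in> hol_tangent (eatlas E) u"
  shows "pushfwd E u v \<in> hol_tangent (atlas E) (proj E u)"
proof -
  define c where "c = chart_at u"
  have c: "c \<in> bcharts E" "u \<in> bdom E c" using chart_at by (simp_all add: c_def)
  note b = chart_triv(3,4)[OF c]
  have v_pull: "v (f \<circ> proj E) = (\<Sum>k\<in>UNIV. v (coord (echart E c) (Inl k)) * pd (fst c) k f (proj E u))"
    if "smooth_at (atlas E) (proj E u) f" for f
    using tot.hol_tangent_repr[OF v at_echart[OF c] tot_smooth_pullback[OF that]] pullback(2,3)[OF c that]
    by (simp add: sum_UNIV_plus o_def)
  show ?thesis
    unfolding base.hol_tangent_iff[OF b]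
  proof (intro conjI allI)
    show "pushfwd E u v \<in> base.ctan (proj E u)"
      by (rule base.ctanI[OF b, where a = "\<lambda>k. v (coord (echart E c) (Inl k))" and b = "\<lambda>_. 0"])
        (simp_all add: pushfwd_def v_pull)
    show "pushfwd E u v (\<lambda>x. cnj (coord (fst c) i x)) = 0" for i
      using base.smooth_at_coord[OF b, of i]
      by (simp add: pushfwd_def v_pull base.smooth_at_cnj base.pd_cnj[OF b] base.pd_coord[OF b])
  qed
qed

text \<open>Both sides of the condition \<open>\<rho>(e) = \<pi>\<^sub>*(v)\<close> are vectors of type (1,0) on the base, so it can be tested on the
  base coordinates.\<close>

lemma prol_iff:
  assumes c: "c \<in> bcharts E" "u \<in> bdom E c"
  shows "p \<in> prol E u \<longleftrightarrow> proj E (fst p) = proj E u \<and> snd p \<in> hol_tangent (eatlas E) u \<and>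
    (\<forall>k. snd p (coord (echart E c) (Inl k)) = (\<Sum>\<alpha>\<in>UNIV. snd (snd c) (fst p) $ \<alpha> * rho E c k \<alpha> (proj E u)))"
proof -
  note b = chart_triv(3,4)[OF c]
  have push: "pushfwd E u v (coord (fst c) k) = v (coord (echart E c) (Inl k))" for v k
  proof -
    have "coord (fst c) k \<circ> proj E = coord (echart E c) (Inl k)" by (simp add: coord_echart fun_eq_iff)
    then show ?thesis by (simp add: pushfwd_def base.smooth_at_coord[OF b])
  qed
  have "anchor E e = pushfwd E u v \<longleftrightarrow>
      (\<forall>k. v (coord (echart E c) (Inl k)) = (\<Sum>\<alpha>\<in>UNIV. snd (snd c) e $ \<alpha> * rho E c k \<alpha> (proj E u)))"
    if "proj E e = proj E u" "v \<in> hol_tangent (eatlas E) u" for e v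
    unfolding anchor_expand[OF c that(1), symmetric] push[symmetric]
    using base.hol_tangent_eqI[OF anchor_hol[of e, unfolded that(1)] pushfwd_hol[OF that(2)] b] by metis
  then show ?thesis by (cases p) (auto simp: prol_def)
qed

lemma prol_hol: "p \<in> prol E u \<Longrightarrow> snd p \<in> hol_tangent (eatlas E) u"
  and prol_proj: "p \<in> prol E u \<Longrightarrow> proj E (fst p) = proj E u"
  by (auto simp: prol_def)

text \<open>For an element \<open>(e, v)\<close> of the prolongation, the components along the \<open>\<X>\<^sub>\<alpha>\<close> are the fibre coordinates
  of \<open>e\<close>, since the \<open>\<V>\<^sub>\<alpha>\<close> have first entry 0; the components along the \<open>\<V>\<^sub>\<alpha>\<close> are \<open>vert c u v\<close>. The
  element with given components is \<open>adapted c u a b\<close>.\<close>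

definition hcomp :: "('b, 'e, 'n, 'm) bchart \<Rightarrow> 'e pvec \<Rightarrow> complex^'m" where
  "hcomp c p = snd (snd c) (fst p)"

definition adapted :: "('b, 'e, 'n, 'm) bchart \<Rightarrow> 'e \<Rightarrow> complex^'m \<Rightarrow> complex^'m \<Rightarrow> 'e pvec" where
  "adapted c u a b = (lift (snd c) (proj E u) a,
     \<lambda>f. (\<Sum>k\<in>UNIV. (\<Sum>\<alpha>\<in>UNIV. a $ \<alpha> * rho E c k \<alpha> (proj E u)) * deltak E (cfN E F) c k u f) + vvec c u b f)"

lemma prol_base_coord:
  assumes "c \<in> bcharts E" "u \<in> bdom E c" "p \<in> prol E u"
  shows "snd p (coord (echart E c) (Inl k)) = (\<Sum>\<alpha>\<in>UNIV. hcomp c p $ \<alpha> * rho E c k \<alpha> (proj E u))"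
  using assms prol_iff unfolding hcomp_def by blast

lemma prol_fibre_coord:
  assumes "c \<in> bcharts E" "u \<in> bdom E c" "p \<in> prol E u"
  shows "snd p (coord (echart E c) (Inr \<beta>)) = vert c u (snd p) $ \<beta> -
    (\<Sum>k\<in>UNIV. cfN E F c k \<beta> u * (\<Sum>\<alpha>\<in>UNIV. hcomp c p $ \<alpha> * rho E c k \<alpha> (proj E u)))"
  by (simp add: vert_def prol_base_coord[OF assms])

lemma adapted_props:
  assumes c: "c \<in> bcharts E" "u \<in> bdom E c"
  shows "adapted c u a b \<in> prol E u" "hcomp c (adapted c u a b) = a" "vert c u (snd (adapted c u a b)) = b"
proof -
  let ?v = "snd (adapted c u a b)"
  note l = lift_props[OF chart_triv(1,2)[OF c]]
  have hol: "?v \<in> hol_tangent (eatlas E) u"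
    unfolding adapted_def snd_conv
    by (intro tot.hol_tangent_add tot.hol_tangent_sum tot.hol_tangent_scale deltak_hol vvec_hol c)
  have base: "?v (coord (echart E c) (Inl k)) = (\<Sum>\<alpha>\<in>UNIV. a $ \<alpha> * rho E c k \<alpha> (proj E u))" for k
    by (simp add: adapted_def deltak_coord[OF c] vvec_coord[OF c] if_distrib[of "\<lambda>x. _ * x"] cong: if_cong)
  show "hcomp c (adapted c u a b) = a" by (simp add: hcomp_def adapted_def l)
  then show "adapted c u a b \<in> prol E u"
    unfolding prol_iff[OF c] hcomp_def using hol base by (simp add: adapted_def l)
  show "vert c u ?v = b"
    unfolding vert_def base by (simp add: adapted_def deltak_coord[OF c] vvec_coord[OF c] vec_eq_iff sum_negf mult.commute)
qed

lemma prol_eqI: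
  assumes c: "c \<in> bcharts E" "u \<in> bdom E c" and p: "p \<in> prol E u" "q \<in> prol E u"
    and "hcomp c p = hcomp c q" "vert c u (snd p) = vert c u (snd q)"
  shows "p = q"
proof (rule prod_eqI)
  show "fst p = fst q"
    by (rule triv_eqI[OF chart_triv(1)[OF c]])
      (use assms(5) prol_proj[OF p(1)] prol_proj[OF p(2)] chart_triv(2)[OF c] in \<open>auto simp: hcomp_def\<close>)
  show "snd p = snd q"
  proof (rule tot.hol_tangent_eqI[OF prol_hol[OF p(1)] prol_hol[OF p(2)] at_echart[OF c]])
    show "snd p (coord (echart E c) i) = snd q (coord (echart E c) i)" for i
      by (cases i) (simp_all add: prol_base_coord[OF c] prol_fibre_coord[OF c] p assms(5,6))
  qed
qed

lemma adapted_expand: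
  assumes "c \<in> bcharts E" "u \<in> bdom E c" "p \<in> prol E u"
  shows "adapted c u (hcomp c p) (vert c u (snd p)) = p"
  by (rule prol_eqI[OF assms(1,2)]) (simp_all add: adapted_props[OF assms(1,2)] assms(3))

lemma hcomp_transition:
  assumes "c \<in> bcharts E" "c' \<in> bcharts E" "u \<in> bdom E c" "u \<in> bdom E c'" "p \<in> prol E u"
  shows "hcomp c' p = tmat c c' (proj E u) *v hcomp c p"
  unfolding hcomp_def by (rule tmat_apply[OF assms(1-4) prol_proj[OF assms(5)]])

text \<open>Both kinds of components transform with the same matrix, so the adapted frames transform with its inverse.\<close>

lemma adapted_transition:
  assumes c: "c \<in> bcharts E" and c': "c' \<in> bcharts E" and u: "u \<in> bdom E c" "u \<in> bdom E c'" "u \<in> slit E"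
  shows "adapted c' u (tmat c c' (proj E u) *v a) (tmat c c' (proj E u) *v b) = adapted c u a b"
proof -
  note p = adapted_props[OF c u(1), of a b]
  show ?thesis
    using adapted_expand[OF c' u(2) p(1)] hcomp_transition[OF c c' u(1,2) p(1)] vert_transition[OF c c' u prol_hol[OF p(1)]] p
    by simp
qed

text \<open>The defining condition of \<^const>\<open>fsum\<close> refers to all trivializations; the sum formed in one of them satisfies
  it in the others because transitions are linear on fibres.\<close>

lemma fsum_props:
  assumes t: "t \<in> trivs E" "x \<in> fst t" and g: "\<And>i. proj E (g i) = x"
  shows "proj E (fsum E x g) = x" "snd t (fsum E x g) = (\<Sum>i\<in>UNIV. snd t (g i))"
proof -
  define e where "e = lift t x (\<Sum>i\<in>UNIV. snd t (g i))"
  have e: "proj E e = x" "snd t e = (\<Sum>i\<in>UNIV. snd t (g i))" using lift_props[OF t] by (simp_all add: e_def)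
  have all: "snd t' e = (\<Sum>i\<in>UNIV. snd t' (g i))" if t': "t' \<in> trivs E" "x \<in> fst t'" for t'
  proof -
    obtain M :: "'b \<Rightarrow> complex^'m^'m"
      where "\<And>\<alpha> \<beta>. holo_fun (atlas E) (fst t \<inter> fst t') (\<lambda>x. M x $ \<alpha> $ \<beta>)"
        and M: "\<And>e. proj E e \<in> fst t \<inter> fst t' \<Longrightarrow> snd t' e = M (proj E e) *v snd t e"
      by (rule triv_transition[OF t(1) t'(1)], rule that)
    have lin: "M x *v (\<Sum>i\<in>UNIV. snd t (g i)) = (\<Sum>i\<in>UNIV. M x *v snd t (g i))"
      by (rule linear_sum[OF matrix_vector_mul_linear])
    have "snd t' e = M x *v snd t e" "snd t' (g i) = M x *v snd t (g i)" for i
      using M[of e] M[of "g i"] e(1) g[of i] t(2) t'(2) by simp_all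
    then show ?thesis using lin e(2) by (simp only:)
  qed
  have "fsum E x g = e"
    unfolding fsum_def
  proof (rule the_equality)
    show "proj E e = x \<and> (\<forall>(V, \<Phi>)\<in>trivs E. x \<in> V \<longrightarrow> \<Phi> e = (\<Sum>i\<in>UNIV. \<Phi> (g i)))"
      using e all unfolding case_prod_beta by blast
    fix e' assume "proj E e' = x \<and> (\<forall>(V, \<Phi>)\<in>trivs E. x \<in> V \<longrightarrow> \<Phi> e' = (\<Sum>i\<in>UNIV. \<Phi> (g i)))"
    then have "proj E e' = x" "snd t e' = snd t e" using t e unfolding case_prod_beta by auto
    then show "e' = e" using triv_eqI[OF t(1), of e' e] e t by simp
  qed
  then show "proj E (fsum E x g) = x" "snd t (fsum E x g) = (\<Sum>i\<in>UNIV. snd t (g i))" using e by auto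
qed

lemma vert_lincomb: "vert c u (\<lambda>f. r * v f + s * w f) = r *s vert c u v + s *s vert c u w"
  by (simp add: vert_def vec_eq_iff sum_distrib_left sum.distrib[symmetric] algebra_simps)

lemma vert_sum: "vert c u (\<lambda>f. \<Sum>i\<in>I. v i f) = (\<Sum>i\<in>I. vert c u (v i))"
proof (induction I rule: infinite_finite_induct)
  case (insert i I)
  then show ?case using vert_lincomb[of c u 1 "v i" 1 "\<lambda>f. \<Sum>i\<in>I. v i f"] by simp
qed (simp_all add: vert_def vec_eq_iff)

lemma padd_props:
  assumes c: "c \<in> bcharts E" "u \<in> bdom E c" and p: "p \<in> prol E u" "q \<in> prol E u"
  shows "padd E p q \<in> prol E u" "hcomp c (padd E p q) = hcomp c p + hcomp c q"
    "vert c u (snd (padd E p q)) = vert c u (snd p) + vert c u (snd q)"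
proof -
  have pr: "proj E (fst p) = proj E (fst q)" using prol_proj[OF p(1)] prol_proj[OF p(2)] by simp
  show h: "hcomp c (padd E p q) = hcomp c p + hcomp c q"
    using triv_vadd[OF chart_triv(1)[OF c] _ pr] chart_triv(2)[OF c] prol_proj[OF p(1)]
    by (simp add: hcomp_def padd_def)
  show "padd E p q \<in> prol E u"
    unfolding prol_iff[OF c] hcomp_def[symmetric] h
    using proj_vadd[OF pr] prol_proj[OF p(1)]
    by (simp add: padd_def tot.hol_tangent_add prol_hol p prol_base_coord[OF c] sum.distrib algebra_simps)
  show "vert c u (snd (padd E p q)) = vert c u (snd p) + vert c u (snd q)"
    using vert_lincomb[of c u 1 "snd p" 1 "snd q"] by (simp add: padd_def)
qed

lemma pscl_props:
  assumes c: "c \<in> bcharts E" "u \<in> bdom E c" and p: "p \<in> prol E u"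
  shows "pscl E r p \<in> prol E u" "hcomp c (pscl E r p) = r *s hcomp c p"
    "vert c u (snd (pscl E r p)) = r *s vert c u (snd p)"
proof -
  show h: "hcomp c (pscl E r p) = r *s hcomp c p"
    using triv_vscale[OF chart_triv(1)[OF c]] chart_triv(2)[OF c] prol_proj[OF p]
    by (simp add: hcomp_def pscl_def)
  show "pscl E r p \<in> prol E u"
    unfolding prol_iff[OF c] hcomp_def[symmetric] h
    using prol_proj[OF p]
    by (simp add: pscl_def proj_vscale tot.hol_tangent_scale prol_hol p prol_base_coord[OF c] sum_distrib_left algebra_simps)
  show "vert c u (snd (pscl E r p)) = r *s vert c u (snd p)"
    using vert_lincomb[of c u r "snd p" 0 "snd p"] by (simp add: pscl_def)
qed

lemma pzero_props:
  assumes c: "c \<in> bcharts E" "u \<in> bdom E c"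
  shows "pzero E u \<in> prol E u" "hcomp c (pzero E u) = 0" "vert c u (snd (pzero E u)) = 0"
proof -
  show h: "hcomp c (pzero E u) = 0"
    using triv_vscale[OF chart_triv(1)[OF c]] chart_triv(2)[OF c] by (simp add: hcomp_def pzero_def)
  show "pzero E u \<in> prol E u"
    unfolding prol_iff[OF c] hcomp_def[symmetric] h by (simp add: pzero_def proj_vscale tot.hol_tangent_zero)
  show "vert c u (snd (pzero E u)) = 0" by (simp add: vert_def pzero_def vec_eq_iff)
qed

lemma psum_props:
  assumes c: "c \<in> bcharts E" "u \<in> bdom E c" and p: "\<And>i. p i \<in> prol E u"
  shows "psum E u p \<in> prol E u" "hcomp c (psum E u p) = (\<Sum>i\<in>UNIV. hcomp c (p i))"
    "vert c u (snd (psum E u p)) = (\<Sum>i\<in>UNIV. vert c u (snd (p i)))"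
proof -
  note f = fsum_props[OF chart_triv(1,2)[OF c], of "\<lambda>i. fst (p i)", OF prol_proj[OF p]]
  show h: "hcomp c (psum E u p) = (\<Sum>i\<in>UNIV. hcomp c (p i))"
    by (simp add: hcomp_def psum_def f)
  have "(\<Sum>i\<in>UNIV. \<Sum>\<alpha>\<in>UNIV. hcomp c (p i) $ \<alpha> * rho E c k \<alpha> (proj E u)) =
      (\<Sum>\<alpha>\<in>UNIV. \<Sum>i\<in>UNIV. hcomp c (p i) $ \<alpha> * rho E c k \<alpha> (proj E u))" for k
    by (rule sum.swap)
  then show "psum E u p \<in> prol E u"
    unfolding prol_iff[OF c] hcomp_def[symmetric] h
    by (simp add: psum_def f tot.hol_tangent_sum prol_hol p prol_base_coord[OF c] sum_distrib_right)
  show "vert c u (snd (psum E u p)) = (\<Sum>i\<in>UNIV. vert c u (snd (p i)))"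
    by (simp add: psum_def vert_sum)
qed

lemma adapted_lincomb:
  assumes c: "c \<in> bcharts E" "u \<in> bdom E c"
  shows "adapted c u (r *s a + s *s a') (r *s b + s *s b') =
    padd E (pscl E r (adapted c u a b)) (pscl E s (adapted c u a' b'))"
  by (rule prol_eqI[OF c]) (simp_all add: adapted_props[OF c] padd_props[OF c] pscl_props[OF c])

lemma adapted_add:
  assumes c: "c \<in> bcharts E" "u \<in> bdom E c"
  shows "adapted c u (a + a') (b + b') = padd E (adapted c u a b) (adapted c u a' b')"
  by (rule prol_eqI[OF c]) (simp_all add: adapted_props[OF c] padd_props[OF c])

lemma adapted_scale:
  assumes c: "c \<in> bcharts E" "u \<in> bdom E c"
  shows "adapted c u (r *s a) (r *s b) = pscl E r (adapted c u a b)"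
  by (rule prol_eqI[OF c]) (simp_all add: adapted_props[OF c] pscl_props[OF c])

lemma adapted_zero:
  assumes c: "c \<in> bcharts E" "u \<in> bdom E c"
  shows "adapted c u 0 0 = pzero E u"
  by (rule prol_eqI[OF c]) (simp_all add: adapted_props[OF c] pzero_props[OF c])

lemma axis_sum: "(\<Sum>\<gamma>\<in>UNIV. r \<gamma> *s axis \<gamma> (1::complex)) = (\<chi> \<gamma>. r \<gamma>)"
  by (simp add: vec_eq_iff axis_def if_distrib[of "\<lambda>x. _ * x"] cong: if_cong)

lemma psum_adapted:
  assumes c: "c \<in> bcharts E" "u \<in> bdom E c"
  shows "psum E u (\<lambda>\<gamma>. pscl E (r \<gamma>) (adapted c u (axis \<gamma> 1) 0)) = adapted c u (\<chi> \<gamma>. r \<gamma>) 0"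
    "psum E u (\<lambda>\<gamma>. pscl E (r \<gamma>) (adapted c u 0 (axis \<gamma> 1))) = adapted c u 0 (\<chi> \<gamma>. r \<gamma>)"
    "psum E u (\<lambda>\<gamma>. pscl E (r \<gamma>) (pzero E u)) = pzero E u"
  by (rule prol_eqI[OF c]; simp add: adapted_props[OF c] pscl_props[OF c] psum_props[OF c] pzero_props[OF c] axis_sum)+

lemma padd_pzero:
  assumes c: "c \<in> bcharts E" "u \<in> bdom E c" and p: "p \<in> prol E u"
  shows "padd E p (pzero E u) = p" "padd E (pzero E u) p = p"
  by (rule prol_eqI[OF c]; simp add: padd_props[OF c] pzero_props[OF c] p)+


subsection \<open>The frames\<close>

lemma frameV_adapted:
  assumes c: "c \<in> bcharts E" "u \<in> bdom E c"
  shows "frameV E c \<alpha> u = (adapted c u 0 (axis \<alpha> 1), pzero E u)"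
proof -
  have "lift (snd c) (proj E u) 0 = vscale E 0 u"
    using lift_vscale[OF chart_triv(1,2)[OF c], of 0 "snd (snd c) u"] lift_unique[OF chart_triv(1,2)[OF c]] by simp
  then show ?thesis
    by (simp add: frameV_def adapted_def vvec_def axis_def if_distrib[of "\<lambda>x. x * _"] cong: if_cong)
qed

lemma frameZ_props:
  assumes c: "c \<in> bcharts E" "u \<in> bdom E c"
  shows "fst (frameZ E c \<alpha> u) \<in> prol E u" "hcomp c (fst (frameZ E c \<alpha> u)) = axis \<alpha> 1"
    "vert c u (snd (fst (frameZ E c \<alpha> u))) = (\<chi> \<beta>. NA E (cfN E F) c \<alpha> \<beta> u)"
    "snd (frameZ E c \<alpha> u) = pzero E u"
proof -
  note l = lift_props[OF chart_triv(1,2)[OF c]]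
  show h: "hcomp c (fst (frameZ E c \<alpha> u)) = axis \<alpha> 1"
    by (simp add: hcomp_def frameZ_def frame_lift l)
  show "fst (frameZ E c \<alpha> u) \<in> prol E u"
    unfolding prol_iff[OF c] hcomp_def[symmetric] h
    by (simp add: frameZ_def frame_lift l tot.hol_tangent_sum tot.hol_tangent_scale evec_hol[OF c] evec_coord[OF c]
        axis_def if_distrib[of "\<lambda>x. _ * x"] if_distrib[of "\<lambda>x. x * _"] cong: if_cong)
  show "vert c u (snd (fst (frameZ E c \<alpha> u))) = (\<chi> \<beta>. NA E (cfN E F) c \<alpha> \<beta> u)"
    by (simp add: vert_def frameZ_def evec_coord[OF c] NA_def vec_eq_iff mult.commute
        if_distrib[of "\<lambda>x. _ * x"] if_distrib[of "\<lambda>x. x * _"] cong: if_cong)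
  show "snd (frameZ E c \<alpha> u) = pzero E u" by (simp add: frameZ_def)
qed

text \<open>The frame \<open>\<X>\<^sub>\<alpha>\<close> is \<open>\<Z>\<^sub>\<alpha>\<close> with its vertical component \<open>N\<^sub>\<alpha>\<^sup>\<beta>\<close> (\<open>frameZ_props\<close>) subtracted.\<close>

lemma frameX_adapted:
  assumes c: "c \<in> bcharts E" "u \<in> bdom E c"
  shows "frameX E (cfN E F) c \<alpha> u = (adapted c u (axis \<alpha> 1) 0, pzero E u)"
proof -
  have z: "pscl E r (pzero E u) = pzero E u" for r
    by (rule prol_eqI[OF c]) (simp_all add: pscl_props[OF c] pzero_props[OF c])
  have z2: "psum E u (\<lambda>i. pzero E u) = pzero E u"
    by (rule prol_eqI[OF c]) (simp_all add: psum_props[OF c] pzero_props[OF c])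
  have "padd E (fst (frameZ E c \<alpha> u)) (pscl E (-1) (adapted c u 0 (\<chi> \<beta>. NA E (cfN E F) c \<alpha> \<beta> u))) = adapted c u (axis \<alpha> 1) 0"
    by (rule prol_eqI[OF c])
      (simp_all add: padd_props[OF c] pscl_props[OF c] adapted_props[OF c] frameZ_props[OF c] vec_eq_iff)
  then show ?thesis
    by (simp add: frameX_def tadd_def tscl_def tsum_def frameV_adapted[OF c] psum_adapted[OF c] frameZ_props[OF c]
        z z2 padd_pzero[OF c] pzero_props[OF c])
qed

lemma tanchor_frameX:
  assumes c: "c \<in> bcharts E" "u \<in> bdom E c"
  shows "tanchor (frameX E (cfN E F) c \<beta> u) = deltaA E (cfN E F) c \<beta> u"
  by (simp add: frameX_adapted[OF c] tanchor_def adapted_def pzero_def conj_tv_zero vvec_zero deltaA_def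
      axis_def if_distrib[of "\<lambda>x. x * _"] cong: if_cong)

lemma tanchor_frameV:
  assumes c: "c \<in> bcharts E" "u \<in> bdom E c"
  shows "tanchor (frameV E c \<beta> u) = evec E c (Inr \<beta>) u"
  by (simp add: frameV_def tanchor_def pzero_def conj_tv_zero)

lemma deltaA_hol: "c \<in> bcharts E \<Longrightarrow> u \<in> bdom E c \<Longrightarrow> deltaA E N c \<beta> u \<in> hol_tangent (eatlas E) u"
  unfolding deltaA_def by (intro tot.hol_tangent_sum tot.hol_tangent_scale deltak_hol)

end

section \<open>Sections of the prolongation\<close>

context finsler_algebroid
begin

text \<open>Smooth sections of the prolongation, with smoothness expressed by the components in the adapted frames. Over
  open subsets of the slit bundle these are exactly the two entries of the smooth sections of the complexified
  prolongation (\<open>smooth_section_iff\<close>).\<close>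

definition psection :: "'e set \<Rightarrow> ('e \<Rightarrow> 'e pvec) \<Rightarrow> bool" where
  "psection W p \<longleftrightarrow> (\<forall>u\<in>W. p u \<in> prol E u) \<and>
     (\<forall>c\<in>bcharts E. \<forall>u\<in>W \<inter> bdom E c. \<forall>\<alpha>. smooth_at (eatlas E) u (\<lambda>x. hcomp c (p x) $ \<alpha>) \<and>
        smooth_at (eatlas E) u (\<lambda>x. vert c x (snd (p x)) $ \<alpha>))"

lemma psectionD:
  assumes "psection W p" "u \<in> W"
  shows "p u \<in> prol E u"
    and "c \<in> bcharts E \<Longrightarrow> u \<in> bdom E c \<Longrightarrow> smooth_at (eatlas E) u (\<lambda>x. hcomp c (p x) $ \<alpha>)"
    and "c \<in> bcharts E \<Longrightarrow> u \<in> bdom E c \<Longrightarrow> smooth_at (eatlas E) u (\<lambda>x. vert c x (snd (p x)) $ \<alpha>)"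
  using assms unfolding psection_def by blast+

text \<open>As the components transform with smooth matrices, one chart around each point is enough.\<close>

lemma psectionI:
  assumes W: "open W" "W \<subseteq> slit E" and p: "\<And>u. u \<in> W \<Longrightarrow> p u \<in> prol E u"
    and sm: "\<And>u. u \<in> W \<Longrightarrow> \<exists>c\<in>bcharts E. u \<in> bdom E c \<and> (\<forall>\<alpha>.
      smooth_at (eatlas E) u (\<lambda>x. hcomp c (p x) $ \<alpha>) \<and> smooth_at (eatlas E) u (\<lambda>x. vert c x (snd (p x)) $ \<alpha>))"
  shows "psection W p"
  unfolding psection_def
proof (intro conjI ballI allI p)
  fix c' u \<alpha> assume c': "c' \<in> bcharts E" and u: "u \<in> W \<inter> bdom E c'"
  obtain c where c: "c \<in> bcharts E" "u \<in> bdom E c"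
    and s: "\<And>\<alpha>. smooth_at (eatlas E) u (\<lambda>x. hcomp c (p x) $ \<alpha>)"
      "\<And>\<alpha>. smooth_at (eatlas E) u (\<lambda>x. vert c x (snd (p x)) $ \<alpha>)"
    using sm[of u] u by blast
  have op: "open (W \<inter> (bdom E c \<inter> bdom E c'))" "u \<in> W \<inter> (bdom E c \<inter> bdom E c')"
    using W bdom_open[OF c(1)] bdom_open[OF c'] c u by blast+
  have M: "smooth_at (eatlas E) u (\<lambda>x. tmat c c' (proj E x) $ \<alpha> $ \<beta>)" for \<alpha> \<beta>
    by (rule tmat_smooth[OF c(1) c' c(2)]) (use u in blast)
  have "smooth_at (eatlas E) u (\<lambda>x. \<Sum>\<beta>\<in>UNIV. tmat c c' (proj E x) $ \<alpha> $ \<beta> * hcomp c (p x) $ \<beta>)"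
    by (intro tot.smooth_at_sum tot.smooth_at_mult M s)
  then show "smooth_at (eatlas E) u (\<lambda>x. hcomp c' (p x) $ \<alpha>)"
  proof (rule tot.smooth_at_cong[OF _ op])
    fix x assume "x \<in> W \<inter> (bdom E c \<inter> bdom E c')"
    then show "(\<Sum>\<beta>\<in>UNIV. tmat c c' (proj E x) $ \<alpha> $ \<beta> * hcomp c (p x) $ \<beta>) = hcomp c' (p x) $ \<alpha>"
      using hcomp_transition[OF c(1) c' _ _ p, of x] by (simp add: matrix_vector_mult_def)
  qed
  have "smooth_at (eatlas E) u (\<lambda>x. \<Sum>\<beta>\<in>UNIV. tmat c c' (proj E x) $ \<alpha> $ \<beta> * vert c x (snd (p x)) $ \<beta>)"
    by (intro tot.smooth_at_sum tot.smooth_at_mult M s)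
  then show "smooth_at (eatlas E) u (\<lambda>x. vert c' x (snd (p x)) $ \<alpha>)"
  proof (rule tot.smooth_at_cong[OF _ op])
    fix x assume x: "x \<in> W \<inter> (bdom E c \<inter> bdom E c')"
    then show "(\<Sum>\<beta>\<in>UNIV. tmat c c' (proj E x) $ \<alpha> $ \<beta> * vert c x (snd (p x)) $ \<beta>) = vert c' x (snd (p x)) $ \<alpha>"
      using vert_transition[OF c(1) c' _ _ _ prol_hol[OF p], of x] W(2) by (auto simp: matrix_vector_mult_def)
  qed
qed

lemma adapted_section:
  assumes c: "c \<in> bcharts E" and W: "open W" "W \<subseteq> slit E" "W \<subseteq> bdom E c"
    and p: "\<And>x. x \<in> W \<Longrightarrow> p x = adapted c x (a x) (b x)"
    and s: "\<And>x \<alpha>. x \<in> W \<Longrightarrow> smooth_at (eatlas E) x (\<lambda>x. a x $ \<alpha>)"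
      "\<And>x \<alpha>. x \<in> W \<Longrightarrow> smooth_at (eatlas E) x (\<lambda>x. b x $ \<alpha>)"
  shows "psection W p"
proof (rule psectionI[OF W(1,2)])
  fix u assume u: "u \<in> W"
  have at: "x \<in> bdom E c" if "x \<in> W" for x using that W by blast
  show "p u \<in> prol E u" using p[OF u] adapted_props(1)[OF c at[OF u]] by simp
  have "smooth_at (eatlas E) u (\<lambda>x. hcomp c (p x) $ \<alpha>)" for \<alpha>
    by (rule tot.smooth_at_cong[OF s(1)[OF u] W(1) u]) (simp add: p adapted_props[OF c at])
  moreover have "smooth_at (eatlas E) u (\<lambda>x. vert c x (snd (p x)) $ \<alpha>)" for \<alpha>
    by (rule tot.smooth_at_cong[OF s(2)[OF u] W(1) u]) (simp add: p adapted_props[OF c at])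
  ultimately show "\<exists>c\<in>bcharts E. u \<in> bdom E c \<and> (\<forall>\<alpha>. smooth_at (eatlas E) u (\<lambda>x. hcomp c (p x) $ \<alpha>) \<and>
      smooth_at (eatlas E) u (\<lambda>x. vert c x (snd (p x)) $ \<alpha>))"
    using c at[OF u] by blast
qed

lemma smooth_NA:
  assumes c: "c \<in> bcharts E" "u \<in> bdom E c" "u \<in> slit E"
  shows "smooth_at (eatlas E) u (NA E (cfN E F) c \<alpha> \<beta>)"
  unfolding NA_def by (intro tot.smooth_at_sum tot.smooth_at_mult smooth_rho smooth_cfN c)

text \<open>Smooth sections are defined by expansions in the \<open>\<Z>\<^sub>\<alpha>\<close> and \<open>\<V>\<^sub>\<alpha>\<close>. As \<open>\<Z>\<^sub>\<alpha> = \<X>\<^sub>\<alpha> + N\<^sub>\<alpha>\<^sup>\<beta> \<V>\<^sub>\<beta>\<close>, passing to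
  the adapted frame only changes the vertical components.\<close>

lemma frame_comb:
  assumes c: "c \<in> bcharts E" "u \<in> bdom E c"
  shows "padd E (psum E u (\<lambda>\<alpha>. pscl E (a \<alpha>) (fst (frameZ E c \<alpha> u)))) (psum E u (\<lambda>\<alpha>. pscl E (b \<alpha>) (fst (frameV E c \<alpha> u)))) =
    adapted c u (\<chi> \<alpha>. a \<alpha>) (\<chi> \<beta>. b \<beta> + (\<Sum>\<alpha>\<in>UNIV. a \<alpha> * NA E (cfN E F) c \<alpha> \<beta> u))"
proof (rule prol_eqI[OF c])
  let ?Z = "\<lambda>\<alpha>. fst (frameZ E c \<alpha> u)" and ?V = "\<lambda>\<alpha>. fst (frameV E c \<alpha> u)"
  have V: "?V \<alpha> = adapted c u 0 (axis \<alpha> 1)" for \<alpha> by (simp add: frameV_adapted[OF c])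
  note mem = psum_props[OF c, OF pscl_props(1)[OF c frameZ_props(1)[OF c]], of a]
    psum_props[OF c, OF pscl_props(1)[OF c adapted_props(1)[OF c]], of b "\<lambda>_. 0" "\<lambda>\<alpha>. axis \<alpha> 1"]
  note simps = V padd_props[OF c] mem pscl_props[OF c] adapted_props[OF c] frameZ_props[OF c] axis_sum
  show "padd E (psum E u (\<lambda>\<alpha>. pscl E (a \<alpha>) (?Z \<alpha>))) (psum E u (\<lambda>\<alpha>. pscl E (b \<alpha>) (?V \<alpha>))) \<in> prol E u"
    by (simp add: simps)
  show "adapted c u (\<chi> \<alpha>. a \<alpha>) (\<chi> \<beta>. b \<beta> + (\<Sum>\<alpha>\<in>UNIV. a \<alpha> * NA E (cfN E F) c \<alpha> \<beta> u)) \<in> prol E u"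
    by (simp add: simps)
  show "hcomp c (padd E (psum E u (\<lambda>\<alpha>. pscl E (a \<alpha>) (?Z \<alpha>))) (psum E u (\<lambda>\<alpha>. pscl E (b \<alpha>) (?V \<alpha>)))) =
      hcomp c (adapted c u (\<chi> \<alpha>. a \<alpha>) (\<chi> \<beta>. b \<beta> + (\<Sum>\<alpha>\<in>UNIV. a \<alpha> * NA E (cfN E F) c \<alpha> \<beta> u)))"
    by (simp add: simps)
  show "vert c u (snd (padd E (psum E u (\<lambda>\<alpha>. pscl E (a \<alpha>) (?Z \<alpha>))) (psum E u (\<lambda>\<alpha>. pscl E (b \<alpha>) (?V \<alpha>))))) =
      vert c u (snd (adapted c u (\<chi> \<alpha>. a \<alpha>) (\<chi> \<beta>. b \<beta> + (\<Sum>\<alpha>\<in>UNIV. a \<alpha> * NA E (cfN E F) c \<alpha> \<beta> u))))"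
    by (simp add: simps) (simp add: vec_eq_iff)
qed

lemma full_comb:
  assumes c: "c \<in> bcharts E" "u \<in> bdom E c"
  shows "tadd E (tadd E (tsum E u (\<lambda>\<alpha>. tscl E (a \<alpha>) (frameZ E c \<alpha> u))) (tsum E u (\<lambda>\<alpha>. tscl E (b \<alpha>) (frameV E c \<alpha> u))))
            (tadd E (tsum E u (\<lambda>\<alpha>. tscl E (a' \<alpha>) (tconj (frameZ E c \<alpha> u)))) (tsum E u (\<lambda>\<alpha>. tscl E (b' \<alpha>) (tconj (frameV E c \<alpha> u))))) =
    (adapted c u (\<chi> \<alpha>. a \<alpha>) (\<chi> \<beta>. b \<beta> + (\<Sum>\<alpha>\<in>UNIV. a \<alpha> * NA E (cfN E F) c \<alpha> \<beta> u)),
     adapted c u (\<chi> \<alpha>. cnj (a' \<alpha>)) (\<chi> \<beta>. cnj (b' \<beta>) + (\<Sum>\<alpha>\<in>UNIV. cnj (a' \<alpha>) * NA E (cfN E F) c \<alpha> \<beta> u)))"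
proof -
  have s: "snd (frameZ E c \<alpha> u) = pzero E u" "snd (frameV E c \<alpha> u) = pzero E u" for \<alpha>
    by (simp_all add: frameZ_def frameV_def)
  show ?thesis
    by (simp add: tadd_def tsum_def tscl_def tconj_def s frame_comb[OF c] psum_adapted(3)[OF c]
        padd_pzero[OF c] pzero_props[OF c] adapted_props[OF c])
qed

text \<open>The passage between the two frames preserves smoothness of coefficients because the \<open>N\<^sub>\<alpha>\<^sup>\<beta>\<close> are smooth. This
  needs \<open>W \<subseteq> slit E\<close>, as \<open>F\<close> is only smooth there.\<close>

lemma smooth_section_iff:
  assumes W: "open W" "W \<subseteq> slit E"
  shows "smooth_section E W S \<longleftrightarrow> psection W (\<lambda>x. fst (S x)) \<and> psection W (\<lambda>x. snd (S x))"
proof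
  assume S: "smooth_section E W S"
  have "\<exists>a b a' b'. (\<forall>u\<in>W \<inter> bdom E c. S u = (adapted c u (a u) (b u), adapted c u (a' u) (b' u)) \<and>
      (\<forall>\<alpha>. smooth_at (eatlas E) u (\<lambda>x. a x $ \<alpha>) \<and> smooth_at (eatlas E) u (\<lambda>x. b x $ \<alpha>) \<and>
         smooth_at (eatlas E) u (\<lambda>x. a' x $ \<alpha>) \<and> smooth_at (eatlas E) u (\<lambda>x. b' x $ \<alpha>)))" if c: "c \<in> bcharts E" for c
  proof -
    obtain a b a' b' where sm: "\<forall>\<alpha>. smooth_fun (eatlas E) (W \<inter> bdom E c) (a \<alpha>) \<and>
              smooth_fun (eatlas E) (W \<inter> bdom E c) (b \<alpha>) \<and>
              smooth_fun (eatlas E) (W \<inter> bdom E c) (a' \<alpha>) \<and>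
              smooth_fun (eatlas E) (W \<inter> bdom E c) (b' \<alpha>)"
      and eq: "\<forall>u\<in>W \<inter> bdom E c. S u =
           tadd E (tadd E (tsum E u (\<lambda>\<alpha>. tscl E (a \<alpha> u) (frameZ E c \<alpha> u)))
                    (tsum E u (\<lambda>\<alpha>. tscl E (b \<alpha> u) (frameV E c \<alpha> u))))
            (tadd E (tsum E u (\<lambda>\<alpha>. tscl E (a' \<alpha> u) (tconj (frameZ E c \<alpha> u))))
                    (tsum E u (\<lambda>\<alpha>. tscl E (b' \<alpha> u) (tconj (frameV E c \<alpha> u)))))"
      using S c unfolding smooth_section_def by blast
    have smu: "smooth_at (eatlas E) u (a \<alpha>)" "smooth_at (eatlas E) u (b \<alpha>)"
      "smooth_at (eatlas E) u (a' \<alpha>)" "smooth_at (eatlas E) u (b' \<alpha>)" if "u \<in> W \<inter> bdom E c" for u \<alpha>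
      using sm that unfolding smooth_fun_germs[OF W(1) c] by blast+
    have sN: "smooth_at (eatlas E) u (NA E (cfN E F) c \<alpha> \<beta>)" if "u \<in> W \<inter> bdom E c" for u \<alpha> \<beta>
      using that W by (intro smooth_NA[OF c]) auto
    show ?thesis
    proof (rule exI[of _ "\<lambda>u. \<chi> \<alpha>. a \<alpha> u"], rule exI[of _ "\<lambda>u. \<chi> \<beta>. b \<beta> u + (\<Sum>\<alpha>\<in>UNIV. a \<alpha> u * NA E (cfN E F) c \<alpha> \<beta> u)"],
        rule exI[of _ "\<lambda>u. \<chi> \<alpha>. cnj (a' \<alpha> u)"],
        rule exI[of _ "\<lambda>u. \<chi> \<beta>. cnj (b' \<beta> u) + (\<Sum>\<alpha>\<in>UNIV. cnj (a' \<alpha> u) * NA E (cfN E F) c \<alpha> \<beta> u)"], intro ballI)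
      fix u assume u: "u \<in> W \<inter> bdom E c"
      then have uc: "u \<in> bdom E c" by blast
      show "S u = (adapted c u (\<chi> \<alpha>. a \<alpha> u) (\<chi> \<beta>. b \<beta> u + (\<Sum>\<alpha>\<in>UNIV. a \<alpha> u * NA E (cfN E F) c \<alpha> \<beta> u)),
           adapted c u (\<chi> \<alpha>. cnj (a' \<alpha> u)) (\<chi> \<beta>. cnj (b' \<beta> u) + (\<Sum>\<alpha>\<in>UNIV. cnj (a' \<alpha> u) * NA E (cfN E F) c \<alpha> \<beta> u))) \<and>
         (\<forall>\<alpha>. smooth_at (eatlas E) u (\<lambda>x. (\<chi> \<alpha>. a \<alpha> x) $ \<alpha>) \<and>
           smooth_at (eatlas E) u (\<lambda>x. (\<chi> \<beta>. b \<beta> x + (\<Sum>\<alpha>\<in>UNIV. a \<alpha> x * NA E (cfN E F) c \<alpha> \<beta> x)) $ \<alpha>) \<and>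
           smooth_at (eatlas E) u (\<lambda>x. (\<chi> \<alpha>. cnj (a' \<alpha> x)) $ \<alpha>) \<and>
           smooth_at (eatlas E) u (\<lambda>x. (\<chi> \<beta>. cnj (b' \<beta> x) + (\<Sum>\<alpha>\<in>UNIV. cnj (a' \<alpha> x) * NA E (cfN E F) c \<alpha> \<beta> x)) $ \<alpha>))"
        unfolding bspec[OF eq u] full_comb[OF c uc] vec_lambda_beta
        by (intro conjI refl allI tot.smooth_at_add tot.smooth_at_sum tot.smooth_at_mult tot.smooth_at_cnj smu[OF u] sN[OF u])
    qed
  qed
  note rep = this
  have "psection (W \<inter> bdom E c) (\<lambda>x. fst (S x)) \<and> psection (W \<inter> bdom E c) (\<lambda>x. snd (S x))" if c: "c \<in> bcharts E" for c
  proof -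
    obtain a b a' b' where r: "\<forall>u\<in>W \<inter> bdom E c. S u = (adapted c u (a u) (b u), adapted c u (a' u) (b' u)) \<and>
      (\<forall>\<alpha>. smooth_at (eatlas E) u (\<lambda>x. a x $ \<alpha>) \<and> smooth_at (eatlas E) u (\<lambda>x. b x $ \<alpha>) \<and>
         smooth_at (eatlas E) u (\<lambda>x. a' x $ \<alpha>) \<and> smooth_at (eatlas E) u (\<lambda>x. b' x $ \<alpha>))"
      using rep[OF c] by blast
    have op: "open (W \<inter> bdom E c)" "W \<inter> bdom E c \<subseteq> slit E" "W \<inter> bdom E c \<subseteq> bdom E c"
      using W bdom_open[OF c] by blast+
    show ?thesis
      by (rule conjI; rule adapted_section[OF c op]) (use r in auto)
  qed
  then have "psection W (\<lambda>x. p (S x))" if "\<And>c. c \<in> bcharts E \<Longrightarrow> psection (W \<inter> bdom E c) (\<lambda>x. p (S x))" for p :: "'e cpvec \<Rightarrow> 'e pvec"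
    unfolding psection_def
  proof (intro conjI ballI allI)
    show "p (S u) \<in> prol E u" if "u \<in> W" for u
      using psectionD(1)[OF \<open>\<And>c. c \<in> bcharts E \<Longrightarrow> psection (W \<inter> bdom E c) (\<lambda>x. p (S x))\<close>[OF chart_at(1)]] chart_at that by blast
  qed (use psectionD(2,3)[OF that] in blast)+
  then show "psection W (\<lambda>x. fst (S x)) \<and> psection W (\<lambda>x. snd (S x))"
    using \<open>\<And>c. c \<in> bcharts E \<Longrightarrow> psection (W \<inter> bdom E c) (\<lambda>x. fst (S x)) \<and> psection (W \<inter> bdom E c) (\<lambda>x. snd (S x))\<close> by blast
next
  assume R: "psection W (\<lambda>x. fst (S x)) \<and> psection W (\<lambda>x. snd (S x))"
  show "smooth_section E W S"
    unfolding smooth_section_def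
  proof (intro conjI ballI)
    show "S u \<in> cprol E u" if "u \<in> W" for u
      using psectionD(1)[OF conjunct1[OF R] that] psectionD(1)[OF conjunct2[OF R] that]
      by (simp add: cprol_def mem_Times_iff)
    fix c assume c: "c \<in> bcharts E"
    define a where "a \<alpha> x = hcomp c (fst (S x)) $ \<alpha>" for \<alpha> x
    define b where "b \<beta> x = vert c x (snd (fst (S x))) $ \<beta> - (\<Sum>\<alpha>\<in>UNIV. a \<alpha> x * NA E (cfN E F) c \<alpha> \<beta> x)" for \<beta> x
    define a' where "a' \<alpha> x = cnj (hcomp c (snd (S x)) $ \<alpha>)" for \<alpha> x
    define b' where "b' \<beta> x = cnj (vert c x (snd (snd (S x))) $ \<beta> - (\<Sum>\<alpha>\<in>UNIV. cnj (a' \<alpha> x) * NA E (cfN E F) c \<alpha> \<beta> x))" for \<beta> x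
    have sm: "smooth_at (eatlas E) u (a \<alpha>)" "smooth_at (eatlas E) u (b \<alpha>)"
      "smooth_at (eatlas E) u (a' \<alpha>)" "smooth_at (eatlas E) u (b' \<alpha>)" if u: "u \<in> W \<inter> bdom E c" for u \<alpha>
    proof -
      have u': "u \<in> W" "u \<in> bdom E c" "u \<in> slit E" using u W by auto
      note d = psectionD(2,3)[OF conjunct1[OF R] u'(1) c u'(2)] psectionD(2,3)[OF conjunct2[OF R] u'(1) c u'(2)]
      show a: "smooth_at (eatlas E) u (a \<alpha>)" "smooth_at (eatlas E) u (a' \<alpha>)" for \<alpha>
        unfolding a_def a'_def by (intro d tot.smooth_at_cnj)+
      show "smooth_at (eatlas E) u (b \<alpha>)" "smooth_at (eatlas E) u (b' \<alpha>)"
        unfolding b_def b'_def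
        by (intro tot.smooth_at_diff tot.smooth_at_cnj tot.smooth_at_sum tot.smooth_at_mult d a smooth_NA c u')+
    qed
    show "\<exists>a b a' b'.
        (\<forall>\<alpha>. smooth_fun (eatlas E) (W \<inter> bdom E c) (a \<alpha>) \<and>
              smooth_fun (eatlas E) (W \<inter> bdom E c) (b \<alpha>) \<and>
              smooth_fun (eatlas E) (W \<inter> bdom E c) (a' \<alpha>) \<and>
              smooth_fun (eatlas E) (W \<inter> bdom E c) (b' \<alpha>)) \<and>
        (\<forall>u\<in>W \<inter> bdom E c. S u =
           tadd E
            (tadd E (tsum E u (\<lambda>\<alpha>. tscl E (a \<alpha> u) (frameZ E c \<alpha> u)))
                    (tsum E u (\<lambda>\<alpha>. tscl E (b \<alpha> u) (frameV E c \<alpha> u))))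
            (tadd E (tsum E u (\<lambda>\<alpha>. tscl E (a' \<alpha> u) (tconj (frameZ E c \<alpha> u))))
                    (tsum E u (\<lambda>\<alpha>. tscl E (b' \<alpha> u) (tconj (frameV E c \<alpha> u))))))"
    proof (rule exI[of _ a], rule exI[of _ b], rule exI[of _ a'], rule exI[of _ b'], intro conjI ballI)
      show "\<forall>\<alpha>. smooth_fun (eatlas E) (W \<inter> bdom E c) (a \<alpha>) \<and>
              smooth_fun (eatlas E) (W \<inter> bdom E c) (b \<alpha>) \<and>
              smooth_fun (eatlas E) (W \<inter> bdom E c) (a' \<alpha>) \<and>
              smooth_fun (eatlas E) (W \<inter> bdom E c) (b' \<alpha>)"
        using sm unfolding smooth_fun_germs[OF W(1) c] by blast
      fix u assume u: "u \<in> W \<inter> bdom E c"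
      then have u': "u \<in> W" "u \<in> bdom E c" by auto
      have e: "(\<chi> \<alpha>. a \<alpha> u) = hcomp c (fst (S u))" "(\<chi> \<alpha>. cnj (a' \<alpha> u)) = hcomp c (snd (S u))"
        "(\<chi> \<beta>. b \<beta> u + (\<Sum>\<alpha>\<in>UNIV. a \<alpha> u * NA E (cfN E F) c \<alpha> \<beta> u)) = vert c u (snd (fst (S u)))"
        "(\<chi> \<beta>. cnj (b' \<beta> u) + (\<Sum>\<alpha>\<in>UNIV. cnj (a' \<alpha> u) * NA E (cfN E F) c \<alpha> \<beta> u)) = vert c u (snd (snd (S u)))"
        by (simp_all add: a_def a'_def b_def b'_def vec_eq_iff)
      show "S u = tadd E
            (tadd E (tsum E u (\<lambda>\<alpha>. tscl E (a \<alpha> u) (frameZ E c \<alpha> u)))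
                    (tsum E u (\<lambda>\<alpha>. tscl E (b \<alpha> u) (frameV E c \<alpha> u))))
            (tadd E (tsum E u (\<lambda>\<alpha>. tscl E (a' \<alpha> u) (tconj (frameZ E c \<alpha> u))))
                    (tsum E u (\<lambda>\<alpha>. tscl E (b' \<alpha> u) (tconj (frameV E c \<alpha> u)))))"
        unfolding full_comb[OF c u'(2)] e adapted_expand[OF c u'(2) psectionD(1)[OF conjunct1[OF R] u'(1)]]
          adapted_expand[OF c u'(2) psectionD(1)[OF conjunct2[OF R] u'(1)]] by simp
    qed
  qed
qed

lemma psection_field:
  assumes W: "open W" "W \<subseteq> slit E" and p: "psection W p"
  shows "tangent_section E W (\<lambda>x. snd (p x))"
  unfolding tangent_section_iff[OF W(1)]
proof (intro conjI ballI allI)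
  show "snd (p u) \<in> tot.ctan u" if "u \<in> W" for u
    by (rule tot.hol_tangent_ctan[OF prol_hol[OF psectionD(1)[OF p that]]])
  fix c u i assume c: "c \<in> bcharts E" and u: "u \<in> W \<inter> bdom E c"
  then have u': "u \<in> W" "u \<in> bdom E c" "u \<in> slit E" using W by auto
  have op: "open (W \<inter> bdom E c)" using W bdom_open[OF c] by blast
  note s = psectionD(2,3)[OF p u'(1) c u'(2)]
  have h: "smooth_at (eatlas E) u (\<lambda>x. \<Sum>\<alpha>\<in>UNIV. hcomp c (p x) $ \<alpha> * rho E c k \<alpha> (proj E x))" for k
    by (intro tot.smooth_at_sum tot.smooth_at_mult s smooth_rho c u')
  show "smooth_at (eatlas E) u (\<lambda>x. snd (p x) (coord (echart E c) i))"
  proof (cases i)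
    case (Inl k)
    show ?thesis unfolding Inl
      by (rule tot.smooth_at_cong[OF h[of k] op u]) (simp add: prol_base_coord[OF c _ psectionD(1)[OF p]])
  next
    case (Inr \<beta>)
    have "smooth_at (eatlas E) u (\<lambda>x. vert c x (snd (p x)) $ \<beta> -
        (\<Sum>k\<in>UNIV. cfN E F c k \<beta> x * (\<Sum>\<alpha>\<in>UNIV. hcomp c (p x) $ \<alpha> * rho E c k \<alpha> (proj E x))))"
      by (intro tot.smooth_at_diff s tot.smooth_at_sum[of _ _ "\<lambda>k x. cfN E F c k \<beta> x * _ k x"] tot.smooth_at_mult smooth_cfN c u' h)
    then show ?thesis unfolding Inr
      by (rule tot.smooth_at_cong[OF _ op u]) (simp add: prol_fibre_coord[OF c _ psectionD(1)[OF p]])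
  qed
  show "smooth_at (eatlas E) u (\<lambda>x. snd (p x) (\<lambda>y. cnj (coord (echart E c) i y)))"
  proof (rule tot.smooth_at_cong[OF tot.smooth_at_const[of u 0] op u])
    fix x assume "x \<in> W \<inter> bdom E c"
    then have x: "x \<in> W" "x \<in> bdom E c" by auto
    show "0 = snd (p x) (\<lambda>y. cnj (coord (echart E c) i y))"
      using prol_hol[OF psectionD(1)[OF p x(1)]] tot.hol_tangent_iff[OF at_echart[OF c x(2)]] by simp
  qed
qed

lemma tangent_section_add:
  assumes W: "open W" and "tangent_section E W \<eta>" "tangent_section E W \<eta>'"
  shows "tangent_section E W (\<lambda>x f. \<eta> x f + \<eta>' x f)"
  using assms(2,3) unfolding tangent_section_iff[OF W]
  by (intro conjI ballI allI tot.ctan_add tot.smooth_at_add) blast+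

lemma tanchor_section:
  assumes W: "open W" "W \<subseteq> slit E" and Z: "smooth_section E W Z"
  shows "tangent_section E W (\<lambda>x. tanchor (Z x))"
  unfolding tanchor_def
  using tangent_section_add[OF W(1) psection_field[OF W] tangent_section_conj[OF W(1) psection_field[OF W]]] Z
  unfolding smooth_section_iff[OF W] by blast

lemma tanchor_tconj: "tanchor (tconj s) = conj_tv (tanchor s)"
  by (simp add: tanchor_def tconj_def conj_tv_add conj_tv_conj add.commute)

lemma tanchor_tadd: "tanchor (tadd E s t) = (\<lambda>f. tanchor s f + tanchor t f)"
  by (simp add: tanchor_def tadd_def padd_def conj_tv_add add_ac)

lemma tanchor_tscl: "tanchor (tscl E r s) = (\<lambda>f. r * tanchor s f)"
  by (simp add: tanchor_def tscl_def pscl_def conj_tv_mult distrib_left)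


section \<open>The Chern-Finsler connection\<close>

text \<open>Both kinds of components are differentiated by the same formula. As for \<open>vert_D\<close>, the choice of the chart is
  harmless, by \<open>prol_D_chart\<close>.\<close>

definition prol_D :: "('e \<Rightarrow> 'e tvec) \<Rightarrow> ('e \<Rightarrow> 'e pvec) \<Rightarrow> 'e \<Rightarrow> 'e pvec" where
  "prol_D \<xi> p u = adapted (chart_at u) u (nabla (chart_at u) (\<xi> u) (\<lambda>x. hcomp (chart_at u) (p x)) u)
     (nabla (chart_at u) (\<xi> u) (\<lambda>x. vert (chart_at u) x (snd (p x))) u)"

text \<open>The second entry of an element of the complexified prolongation stands for its conjugate. Commuting with
  conjugation therefore forces the derivative of the second entry along \<open>Z\<close> to be that of a section of the
  prolongation along the conjugate of \<open>Z\<close>.\<close>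

definition lin_conn :: "'e connection" where
  "lin_conn W Z S u = (prol_D (\<lambda>x. tanchor (Z x)) (\<lambda>x. fst (S x)) u,
     prol_D (\<lambda>x. conj_tv (tanchor (Z x))) (\<lambda>x. snd (S x)) u)"

lemma prol_D_chart:
  assumes W: "open W" "W \<subseteq> slit E" "u \<in> W" and p: "psection W p" and \<xi>: "\<xi> u \<in> tot.ctan u"
    and c: "c \<in> bcharts E" "u \<in> bdom E c"
  shows "prol_D \<xi> p u = adapted c u (nabla c (\<xi> u) (\<lambda>x. hcomp c (p x)) u) (nabla c (\<xi> u) (\<lambda>x. vert c x (snd (p x))) u)"
proof -
  define d where "d = chart_at u"
  have d: "d \<in> bcharts E" "u \<in> bdom E d" using chart_at by (simp_all add: d_def)
  have us: "u \<in> slit E" using W by blast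
  have op: "open (W \<inter> (bdom E d \<inter> bdom E c))" "u \<in> W \<inter> (bdom E d \<inter> bdom E c)"
    using W bdom_open[OF c(1)] bdom_open[OF d(1)] c d by blast+
  have 1: "nabla c (\<xi> u) (\<lambda>x. hcomp c (p x)) u = tmat d c (proj E u) *v nabla d (\<xi> u) (\<lambda>x. hcomp d (p x)) u"
  proof (rule nabla_transition[OF d(1) c(1) d(2) c(2) us \<xi> psectionD(2)[OF p W(3) d] op])
    fix x assume "x \<in> W \<inter> (bdom E d \<inter> bdom E c)"
    then show "hcomp c (p x) = tmat d c (proj E x) *v hcomp d (p x)"
      by (intro hcomp_transition[OF d(1) c(1)] psectionD(1)[OF p]) auto
  qed
  have 2: "nabla c (\<xi> u) (\<lambda>x. vert c x (snd (p x))) u = tmat d c (proj E u) *v nabla d (\<xi> u) (\<lambda>x. vert d x (snd (p x))) u"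
  proof (rule nabla_transition[OF d(1) c(1) d(2) c(2) us \<xi> psectionD(3)[OF p W(3) d] op])
    fix x assume "x \<in> W \<inter> (bdom E d \<inter> bdom E c)"
    then show "vert c x (snd (p x)) = tmat d c (proj E x) *v vert d x (snd (p x))"
      using W by (intro vert_transition[OF d(1) c(1)] prol_hol psectionD(1)[OF p]) auto
  qed
  show ?thesis
    unfolding 1 2 adapted_transition[OF d(1) c(1) d(2) c(2) us] by (simp add: prol_D_def d_def)
qed

lemma prol_D_cong:
  assumes W: "open W" "u \<in> W" "psection W p" "\<xi> u \<in> tot.ctan u"
    and "\<xi> u = \<xi>' u" "\<And>x. x \<in> W \<Longrightarrow> p x = p' x"
  shows "prol_D \<xi> p u = prol_D \<xi>' p' u"
proof -
  define c where "c = chart_at u"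
  have c: "c \<in> bcharts E" "u \<in> bdom E c" using chart_at by (simp_all add: c_def)
  have "nabla c (\<xi> u) (\<lambda>x. hcomp c (p x)) u = nabla c (\<xi> u) (\<lambda>x. hcomp c (p' x)) u"
    by (rule nabla_cong[OF W(4) psectionD(2)[OF W(3,2) c] W(1,2)]) (simp add: assms(6))
  moreover have "nabla c (\<xi> u) (\<lambda>x. vert c x (snd (p x))) u = nabla c (\<xi> u) (\<lambda>x. vert c x (snd (p' x))) u"
    by (rule nabla_cong[OF W(4) psectionD(3)[OF W(3,2) c] W(1,2)]) (simp add: assms(6))
  ultimately show ?thesis by (simp add: prol_D_def c_def[symmetric] assms(5))
qed

lemma prol_D_prol: "prol_D \<xi> p u \<in> prol E u"
  unfolding prol_D_def by (rule adapted_props(1)[OF chart_at])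

lemma prol_D_field_add:
  "prol_D (\<lambda>x f. \<xi> x f + \<xi>' x f) p u = padd E (prol_D \<xi> p u) (prol_D \<xi>' p u)"
  using nabla_lincomb[of _ 1 "\<xi> u" 1 "\<xi>' u"] by (simp add: prol_D_def adapted_add[OF chart_at])

lemma prol_D_field_mult:
  "prol_D (\<lambda>x f. r x * \<xi> x f) p u = pscl E (r u) (prol_D \<xi> p u)"
  using nabla_lincomb[of _ "r u" "\<xi> u" 0 "\<xi> u"] by (simp add: prol_D_def adapted_scale[OF chart_at])

lemma prol_D_add:
  assumes W: "open W" "u \<in> W" and \<xi>: "\<xi> u \<in> tot.ctan u" and p: "psection W p" and q: "psection W q"
  shows "prol_D \<xi> (\<lambda>x. padd E (p x) (q x)) u = padd E (prol_D \<xi> p u) (prol_D \<xi> q u)"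
proof -
  define c where "c = chart_at u"
  have c: "c \<in> bcharts E" "u \<in> bdom E c" using chart_at by (simp_all add: c_def)
  have op: "open (W \<inter> bdom E c)" "u \<in> W \<inter> bdom E c" using W bdom_open[OF c(1)] c by blast+
  note sp = psectionD(2,3)[OF p W(2) c] and sq = psectionD(2,3)[OF q W(2) c]
  have add: "hcomp c (padd E (p x) (q x)) = hcomp c (p x) + hcomp c (q x)"
    "vert c x (snd (padd E (p x) (q x))) = vert c x (snd (p x)) + vert c x (snd (q x))"
    if "x \<in> W \<inter> bdom E c" for x
    using padd_props(2,3)[OF c(1) _ psectionD(1)[OF p] psectionD(1)[OF q], of x] that by auto
  have "nabla c (\<xi> u) (\<lambda>x. hcomp c (p x) + hcomp c (q x)) u = nabla c (\<xi> u) (\<lambda>x. hcomp c (padd E (p x) (q x))) u"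
    by (rule nabla_cong[OF \<xi> _ op]) (simp_all add: add tot.smooth_at_add sp sq)
  moreover have "nabla c (\<xi> u) (\<lambda>x. vert c x (snd (p x)) + vert c x (snd (q x))) u = nabla c (\<xi> u) (\<lambda>x. vert c x (snd (padd E (p x) (q x)))) u"
    by (rule nabla_cong[OF \<xi> _ op]) (simp_all add: add tot.smooth_at_add sp sq)
  ultimately show ?thesis
    unfolding nabla_add[OF \<xi> sp(1) sq(1)] nabla_add[OF \<xi> sp(2) sq(2)]
    by (simp add: prol_D_def c_def[symmetric] adapted_add[OF c, symmetric])
qed

lemma prol_D_mult:
  assumes W: "open W" "u \<in> W" and \<xi>: "\<xi> u \<in> tot.ctan u" and p: "psection W p" and g: "smooth_at (eatlas E) u g"
  shows "prol_D \<xi> (\<lambda>x. pscl E (g x) (p x)) u = padd E (pscl E (g u) (prol_D \<xi> p u)) (pscl E (\<xi> u g) (p u))"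
proof -
  define c where "c = chart_at u"
  have c: "c \<in> bcharts E" "u \<in> bdom E c" using chart_at by (simp_all add: c_def)
  have op: "open (W \<inter> bdom E c)" "u \<in> W \<inter> bdom E c" using W bdom_open[OF c(1)] c by blast+
  note sp = psectionD(2,3)[OF p W(2) c]
  have scl: "hcomp c (pscl E (g x) (p x)) = g x *s hcomp c (p x)"
    "vert c x (snd (pscl E (g x) (p x))) = g x *s vert c x (snd (p x))"
    if "x \<in> W \<inter> bdom E c" for x
    using pscl_props(2,3)[OF c(1) _ psectionD(1)[OF p], of x] that by auto
  have "nabla c (\<xi> u) (\<lambda>x. g x *s hcomp c (p x)) u = nabla c (\<xi> u) (\<lambda>x. hcomp c (pscl E (g x) (p x))) u"
    by (rule nabla_cong[OF \<xi> _ op]) (simp_all add: scl tot.smooth_at_mult g sp)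
  note h = this[unfolded nabla_mult[OF \<xi> g sp(1)], symmetric]
  have "nabla c (\<xi> u) (\<lambda>x. g x *s vert c x (snd (p x))) u = nabla c (\<xi> u) (\<lambda>x. vert c x (snd (pscl E (g x) (p x)))) u"
    by (rule nabla_cong[OF \<xi> _ op]) (simp_all add: scl tot.smooth_at_mult g sp)
  note v = this[unfolded nabla_mult[OF \<xi> g sp(2)], symmetric]
  show ?thesis
    unfolding prol_D_def c_def[symmetric] h v adapted_lincomb[OF c]
      adapted_expand[OF c psectionD(1)[OF p W(2)]] ..
qed

lemma prol_D_section:
  assumes W: "open W" "W \<subseteq> slit E" and \<xi>: "tangent_section E W \<xi>" and p: "psection W p"
  shows "psection W (prol_D \<xi> p)"
proof (rule psectionI[OF W prol_D_prol])
  fix u assume u: "u \<in> W"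
  define c where "c = chart_at u"
  have c: "c \<in> bcharts E" "u \<in> bdom E c" using chart_at by (simp_all add: c_def)
  have op: "open (W \<inter> bdom E c)" "W \<inter> bdom E c \<subseteq> slit E" "W \<inter> bdom E c \<subseteq> bdom E c" "u \<in> W \<inter> bdom E c"
    using W bdom_open[OF c(1)] c u by blast+
  have ct: "\<xi> x \<in> tot.ctan x" if "x \<in> W" for x by (rule tangent_section_ctan[OF W(1) \<xi> that])
  have cs: "smooth_at (eatlas E) u (\<lambda>x. \<xi> x (coord (echart E c) i))"
    "smooth_at (eatlas E) u (\<lambda>x. \<xi> x (\<lambda>y. cnj (coord (echart E c) i y)))" for i
    using \<xi> c op(4) unfolding tangent_section_iff[OF W(1)] by blast+
  have eq: "prol_D \<xi> p x = adapted c x (nabla c (\<xi> x) (\<lambda>x. hcomp c (p x)) x) (nabla c (\<xi> x) (\<lambda>x. vert c x (snd (p x))) x)"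
    if "x \<in> W \<inter> bdom E c" for x
    by (rule prol_D_chart[where \<xi> = \<xi>, OF W _ p ct c(1)]) (use that in auto)
  have s1: "smooth_at (eatlas E) u (\<lambda>x. nabla c (\<xi> x) (\<lambda>x. hcomp c (p x)) x $ \<alpha>)" for \<alpha>
    by (rule smooth_nabla[OF c(1) op ct cs psectionD(2)[OF p u c]]) auto
  have s2: "smooth_at (eatlas E) u (\<lambda>x. nabla c (\<xi> x) (\<lambda>x. vert c x (snd (p x))) x $ \<alpha>)" for \<alpha>
    by (rule smooth_nabla[OF c(1) op ct cs psectionD(3)[OF p u c]]) auto
  have "smooth_at (eatlas E) u (\<lambda>x. hcomp c (prol_D \<xi> p x) $ \<alpha>)" for \<alpha>
    by (rule tot.smooth_at_cong[OF s1 op(1,4)]) (simp add: eq adapted_props[OF c(1)])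
  moreover have "smooth_at (eatlas E) u (\<lambda>x. vert c x (snd (prol_D \<xi> p x)) $ \<alpha>)" for \<alpha>
    by (rule tot.smooth_at_cong[OF s2 op(1,4)]) (simp add: eq adapted_props[OF c(1)])
  ultimately show "\<exists>c\<in>bcharts E. u \<in> bdom E c \<and> (\<forall>\<alpha>. smooth_at (eatlas E) u (\<lambda>x. hcomp c (prol_D \<xi> p x) $ \<alpha>) \<and>
      smooth_at (eatlas E) u (\<lambda>x. vert c x (snd (prol_D \<xi> p x)) $ \<alpha>))"
    using c by blast
qed

lemma smooth_sectionD:
  assumes W: "open W" "W \<subseteq> slit E" and S: "smooth_section E W S"
  shows "psection W (\<lambda>x. fst (S x))" "psection W (\<lambda>x. snd (S x))"
    and "u \<in> W \<Longrightarrow> tanchor (S u) \<in> tot.ctan u" "u \<in> W \<Longrightarrow> conj_tv (tanchor (S u)) \<in> tot.ctan u"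
proof -
  show "psection W (\<lambda>x. fst (S x))" "psection W (\<lambda>x. snd (S x))" using S smooth_section_iff[OF W] by auto
  show "u \<in> W \<Longrightarrow> tanchor (S u) \<in> tot.ctan u" by (rule tangent_section_ctan[OF W(1) tanchor_section[OF W S]])
  then show "u \<in> W \<Longrightarrow> conj_tv (tanchor (S u)) \<in> tot.ctan u" by (rule tot.ctan_conj)
qed

lemma linear_connection_lin_conn: "linear_connection E lin_conn"
  unfolding linear_connection_def
proof (intro conjI allI impI ballI)
  fix W Z S assume W: "open W" "W \<subseteq> slit E" and Z: "smooth_section E W Z" and S: "smooth_section E W S"
  note D = smooth_sectionD[OF W Z] and P = smooth_sectionD[OF W S]
  show "smooth_section E W (lin_conn W Z S)"
    unfolding smooth_section_iff[OF W] lin_conn_def fst_conv snd_conv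
    using prol_D_section[OF W tanchor_section[OF W Z] P(1)]
      prol_D_section[OF W tangent_section_conj[OF W(1) tanchor_section[OF W Z]] P(2)] by blast
  fix u assume u: "u \<in> W"
  show "lin_conn W (\<lambda>x. tconj (Z x)) (\<lambda>x. tconj (S x)) u = tconj (lin_conn W Z S u)"
    by (simp add: lin_conn_def tanchor_tconj conj_tv_conj) (simp add: tconj_def)
  have mult: "lin_conn W Z (\<lambda>x. tscl E (f x) (S x)) u
      = tadd E (tscl E (f u) (lin_conn W Z S u)) (tscl E (tanchor (Z u) f) (S u))"
    if f: "smooth_at (eatlas E) u f" for f
    using prol_D_mult[where \<xi> = "\<lambda>x. tanchor (Z x)", OF W(1) u D(3)[OF u] P(1) f]
      prol_D_mult[where \<xi> = "\<lambda>x. conj_tv (tanchor (Z x))", OF W(1) u D(4)[OF u] P(2) tot.smooth_at_cnj[OF f]]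
    by (simp add: lin_conn_def tscl_def tadd_def conj_tv_cnj)
  show "lin_conn W Z (\<lambda>x. tscl E (f x) (S x)) u
      = tadd E (tscl E (f u) (lin_conn W Z S u)) (tscl E (tanchor (Z u) f) (S u))"
    if "smooth_fun (eatlas E) W f" for f
    by (rule mult[OF smooth_fun_at[OF W(1) that u]])
  show "lin_conn W Z (\<lambda>x. tscl E r (S x)) u = tscl E r (lin_conn W Z S u)" for r
  proof -
    have z: "pscl E 0 p = pzero E u" if "p \<in> prol E u" for p
      by (rule prol_eqI[OF chart_at[of u]]) (simp_all add: pscl_props[OF chart_at] pzero_props[OF chart_at] that)
    show ?thesis
      using mult[OF tot.smooth_at_const[of u r]] psectionD(1)[OF P(1) u] psectionD(1)[OF P(2) u]
      by (simp add: tot.ctan_const[OF D(3)[OF u]])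
        (simp add: tscl_def tadd_def lin_conn_def z padd_pzero[OF chart_at pscl_props(1)[OF chart_at prol_D_prol]])
  qed
  show "lin_conn W (\<lambda>x. tscl E (f x) (Z x)) S u = tscl E (f u) (lin_conn W Z S u)" for f
    by (simp add: lin_conn_def tanchor_tscl conj_tv_mult prol_D_field_mult) (simp add: tscl_def)
next
  fix W W' Z S Z' S' u
  assume W: "open W" "W \<subseteq> slit E" "open W'" "W' \<subseteq> W" and S: "smooth_section E W' Z'" "smooth_section E W' S'"
    and eq: "\<forall>u\<in>W'. Z u = Z' u \<and> S u = S' u" and u: "u \<in> W'"
  have W': "W' \<subseteq> slit E" using W by blast
  note D = smooth_sectionD[OF W(3) W' S(1)] and P = smooth_sectionD[OF W(3) W' S(2)]
  have "prol_D (\<lambda>x. tanchor (Z' x)) (\<lambda>x. fst (S' x)) u = prol_D (\<lambda>x. tanchor (Z x)) (\<lambda>x. fst (S x)) u"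
    by (rule prol_D_cong[where \<xi> = "\<lambda>x. tanchor (Z' x)", OF W(3) u P(1) D(3)[OF u]]) (use eq u in auto)
  moreover have "prol_D (\<lambda>x. conj_tv (tanchor (Z' x))) (\<lambda>x. snd (S' x)) u = prol_D (\<lambda>x. conj_tv (tanchor (Z x))) (\<lambda>x. snd (S x)) u"
    by (rule prol_D_cong[where \<xi> = "\<lambda>x. conj_tv (tanchor (Z' x))", OF W(3) u P(2) D(4)[OF u]]) (use eq u in auto)
  ultimately show "lin_conn W Z S u = lin_conn W' Z' S' u" by (simp add: lin_conn_def)
next
  fix W Z Z' S u
  show "lin_conn W (\<lambda>x. tadd E (Z x) (Z' x)) S u = tadd E (lin_conn W Z S u) (lin_conn W Z' S u)"
    by (simp add: lin_conn_def tanchor_tadd conj_tv_add prol_D_field_add) (simp add: tadd_def)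
next
  fix W Z S S' u
  assume W: "open W" "W \<subseteq> slit E" and Z: "smooth_section E W Z" and S: "smooth_section E W S" "smooth_section E W S'"
    and u: "u \<in> W"
  note D = smooth_sectionD[OF W Z] and P = smooth_sectionD[OF W S(1)] and P' = smooth_sectionD[OF W S(2)]
  show "lin_conn W Z (\<lambda>x. tadd E (S x) (S' x)) u = tadd E (lin_conn W Z S u) (lin_conn W Z S' u)"
    using prol_D_add[where \<xi> = "\<lambda>x. tanchor (Z x)", OF W(1) u D(3)[OF u] P(1) P'(1)]
      prol_D_add[where \<xi> = "\<lambda>x. conj_tv (tanchor (Z x))", OF W(1) u D(4)[OF u] P(2) P'(2)]
    by (simp add: lin_conn_def tadd_def)
qed

text \<open>As in \<open>vert_conn_frame\<close>: the components are constant, so only the connection form contributes.\<close>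

lemma prol_D_frame:
  assumes c: "c \<in> bcharts E" "u \<in> bdom E c" "u \<in> slit E" and \<xi>: "\<xi> u \<in> tot.ctan u"
    and p: "\<And>x. x \<in> bdom E c \<Longrightarrow> p x = adapted c x a b"
  shows "prol_D \<xi> p u = adapted c u
    (\<chi> \<gamma>. \<Sum>\<sigma>\<in>UNIV. hinv E F c \<sigma> \<gamma> u * (\<Sum>\<alpha>\<in>UNIV. a $ \<alpha> * tot.part10 (echart E c) u (\<xi> u) (hmet E F c \<alpha> \<sigma>)))
    (\<chi> \<gamma>. \<Sum>\<sigma>\<in>UNIV. hinv E F c \<sigma> \<gamma> u * (\<Sum>\<alpha>\<in>UNIV. b $ \<alpha> * tot.part10 (echart E c) u (\<xi> u) (hmet E F c \<alpha> \<sigma>)))"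
proof -
  let ?W = "slit E \<inter> bdom E c"
  have W: "open ?W" "?W \<subseteq> slit E" "?W \<subseteq> bdom E c" "u \<in> ?W" using slit_open bdom_open[OF c(1)] c by auto
  have sec: "psection ?W p"
    by (rule adapted_section[OF c(1) W(1-3), where a = "\<lambda>_. a" and b = "\<lambda>_. b"]) (simp_all add: p tot.smooth_at_const)
  have "\<forall>x\<in>?W. hcomp c (p x) = a" "\<forall>x\<in>?W. vert c x (snd (p x)) = b"
    by (auto simp: p adapted_props[OF c(1)])
  note n = nabla_const[where b = "\<lambda>x. hcomp c (p x)", OF \<xi> W(1,4) this(1)]
    nabla_const[where b = "\<lambda>x. vert c x (snd (p x))", OF \<xi> W(1,4) this(2)]
  show ?thesis unfolding prol_D_chart[where \<xi> = \<xi>, OF W(1,2,4) sec \<xi> c(1,2)] n ..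
qed

lemma prol_D_frame_hol:
  assumes c: "c \<in> bcharts E" "u \<in> bdom E c" "u \<in> slit E" and \<xi>: "\<xi> u \<in> hol_tangent (eatlas E) u"
  shows "prol_D \<xi> (\<lambda>x. adapted c x (axis \<alpha> 1) 0) u = adapted c u (\<chi> \<gamma>. \<Sum>\<sigma>\<in>UNIV. hinv E F c \<sigma> \<gamma> u * \<xi> u (hmet E F c \<alpha> \<sigma>)) 0"
    "prol_D \<xi> (\<lambda>x. adapted c x 0 (axis \<alpha> 1)) u = adapted c u 0 (\<chi> \<gamma>. \<Sum>\<sigma>\<in>UNIV. hinv E F c \<sigma> \<gamma> u * \<xi> u (hmet E F c \<alpha> \<sigma>))"
    "prol_D \<xi> (pzero E) u = pzero E u"
proof -
  have z: "(\<chi> \<gamma>. 0) = (0 :: complex^'m)" by (simp add: vec_eq_iff)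
  note simps = tot.part10_of_hol[OF \<xi> at_echart[OF c(1,2)]] z axis_def
  note fr = prol_D_frame[where \<xi> = \<xi>, OF c tot.hol_tangent_ctan[OF \<xi>]]
  show "prol_D \<xi> (\<lambda>x. adapted c x (axis \<alpha> 1) 0) u = adapted c u (\<chi> \<gamma>. \<Sum>\<sigma>\<in>UNIV. hinv E F c \<sigma> \<gamma> u * \<xi> u (hmet E F c \<alpha> \<sigma>)) 0"
    "prol_D \<xi> (\<lambda>x. adapted c x 0 (axis \<alpha> 1)) u = adapted c u 0 (\<chi> \<gamma>. \<Sum>\<sigma>\<in>UNIV. hinv E F c \<sigma> \<gamma> u * \<xi> u (hmet E F c \<alpha> \<sigma>))"
    by (subst fr[OF refl], simp add: simps if_distrib[of "\<lambda>x. x * _"] cong: if_cong)+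
  show "prol_D \<xi> (pzero E) u = pzero E u"
    using fr[of "pzero E" 0 0] adapted_zero[OF c(1)] c(2) by (simp add: z)
qed

text \<open>The connection form vanishes on vectors of type (0,1).\<close>

lemma prol_D_frame_conj:
  assumes c: "c \<in> bcharts E" "u \<in> bdom E c" "u \<in> slit E" and \<xi>: "\<xi> u \<in> hol_tangent (eatlas E) u"
    and p: "\<And>x. x \<in> bdom E c \<Longrightarrow> p x = adapted c x a b"
  shows "prol_D (\<lambda>x. conj_tv (\<xi> x)) p u = pzero E u"
proof -
  have z: "(\<chi> \<gamma>. 0) = (0 :: complex^'m)" by (simp add: vec_eq_iff)
  note ct = tot.ctan_conj[OF tot.hol_tangent_ctan[OF \<xi>]]
  show ?thesis
    by (subst prol_D_frame[where \<xi> = "\<lambda>x. conj_tv (\<xi> x)", OF c ct p], assumption)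
      (simp add: tot.part10_conj[OF \<xi> at_echart[OF c(1,2)]] z adapted_zero[OF c(1,2)])
qed

text \<open>The four covariant derivatives prescribed by the definition, for an arbitrary differentiating
  field \<open>Z\<close> of type (1,0), and those of the conjugate frame.\<close>

lemma lin_conn_frame:
  assumes c: "c \<in> bcharts E" "u \<in> bdom E c" "u \<in> slit E" and Z: "tanchor (Z u) \<in> hol_tangent (eatlas E) u"
    and L: "\<And>\<gamma>. L \<gamma> = (\<Sum>\<sigma>\<in>UNIV. hinv E F c \<sigma> \<gamma> u * tanchor (Z u) (hmet E F c \<alpha> \<sigma>))"
  shows "lin_conn W Z (frameX E (cfN E F) c \<alpha>) u = tsum E u (\<lambda>\<gamma>. tscl E (L \<gamma>) (frameX E (cfN E F) c \<gamma> u))"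
    "lin_conn W Z (frameV E c \<alpha>) u = tsum E u (\<lambda>\<gamma>. tscl E (L \<gamma>) (frameV E c \<gamma> u))"
    "lin_conn W Z (\<lambda>u. tconj (frameX E (cfN E F) c \<alpha> u)) u = tsum E u (\<lambda>\<gamma>. tscl E 0 (tconj (frameX E (cfN E F) c \<gamma> u)))"
    "lin_conn W Z (\<lambda>u. tconj (frameV E c \<alpha> u)) u = tsum E u (\<lambda>\<gamma>. tscl E 0 (tconj (frameV E c \<gamma> u)))"
proof -
  let ?\<xi> = "\<lambda>x. tanchor (Z x)" and ?X = "\<lambda>x. adapted c x (axis \<alpha> 1) 0" and ?V = "\<lambda>x. adapted c x 0 (axis \<alpha> 1)"
  let ?W = "slit E \<inter> bdom E c"
  have z: "(\<chi> \<gamma>. 0) = (0 :: complex^'m)" by (simp add: vec_eq_iff)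
  have W: "open ?W" "?W \<subseteq> slit E" "?W \<subseteq> bdom E c" "u \<in> ?W" using slit_open bdom_open[OF c(1)] c by auto
  have sec: "psection ?W (\<lambda>x. adapted c x a b)" for a b
    by (rule adapted_section[OF c(1) W(1-3), where a = "\<lambda>_. a" and b = "\<lambda>_. b"]) (simp_all add: tot.smooth_at_const)
  note ct = tot.hol_tangent_ctan[OF Z]
  note loc = prol_D_cong[where \<xi>' = ?\<xi> and \<xi> = ?\<xi>, OF W(1,4) sec ct refl]
    prol_D_cong[where \<xi>' = "\<lambda>x. conj_tv (tanchor (Z x))" and \<xi> = "\<lambda>x. conj_tv (tanchor (Z x))", OF W(1,4) sec tot.ctan_conj[OF ct] refl]
  note hol = prol_D_frame_hol[where \<xi> = ?\<xi>, OF c Z]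
  note cnj = prol_D_frame_conj[where \<xi> = ?\<xi>, OF c Z]
  have X: "prol_D ?\<xi> (\<lambda>x. fst (frameX E (cfN E F) c \<alpha> x)) u = adapted c u (\<chi> \<gamma>. L \<gamma>) 0"
    unfolding L hol(1)[symmetric] by (rule loc(1)[symmetric]) (simp add: frameX_adapted[OF c(1)])
  have V: "prol_D ?\<xi> (\<lambda>x. fst (frameV E c \<alpha> x)) u = adapted c u 0 (\<chi> \<gamma>. L \<gamma>)"
    unfolding L hol(2)[symmetric] by (rule loc(1)[symmetric]) (simp add: frameV_adapted[OF c(1)])
  have X': "prol_D (\<lambda>x. conj_tv (tanchor (Z x))) (\<lambda>x. fst (frameX E (cfN E F) c \<alpha> x)) u = pzero E u"
    by (rule cnj) (simp add: frameX_adapted[OF c(1)])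
  have V': "prol_D (\<lambda>x. conj_tv (tanchor (Z x))) (\<lambda>x. fst (frameV E c \<alpha> x)) u = pzero E u"
    by (rule cnj) (simp add: frameV_adapted[OF c(1)])
  have 0: "prol_D (\<lambda>x. conj_tv (tanchor (Z x))) (pzero E) u = pzero E u"
    by (rule cnj[where a = 0 and b = 0]) (simp add: adapted_zero[OF c(1)])
  have sX: "prol_D \<xi> (\<lambda>x. snd (frameX E (cfN E F) c \<alpha> x)) u = prol_D \<xi> (pzero E) u"
    if "\<xi> u \<in> tot.ctan u" for \<xi>
    by (rule prol_D_cong[where \<xi> = \<xi> and \<xi>' = \<xi>, OF W(1,4) _ that refl, symmetric])
      (use adapted_section[OF c(1) W(1-3), where p = "pzero E" and a = "\<lambda>_. 0" and b = "\<lambda>_. 0"] in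
        \<open>simp_all add: adapted_zero[OF c(1)] tot.smooth_at_const frameX_adapted[OF c(1)]\<close>)
  have sV: "(\<lambda>x. snd (frameV E c \<alpha> x)) = pzero E" by (simp add: frameV_def fun_eq_iff)
  show "lin_conn W Z (frameX E (cfN E F) c \<alpha>) u = tsum E u (\<lambda>\<gamma>. tscl E (L \<gamma>) (frameX E (cfN E F) c \<gamma> u))"
    by (simp add: lin_conn_def X sX[where \<xi> = "\<lambda>x. conj_tv (tanchor (Z x))", OF tot.ctan_conj[OF ct]] 0 tsum_def tscl_def frameX_adapted[OF c(1,2)] psum_adapted[OF c(1,2)])
  show "lin_conn W Z (frameV E c \<alpha>) u = tsum E u (\<lambda>\<gamma>. tscl E (L \<gamma>) (frameV E c \<gamma> u))"
    by (simp add: lin_conn_def V sV 0 tsum_def tscl_def frameV_adapted[OF c(1,2)] psum_adapted[OF c(1,2)])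
  show "lin_conn W Z (\<lambda>u. tconj (frameX E (cfN E F) c \<alpha> u)) u = tsum E u (\<lambda>\<gamma>. tscl E 0 (tconj (frameX E (cfN E F) c \<gamma> u)))"
    by (simp add: lin_conn_def tconj_def X' sX[where \<xi> = ?\<xi>, OF ct] hol(3) tsum_def tscl_def frameX_adapted[OF c(1,2)] psum_adapted[OF c(1,2)]
        z adapted_zero[OF c(1,2)])
  show "lin_conn W Z (\<lambda>u. tconj (frameV E c \<alpha> u)) u = tsum E u (\<lambda>\<gamma>. tscl E 0 (tconj (frameV E c \<gamma> u)))"
    by (simp add: lin_conn_def tconj_def V' sV hol(3) tsum_def tscl_def frameV_adapted[OF c(1,2)] psum_adapted[OF c(1,2)]
        z adapted_zero[OF c(1,2)])
qed

lemma cfL_deltaA: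
  "cfL E F c \<gamma> \<alpha> \<beta> u = (\<Sum>\<sigma>\<in>UNIV. hinv E F c \<sigma> \<gamma> u * deltaA E (cfN E F) c \<beta> u (hmet E F c \<alpha> \<sigma>))"
  unfolding cfL_def cfLk_def deltaA_def sum_distrib_left by (subst sum.swap) (simp add: ac_simps)

lemma coeffs_lin_conn:
  assumes c: "c \<in> bcharts E"
  shows "pure_coeffs E (cfN E F) lin_conn c (cfL E F c) (cfC E F c)"
    "mixed_coeffs E (cfN E F) lin_conn c (\<lambda>_ _ _ _. 0) (\<lambda>_ _ _ _. 0)"
proof -
  have X: "tanchor (frameX E (cfN E F) c \<beta> u) \<in> hol_tangent (eatlas E) u" if "u \<in> bdom E c" for \<beta> u
    unfolding tanchor_frameX[OF c that] by (rule deltaA_hol[OF c that])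
  have V: "tanchor (frameV E c \<beta> u) \<in> hol_tangent (eatlas E) u" if "u \<in> bdom E c" for \<beta> u
    unfolding tanchor_frameV[OF c that] by (rule evec_hol[OF c that])
  have LX: "cfL E F c \<gamma> \<alpha> \<beta> u = (\<Sum>\<sigma>\<in>UNIV. hinv E F c \<sigma> \<gamma> u * tanchor (frameX E (cfN E F) c \<beta> u) (hmet E F c \<alpha> \<sigma>))"
    if "u \<in> bdom E c" for \<gamma> \<alpha> \<beta> u
    unfolding tanchor_frameX[OF c that] by (rule cfL_deltaA)
  have LV: "cfC E F c \<gamma> \<alpha> \<beta> u = (\<Sum>\<sigma>\<in>UNIV. hinv E F c \<sigma> \<gamma> u * tanchor (frameV E c \<beta> u) (hmet E F c \<alpha> \<sigma>))"
    if "u \<in> bdom E c" for \<gamma> \<alpha> \<beta> u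
    unfolding tanchor_frameV[OF c that] cfC_def ..
  show "pure_coeffs E (cfN E F) lin_conn c (cfL E F c) (cfC E F c)"
    unfolding pure_coeffs_def Let_def
    by (intro ballI allI conjI lin_conn_frame(1,2)[OF c] X V LX LV) auto
  show "mixed_coeffs E (cfN E F) lin_conn c (\<lambda>_ _ _ _. 0) (\<lambda>_ _ _ _. 0)"
    unfolding mixed_coeffs_def Let_def
    by (intro ballI allI conjI lin_conn_frame(3,4)[OF c _ _ X refl] lin_conn_frame(3,4)[OF c _ _ V refl]) auto
qed

end

theorem theorem2p8:
  fixes E :: "('b::{t2_space,second_countable_topology}, 'e::topological_space, 'n::finite, 'm::finite) algebroid"
    and F :: "'e \<Rightarrow> real"
  assumes "holomorphic_lie_algebroid E"
    and "complex_finsler E F"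
    and "convex_finsler E F"
  shows "nonlinear_connection E (cfN E F) \<and>
    (\<forall>c\<in>bcharts E. \<forall>u\<in>slit E \<inter> bdom E c. \<forall>\<gamma> \<alpha> \<beta>.
       cfL E F c \<gamma> \<alpha> \<beta> u =
         (\<Sum>\<sigma>\<in>UNIV. hinv E F c \<sigma> \<gamma> u * deltaA E (cfN E F) c \<beta> u (hmet E F c \<alpha> \<sigma>))) \<and>
    (\<exists>Dv D.
       vertical_connection E Dv \<and>
       (\<forall>c\<in>bcharts E. vertical_coeffs E (cfN E F) Dv c (cfLk E F c) (cfC E F c)) \<and>
       normal_linear_connection E (cfN E F) D \<and>
       type_10 E (cfN E F) D \<and>
       induced_by_vertical E (cfN E F) D Dv \<and>
       (\<forall>c\<in>bcharts E. pure_coeffs E (cfN E F) D c (cfL E F c) (cfC E F c)))"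
proof -
  interpret finsler_algebroid E F
    by unfold_locales (use assms in \<open>auto simp: holomorphic_lie_algebroid_def\<close>)
  have normal: "normal_linear_connection E (cfN E F) lin_conn"
    unfolding normal_linear_connection_def using linear_connection_lin_conn coeffs_lin_conn by blast
  have type: "type_10 E (cfN E F) lin_conn"
    unfolding type_10_def using coeffs_lin_conn(2) by blast
  have "pure_coeffs E (cfN E F) lin_conn c
      (\<lambda>\<gamma> \<alpha> \<beta> u. \<Sum>k\<in>UNIV. rho E c k \<beta> (proj E u) * cfLk E F c \<gamma> \<alpha> k u) (cfC E F c)" if "c \<in> bcharts E" for c
    using coeffs_lin_conn(1)[OF that] unfolding cfL_def[abs_def] .
  then have induced: "induced_by_vertical E (cfN E F) lin_conn vert_conn"
    unfolding induced_by_vertical_def using vertical_coeffs_vert_conn by blast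
  show ?thesis
    using nonlinear_connection_cfN cfL_deltaA vertical_connection_vert_conn vertical_coeffs_vert_conn
      normal type induced coeffs_lin_conn(1) by blast
qed

end
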